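(* Consider the system with unknown constant disturbance $\Delta\in\mathbb R^3$, $\|\Delta\|\le\delta$, $$\dot R=R\hat\Omega,\qquad\mathbb I\dot\Omega=(\mathbb I\Omega)\times\Omega+\tau+\Delta.$$ Let $k_R,k_\Omega,k_\Delta,a,\mu,\epsilon,\theta_{b_0},\gamma$ be positive numbers such that $0<a<1$, $0<\epsilon<1$, $$0<\mu<\frac{4(1-a)k_Rk_\Omega}{4(1-a)k_R+k_\Omega^2},\qquad B:=2a\frac{\sqrt{k_R}-\mu}{\sqrt{k_R}+\mu}k_R-\frac1{2k_\Delta}\delta^2>0,$$ and, for the initial attitude angle $\theta_0>0$, $$\theta_{b_0}\in(0,\theta_0),\qquad1-\cos(\theta_0-\theta_{b_0})\le\left(2a\frac{\sqrt{k_R}-\mu}{\sqrt{k_R}+\mu}-\frac1{2k_\Delta k_R}\delta^2\right)\epsilon,\qquad\gamma<\frac2{\theta_{b_0}}\sqrt{2(1-\epsilon)B}.$$ Let the control input and adaptive law be: when $V_0(R(0),\Omega(0),0)\le B$, $$\tau=-(\mathbb I\Omega)\times\Omega+\mathbb I(-k_Re_R-k_\Omega e_\Omega+\Omega\times\Omega_d+\dot\Omega_d)-\bar\Delta,\qquad\dot{\bar\Delta}=k_\Delta\mathbb I^{-1}(e_\Omega+\mu e_R);$$ and when $V_0(R(0),\Omega(0),0)>B$, $$\tau=-(\mathbb I\Omega)\times\Omega+\mathbb I(-k_R\tilde e_R-k_\Omega\tilde e_\Omega+\Omega\times\tilde\Omega_d+\dot{\tilde\Omega}_d)-\bar\Delta,\qquad\dot{\bar\Delta}=k_\Delta\mathbb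 I^{-1}(\tilde e_\Omega+\mu\tilde e_R);$$ with $\bar\Delta(0)=0$ in both cases. Define $$\mathcal R=\Big\{(R(0),\Omega(0))\in \mathrm{SO}(3)\times\mathbb R^3\ \Big|\ \|e_\Omega(0)\|<\max\big\{\sqrt{B-k_R(1-\cos\theta_0)},\ \sqrt{2(1-\epsilon)B}-\tfrac\gamma2\theta_{b_0}\big\}\Big\}.$$ Then the region of attraction guaranteeing asymptotic convergence contains $\mathcal R$: for every initial state $(R(0),\Omega(0))\in\mathcal R$, the errors $\|E_R(t)\|$, $\|e_\Omega(t)\|$ and $\|e_\Delta(t)\|$ converge to zero as $t\to\infty$. Furthermore, $\mathcal R$ covers $\mathrm{SO}(3)$ completely, i.e., for every $R(0)\in \mathrm{SO}(3)$ there is $\Omega(0)\in\mathbb R^3$ with $(R(0),\Omega(0))\in\mathcal R$; and $\mathcal R$ is enlarged to all of $\mathbb R^3$ in the angular velocity in the semi-global sense as $k_R$ is increased, i.e., for each $R(0)$, with the other parameters fixed, the upper bound on $\|e_\Omega(0)\|$ in the definition of $\mathcal R$ tends to infinity as $k_R\to\infty$.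
   Context: $\|A\|^2=\operatorname{tr}(A^TA)$ for a matrix or vector $A$. The hat map is defined by $\hat v w=v\times w$ for $v,w\in\mathbb R^3$; $\vee$ is its inverse on skew-symmetric matrices. $e_3=(0,0,1)$, $Z_\theta=\exp(\theta\hat e_3)$. $\mathbb I\in\mathbb R^{3\times3}$ is a symmetric positive-definite (inertia) matrix, $R\in \mathrm{SO}(3)$ the attitude, $\Omega\in\mathbb R^3$ the angular velocity, $\bar\Delta\in\mathbb R^3$ the disturbance estimate, $\delta>0$ a known bound on the disturbance. $(R_d(t),\Omega_d(t))\in \mathrm{SO}(3)\times\mathbb R^3$, $t\ge0$, is a given smooth reference trajectory with $\dot R_d=R_d\hat\Omega_d$, such that $\Omega_d(t)$ and $\dot\Omega_d(t)$ are bounded. Errors: $E_R=R-R_d$, $e_\Omega=\Omega-\Omega_d$, $e_\Delta=\Delta-\bar\Delta$, $e_R=\frac12(R_d^TR-R^TR_d)^\vee$, and $V_0(R,\Omega,t)=\frac{k_R}4\|E_R\|^2+\frac12\|e_\Omega\|^2$. Shifted reference: given $R(0)$, let $\theta_0\in[0,\pi]$ be the unique angle for which there is $U_0\in \mathrm{SO}(3)$ with $R(0)=U_0Z_{\theta_0}U_0^TR_d(0)$, and fix such a $U_0$. With $\theta_{b_0}\in(0,\theta_0)$ and $\gamma$ (which may be chosen depending on the initial attitude) set $$\theta_b(t)=\theta_{b_0}e^{-\frac\gamma2t},\quad\tilde R_d(t)=U_0Z_{\theta_b(t)}U_0^TR_d(t),\quad\tilde\Omega_d(t)=\Omega_d(t)+\dot\theta_b(t)\tilde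 R_d(t)^TU_0e_3,$$ so that $\dot{\tilde R}_d=\tilde R_d\hat{\tilde\Omega}_d$. The shifted errors are $\tilde e_R=\frac12(\tilde R_d^TR-R^T\tilde R_d)^\vee$ and $\tilde e_\Omega=\Omega-\tilde\Omega_d$. Convention in the definition of $\mathcal R$: the first entry of the maximum is omitted when $B-k_R(1-\cos\theta_0)<0$, and the second entry is omitted when $\theta_0=0$ (no $\theta_{b_0}\in(0,\theta_0)$ exists then). *)

theory Defs
  imports "HOL-Analysis.Analysis"
begin

definition SO3 :: "(real^3^3) set" where
  "SO3 = {Q. rotation_matrix Q}"

definition hat :: "real^3 \<Rightarrow> real^3^3" where
  "hat v = matrix (\<lambda>w. cross3 v w)"

(* Meaningful on skew-symmetric matrices only (the range of hat). *)
definition vee :: "real^3^3 \<Rightarrow> real^3" where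
  "vee A = the_inv hat A"

(* The type class function exp is not usable here: the product of the type
   real^3^3 is the componentwise one. *)
definition mat_exp :: "real^'n^'n \<Rightarrow> real^'n^'n" where
  "mat_exp A = (\<Sum>n. (1 / fact n) *\<^sub>R (((**) A) ^^ n) (mat 1))"

definition e3 :: "real^3" where
  "e3 = vector [0, 0, 1]"

definition Zrot :: "real \<Rightarrow> real^3^3" where
  "Zrot \<theta> = mat_exp (\<theta> *\<^sub>R hat e3)"

definition sym_pos_def :: "real^'n^'n \<Rightarrow> bool" where
  "sym_pos_def M \<longleftrightarrow> transpose M = M \<and> (\<forall>x. x \<noteq> 0 \<longrightarrow> 0 < x \<bullet> (M *v x))"

(* Signals live on the time axis t >= 0; the derivative at t = 0 is one-sided. *)
definition tderiv :: "(real \<Rightarrow> 'a::real_normed_vector) \<Rightarrow> real \<Rightarrow> 'a" where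
  "tderiv f t = vector_derivative f (at t within {0..})"

definition smooth_signal :: "(real \<Rightarrow> 'a::real_normed_vector) \<Rightarrow> bool" where
  "smooth_signal f \<longleftrightarrow> (\<forall>n. (tderiv ^^ n) f differentiable_on {0..})"

definition reference_trajectory :: "(real \<Rightarrow> real^3^3) \<Rightarrow> (real \<Rightarrow> real^3) \<Rightarrow> bool" where
  "reference_trajectory Rd \<Omega>d \<longleftrightarrow>
     smooth_signal Rd \<and> smooth_signal \<Omega>d \<and>
     (\<forall>t\<ge>0. Rd t \<in> SO3 \<and>
            (Rd has_vector_derivative Rd t ** hat (\<Omega>d t)) (at t within {0..})) \<and>
     bounded (\<Omega>d ` {0..}) \<and> bounded (tderiv \<Omega>d ` {0..})"

definition e_R :: "real^3^3 \<Rightarrow> real^3^3 \<Rightarrow> real^3" where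
  "e_R Rr R = (1/2) *\<^sub>R vee (transpose Rr ** R - transpose R ** Rr)"

(* norm on real^3^3 is the Frobenius norm *)
definition V0 :: "real \<Rightarrow> (real \<Rightarrow> real^3^3) \<Rightarrow> (real \<Rightarrow> real^3) \<Rightarrow>
    real^3^3 \<Rightarrow> real^3 \<Rightarrow> real \<Rightarrow> real" where
  "V0 kR Rd \<Omega>d R \<Omega> t = kR / 4 * (norm (R - Rd t))\<^sup>2 + 1/2 * (norm (\<Omega> - \<Omega>d t))\<^sup>2"

definition initial_angle :: "real^3^3 \<Rightarrow> real^3^3 \<Rightarrow> real" where
  "initial_angle Rd0 R0 =
     (THE \<theta>. \<theta> \<in> {0..pi} \<and> (\<exists>U\<in>SO3. R0 = U ** Zrot \<theta> ** transpose U ** Rd0))"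

definition shift_angle :: "real \<Rightarrow> real \<Rightarrow> real \<Rightarrow> real" where
  "shift_angle \<theta>b0 \<gamma> t = \<theta>b0 * exp (- (\<gamma> / 2) * t)"

definition shifted_Rd :: "real^3^3 \<Rightarrow> real \<Rightarrow> real \<Rightarrow> (real \<Rightarrow> real^3^3) \<Rightarrow> real \<Rightarrow> real^3^3" where
  "shifted_Rd U0 \<theta>b0 \<gamma> Rd t = U0 ** Zrot (shift_angle \<theta>b0 \<gamma> t) ** transpose U0 ** Rd t"

definition shifted_\<Omega>d :: "real^3^3 \<Rightarrow> real \<Rightarrow> real \<Rightarrow> (real \<Rightarrow> real^3^3) \<Rightarrow> (real \<Rightarrow> real^3) \<Rightarrow>
    real \<Rightarrow> real^3" where
  "shifted_\<Omega>d U0 \<theta>b0 \<gamma> Rd \<Omega>d t =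
     \<Omega>d t + tderiv (shift_angle \<theta>b0 \<gamma>) t *\<^sub>R (transpose (shifted_Rd U0 \<theta>b0 \<gamma> Rd t) *v (U0 *v e3))"

definition plant :: "real^3^3 \<Rightarrow> real^3 \<Rightarrow> (real \<Rightarrow> real^3) \<Rightarrow>
    (real \<Rightarrow> real^3^3) \<Rightarrow> (real \<Rightarrow> real^3) \<Rightarrow> bool" where
  "plant J \<Delta> \<tau> R \<Omega> \<longleftrightarrow>
     (\<forall>t\<ge>0. R t \<in> SO3 \<and>
        (R has_vector_derivative R t ** hat (\<Omega> t)) (at t within {0..}) \<and>
        (\<exists>d\<Omega>. (\<Omega> has_vector_derivative d\<Omega>) (at t within {0..}) \<and>
              J *v d\<Omega> = cross3 (J *v \<Omega> t) (\<Omega> t) + \<tau> t + \<Delta>))"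

(* Control input and adaptive law tracking an arbitrary reference (Rr, \<Omega>r): both the
   original and the shifted reference are plugged in below. Db is the estimate of \<Delta>. *)
definition adaptive_tracking :: "real^3^3 \<Rightarrow> real \<Rightarrow> real \<Rightarrow> real \<Rightarrow> real \<Rightarrow>
    (real \<Rightarrow> real^3^3) \<Rightarrow> (real \<Rightarrow> real^3) \<Rightarrow>
    (real \<Rightarrow> real^3^3) \<Rightarrow> (real \<Rightarrow> real^3) \<Rightarrow> (real \<Rightarrow> real^3) \<Rightarrow> (real \<Rightarrow> real^3) \<Rightarrow> bool" where
  "adaptive_tracking J kR k\<Omega> k\<Delta> \<mu> Rr \<Omega>r R \<Omega> Db \<tau> \<longleftrightarrow>
     Db 0 = 0 \<and>
     (\<forall>t\<ge>0.
        \<tau> t = - cross3 (J *v \<Omega> t) (\<Omega> t)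
              + J *v (- kR *\<^sub>R e_R (Rr t) (R t) - k\<Omega> *\<^sub>R (\<Omega> t - \<Omega>r t)
                      + cross3 (\<Omega> t) (\<Omega>r t) + tderiv \<Omega>r t)
              - Db t \<and>
        (Db has_vector_derivative
           k\<Delta> *\<^sub>R (matrix_inv J *v ((\<Omega> t - \<Omega>r t) + \<mu> *\<^sub>R e_R (Rr t) (R t))))
          (at t within {0..}))"

definition level_B :: "real \<Rightarrow> real \<Rightarrow> real \<Rightarrow> real \<Rightarrow> real \<Rightarrow> real" where
  "level_B a \<mu> k\<Delta> \<delta> kR =
     2 * a * ((sqrt kR - \<mu>) / (sqrt kR + \<mu>)) * kR - 1 / (2 * k\<Delta>) * \<delta>\<^sup>2"

definition closed_loop :: "real^3^3 \<Rightarrow> real \<Rightarrow> real \<Rightarrow> real \<Rightarrow> real \<Rightarrow> real \<Rightarrow> real \<Rightarrow>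
    (real \<Rightarrow> real^3^3) \<Rightarrow> (real \<Rightarrow> real^3) \<Rightarrow> real^3^3 \<Rightarrow> real \<Rightarrow> real \<Rightarrow> real^3 \<Rightarrow>
    (real \<Rightarrow> real^3^3) \<Rightarrow> (real \<Rightarrow> real^3) \<Rightarrow> (real \<Rightarrow> real^3) \<Rightarrow> (real \<Rightarrow> real^3) \<Rightarrow> bool" where
  "closed_loop J kR k\<Omega> k\<Delta> a \<mu> \<delta> Rd \<Omega>d U0 \<theta>b0 \<gamma> \<Delta> R \<Omega> Db \<tau> \<longleftrightarrow>
     plant J \<Delta> \<tau> R \<Omega> \<and>
     (if V0 kR Rd \<Omega>d (R 0) (\<Omega> 0) 0 \<le> level_B a \<mu> k\<Delta> \<delta> kR
      then adaptive_tracking J kR k\<Omega> k\<Delta> \<mu> Rd \<Omega>d R \<Omega> Db \<tau>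
      else adaptive_tracking J kR k\<Omega> k\<Delta> \<mu>
             (shifted_Rd U0 \<theta>b0 \<gamma> Rd) (shifted_\<Omega>d U0 \<theta>b0 \<gamma> Rd \<Omega>d) R \<Omega> Db \<tau>)"

(* The two entries are dropped by convention under the conditions shown; when
   level_B > 0 at least one of them remains. *)
definition rate_bound :: "real \<Rightarrow> real \<Rightarrow> real \<Rightarrow> real \<Rightarrow> real \<Rightarrow> real \<Rightarrow> real \<Rightarrow> real \<Rightarrow> real \<Rightarrow> real" where
  "rate_bound a \<mu> \<epsilon> k\<Delta> \<delta> \<theta>0 \<theta>b0 \<gamma> kR =
     (let B = level_B a \<mu> k\<Delta> \<delta> kR in
      Max ((if B - kR * (1 - cos \<theta>0) < 0 then {} else {sqrt (B - kR * (1 - cos \<theta>0))}) \<union>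
           (if \<theta>0 = 0 then {} else {sqrt (2 * (1 - \<epsilon>) * B) - \<gamma> / 2 * \<theta>b0})))"

(* \<theta>b0 and \<gamma> are chosen as functions of the initial attitude. *)
definition region :: "real \<Rightarrow> real \<Rightarrow> real \<Rightarrow> real \<Rightarrow> real \<Rightarrow> real \<Rightarrow>
    (real^3^3 \<Rightarrow> real) \<Rightarrow> (real^3^3 \<Rightarrow> real) \<Rightarrow> (real \<Rightarrow> real^3^3) \<Rightarrow> (real \<Rightarrow> real^3) \<Rightarrow>
    ((real^3^3) \<times> (real^3)) set" where
  "region a \<mu> \<epsilon> k\<Delta> \<delta> kR \<theta>b0 \<gamma> Rd \<Omega>d =
     {(R0, \<Omega>0). R0 \<in> SO3 \<and>
        norm (\<Omega>0 - \<Omega>d 0)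
          < rate_bound a \<mu> \<epsilon> k\<Delta> \<delta> (initial_angle (Rd 0) R0) (\<theta>b0 R0) (\<gamma> R0) kR}"

end

theory Submission
  imports Defs
begin

text \<open>Both control laws track a reference $(R_r,\Omega_r)$, the original one or the shifted one, and are treated
  at once. Put $Q = R_r^T R$, $q = (3 - \mathrm{tr}\, Q)/2 = \frac14\|R - R_r\|^2$, $s = e_R$, $e = e_\Omega$,
  $d = e_\Delta$. Along the closed loop the function
  $V = k_R q + \frac12 |e|^2 + \mu\, s \cdot e + \frac1{2k_\Delta} |d|^2$ satisfies
  $\dot V \le - l (|s|^2 + |e|^2)$ with $l > 0$; the parameter estimate cancels the disturbance because the inertia
  matrix is symmetric. If the energy $k_R q + \frac12|e|^2$ is initially at most $B$, monotonicity of $V$ keeps it below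
  $2 a k_R$, so $q \le 2a < 2$. Since $|s|^2 = q (2 - q)$, the attitude stays away from the antipodal
  equilibria, where $s$ vanishes although $q = 2$, and $s \to 0$ forces $q \to 0$. Then $d \to 0$ because
  $\dot e - \mathbb I^{-1} d \to 0$ and $\dot d \to 0$. When the initial energy exceeds $B$, the shifted reference
  starts close enough to $R(0)$ to bring the energy down to $B$, and it converges to the original one.\<close>

subsection \<open>Rotation matrices\<close>

text \<open>The analysis is circular at first sight: the energy bound speaks about a solution, while
  a solution on the whole half-line needs the energy bound, since the product of \<open>R\<close>
  and \<open>hat \<Omega>\<close> is only locally Lipschitz. All estimates are therefore proved on
  an unspecified interval, compact or the whole half-line. The compact case shows that a globally
  Lipschitz truncation of the loop never leaves the set where it agrees with the loop; the other
  case gives the limits. Origin of \<open>B\<close>: the cross term in V is at most r = \<mu> / sqrt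
  kR times the energy, so V lies between (1 - r) and (1 + r) times the energy, up to the term in d.
  That term starts at most at D = \<delta>^2 / (2 k\<Delta>), because the estimate starts at 0.
  \<open>B\<close> is small enough that (1 + r) B + D \<le> (1 - r) 2 a kR. In the shifted case
  \<epsilon> divides \<open>B\<close>: the part \<epsilon> B is for the attitude error left after
  the shift, the part (1 - \<epsilon>) B for the velocity error, which the motion of the shifted
  reference enlarges by at most \<gamma> \<theta>b0 / 2. Facts about a single rotation are reduced
  to a planar rotation by an angle t in a frame of its axis, where q = 1 - cos t and |s| = |sin
  t|.\<close>

definition skew_vec :: "real^3^3 \<Rightarrow> real^3" where
  "skew_vec A = (1/2) *\<^sub>R vector [A$3$2 - A$2$3, A$1$3 - A$3$1, A$2$1 - A$1$2]"

section \<open>Coordinates for the hat map and for 3 by 3 matrices\<close>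

lemma hat_eq:
  "hat v = vector [vector [0, - v$3, v$2], vector [v$3, 0, - v$1], vector [- v$2, v$1, 0]]"
  by (simp add: hat_def matrix_def axis_def cross3_def vec_eq_iff forall_3)

lemma hat_mult: "hat v *v w = cross3 v w"
  by (simp add: hat_eq matrix_vector_mult_def cross3_def vec_eq_iff forall_3 sum_3)

lemma hat_nth [simp]:
  "hat v $ 1 $ 1 = 0" "hat v $ 1 $ 2 = - v$3" "hat v $ 1 $ 3 = v$2"
  "hat v $ 2 $ 1 = v$3" "hat v $ 2 $ 2 = 0" "hat v $ 2 $ 3 = - v$1"
  "hat v $ 3 $ 1 = - v$2" "hat v $ 3 $ 2 = v$1" "hat v $ 3 $ 3 = 0"
  by (simp_all add: hat_eq)

lemma vee_hat: "vee (hat v) = v"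
proof -
  have "inj hat"
    by (rule injI) (simp add: vec_eq_iff forall_3)
  then show ?thesis by (simp add: vee_def the_inv_f_f)
qed

lemma matrix_mult_nth3: "(A ** B) $ i $ j = A$i$1 * B$1$j + A$i$2 * B$2$j + A$i$3 * (B::real^3^3)$3$j"
  by (simp add: matrix_matrix_mult_def sum_3)

lemma matrix_vector_mult_nth3: "(A *v x) $ i = A$i$1 * x$1 + A$i$2 * x$2 + A$i$3 * (x::real^3)$3"
  by (simp add: matrix_vector_mult_def sum_3)

lemma transpose_nth: "transpose A $ i $ j = A $ j $ i"
  by (simp add: transpose_def)

lemma mat_nth: "mat c $ i $ j = (if i = j then c else 0)"
  by (simp add: mat_def)

lemma skew_vec_nth [simp]:
  "skew_vec A $ 1 = (A$3$2 - A$2$3) / 2" "skew_vec A $ 2 = (A$1$3 - A$3$1) / 2"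
  "skew_vec A $ 3 = (A$2$1 - A$1$2) / 2"
  by (simp_all add: skew_vec_def)

lemmas mat3_simps = vec_eq_iff forall_3 matrix_mult_nth3 matrix_vector_mult_nth3 transpose_nth mat_nth

lemma hat_skew_vec: "hat (2 *\<^sub>R skew_vec A) = A - transpose A"
  by (simp add: mat3_simps field_simps)

text \<open>\<open>vee\<close> is meaningful only on the range of \<open>hat\<close>. The difference
  inside \<open>e_R\<close> is skew-symmetric, and \<open>skew_vec\<close>, which is linear on all
  matrices, recovers the same vector, so the error can be differentiated by the rules for bounded
  linear maps.\<close>

lemma e_R_eq: "e_R A B = skew_vec (transpose A ** B)"
proof -
  have "transpose A ** B - transpose B ** A = hat (2 *\<^sub>R skew_vec (transpose A ** B))"
    by (simp add: hat_skew_vec matrix_transpose_mul)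
  then show ?thesis by (simp add: e_R_def vee_hat)
qed

text \<open>\<open>hat e3\<close> acts on the plane of the first two axes as multiplication by the
  imaginary unit. The coefficients of its powers are thus real and imaginary parts of
  \<open>(\<i> * t) ^ n\<close>, and the complex exponential series supplies cosine and
  sine.\<close>

lemma Zrot_eq:
  "Zrot t = vector [vector [cos t, - sin t, 0], vector [sin t, cos t, 0], vector [0, 0, 1]]"
proof -
  \<comment> \<open>Projection onto the plane, quarter turn in the plane, projection onto the axis.
    The last one occurs only in the zeroth power.\<close>
  define E1 :: "real^3^3" where "E1 = vector [vector [1,0,0], vector [0,1,0], vector [0,0,0]]"
  define E2 :: "real^3^3" where "E2 = vector [vector [0,-1,0], vector [1,0,0], vector [0,0,0]]"
  define E3 :: "real^3^3" where "E3 = vector [vector [0,0,0], vector [0,0,0], vector [0,0,1]]"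
  note E = E1_def E2_def E3_def
  define A where "A = t *\<^sub>R hat e3"
  have pow: "(((**) A) ^^ n) (mat 1) =
      Re ((\<i> * t) ^ n) *\<^sub>R E1 + Im ((\<i> * t) ^ n) *\<^sub>R E2 + (if n = 0 then 1 else 0) *\<^sub>R E3" for n
  proof (induction n)
    case 0
    show ?case by (simp add: mat3_simps E)
  next
    case (Suc n)
    show ?case
      by (simp add: Suc.IH) (simp add: mat3_simps E A_def e3_def)
  qed
  have s: "(\<lambda>n. (\<i> * t) ^ n /\<^sub>R fact n) sums exp (\<i> * t)"
    by (rule exp_converges)
  have ex: "exp (\<i> * t) = Complex (cos t) (sin t)"
    by (simp add: exp_Euler cos_of_real sin_of_real complex_eq_iff)
  have sR: "(\<lambda>n. Re ((\<i> * t) ^ n) / fact n) sums cos t"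
    using sums_Re[OF s] ex by (simp add: field_simps)
  have sI: "(\<lambda>n. Im ((\<i> * t) ^ n) / fact n) sums sin t"
    using sums_Im[OF s] ex by (simp add: field_simps)
  have s0: "(\<lambda>n::nat. if n = 0 then 1 else 0::real) sums 1"
    using sums_single[of 0 "\<lambda>_. 1::real"] by simp
  have "(\<lambda>n. (Re ((\<i> * t) ^ n) / fact n) *\<^sub>R E1 + (Im ((\<i> * t) ^ n) / fact n) *\<^sub>R E2
      + (if n = 0 then 1 else 0) *\<^sub>R E3) sums (cos t *\<^sub>R E1 + sin t *\<^sub>R E2 + 1 *\<^sub>R E3)"
    by (intro sums_add sums_scaleR_left sR sI s0)
  moreover have "(1 / fact n) *\<^sub>R (((**) A) ^^ n) (mat 1) =
     (Re ((\<i> * t) ^ n) / fact n) *\<^sub>R E1 + (Im ((\<i> * t) ^ n) / fact n) *\<^sub>R E2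
      + (if n = 0 then 1 else 0) *\<^sub>R E3" for n
    unfolding pow by (simp add: scaleR_add_right)
  ultimately have "(\<lambda>n. (1 / fact n) *\<^sub>R (((**) A) ^^ n) (mat 1)) sums
      (cos t *\<^sub>R E1 + sin t *\<^sub>R E2 + 1 *\<^sub>R E3)"
    by simp
  then have "Zrot t = cos t *\<^sub>R E1 + sin t *\<^sub>R E2 + 1 *\<^sub>R E3"
    unfolding Zrot_def mat_exp_def A_def[symmetric] by (rule sums_unique[symmetric])
  then show ?thesis
    by (simp add: mat3_simps E)
qed

section \<open>The rotation group and Euler's rotation theorem\<close>

lemma SO3_iff: "Q \<in> SO3 \<longleftrightarrow> orthogonal_matrix Q \<and> det Q = 1"
  by (simp add: SO3_def rotation_matrix_def)

lemma SO3_mult: "A \<in> SO3 \<Longrightarrow> B \<in> SO3 \<Longrightarrow> A ** B \<in> SO3"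
  by (simp add: SO3_iff orthogonal_matrix_mul det_mul)

lemma SO3_transpose: "A \<in> SO3 \<Longrightarrow> transpose A \<in> SO3"
  by (simp add: SO3_iff det_transpose)

lemma SO3_orthogonal:
  assumes "A \<in> SO3"
  shows "transpose A ** A = mat 1" "A ** transpose A = mat 1"
  using assms by (auto simp: SO3_iff orthogonal_matrix_def)

lemma Zrot_SO3: "Zrot t \<in> SO3"
proof -
  have "orthogonal_matrix (Zrot t)"
    by (simp add: orthogonal_matrix mat3_simps Zrot_eq flip: power2_eq_square)
  moreover have "det (Zrot t) = 1"
    by (simp add: det_3 Zrot_eq flip: power2_eq_square)
  ultimately show ?thesis by (simp add: SO3_iff)
qed

text \<open>A rotation in dimension 3 fixes an axis; conjugating by a rotation that carries the
  third basis vector to that axis leaves a planar rotation. Restricting the angle to [0, pi] is what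
  later makes the initial angle unique.\<close>

lemma euler_rotation:
  assumes Q: "Q \<in> SO3"
  obtains U t where "U \<in> SO3" "0 \<le> t" "t \<le> pi" "Q = U ** Zrot t ** transpose U"
proof -
  have "transpose Q ** (Q - mat 1) = - transpose (Q - mat 1)"
  proof -
    have "transpose Q ** (Q - mat 1) = transpose Q ** Q - transpose Q"
      by (simp add: mat3_simps algebra_simps)
    also have "\<dots> = - transpose (Q - mat 1)"
      unfolding SO3_orthogonal(1)[OF Q] by (simp add: mat3_simps)
    finally show ?thesis .
  qed
  then have "det (transpose Q) * det (Q - mat 1) = det (- transpose (Q - mat 1))"
    by (metis det_mul)
  \<comment> \<open>The dimension is odd, so the sign comes out of the determinant; hence 1 is an
    eigenvalue of \<open>Q\<close>.\<close>
  also have "\<dots> = - det (Q - mat 1)"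
    by (simp add: det_3 transpose_nth algebra_simps)
  finally have "det (Q - mat 1) = 0"
    using Q by (simp add: SO3_iff det_transpose)
  then obtain v where v: "v \<noteq> 0" "(Q - mat 1) *v v = 0"
    using invertible_det_nz[of "Q - mat 1"] matrix_left_invertible_ker[of "Q - mat 1"]
      invertible_left_inverse[of "Q - mat 1"] by auto
  have "norm (v /\<^sub>R norm v) = 1" using v by simp
  then obtain U where U: "rotation_matrix U" "U *v axis 3 1 = v /\<^sub>R norm v"
    using rotation_matrix_exists_basis[of "v /\<^sub>R norm v" 3] by auto
  have USO: "U \<in> SO3" using U by (simp add: SO3_def)
  define M where "M = transpose U ** Q ** U"
  have MSO: "M \<in> SO3"
    unfolding M_def by (intro SO3_mult SO3_transpose USO Q)
  have "Q *v (v /\<^sub>R norm v) = v /\<^sub>R norm v"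
    using v by (simp add: matrix_vector_mult_diff_rdistrib matrix_vector_mult_scaleR)
  then have "Q *v (U *v axis 3 1) = U *v axis 3 1" using U by simp
  then have "M *v axis 3 1 = (transpose U ** U) *v axis 3 1"
    by (simp add: M_def flip: matrix_vector_mul_assoc)
  then have "M *v axis 3 1 = axis 3 1"
    by (simp add: SO3_orthogonal[OF USO])
  then have c3: "M$1$3 = 0" "M$2$3 = 0" "M$3$3 = 1"
    by (auto simp: mat3_simps axis_def)
  have o1: "transpose M ** M = mat 1" using SO3_orthogonal[OF MSO] by simp
  have r: "M$3$1 = 0" "M$3$2 = 0" 
    using o1 by (simp_all add: mat3_simps c3)
  have o: "M$1$1 * M$1$1 + M$2$1 * M$2$1 = 1" "M$1$1 * M$1$2 + M$2$1 * M$2$2 = 0"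
     "M$1$2 * M$1$2 + M$2$2 * M$2$2 = 1"
    using o1 by (simp_all add: mat3_simps c3 r)
  have d: "M$1$1 * M$2$2 - M$1$2 * M$2$1 = 1"
    using MSO by (simp add: SO3_iff det_3 c3 r)
  \<comment> \<open>Unit columns and determinant 1 make this sum of squares vanish, which gives the
    planar block the shape of a rotation.\<close>
  have "(M$2$2 - M$1$1)^2 + (M$1$2 + M$2$1)^2 = 
     (M$1$1 * M$1$1 + M$2$1 * M$2$1) + (M$1$2 * M$1$2 + M$2$2 * M$2$2) - 2 * (M$1$1 * M$2$2 - M$1$2 * M$2$1)"
    by (simp add: power2_eq_square algebra_simps)
  also have "\<dots> = 0" unfolding o d by simp
  finally have e: "M$2$2 = M$1$1" "M$1$2 = - M$2$1"
    by (simp_all add: sum_power2_eq_zero_iff)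
  have QM: "Q = U ** M ** transpose U"
  proof -
    have "U ** M ** transpose U = (U ** transpose U) ** Q ** (U ** transpose U)"
      by (simp add: M_def matrix_mul_assoc)
    then show ?thesis by (simp add: SO3_orthogonal[OF USO])
  qed
  show thesis
  proof (cases "M$2$1 \<ge> 0")
    case True
    then obtain t where t: "0 \<le> t" "t \<le> pi" "M$1$1 = cos t" "M$2$1 = sin t"
      using sincos_total_pi[of "M$2$1" "M$1$1"] o by (auto simp: power2_eq_square)
    have "M = Zrot t"
      by (simp add: Zrot_eq mat3_simps c3 r e t)
    then show thesis using that USO t QM by blast
  next
    case False
    then obtain t where t: "0 \<le> t" "t \<le> pi" "M$1$1 = cos t" "- M$2$1 = sin t"
      using sincos_total_pi[of "- M$2$1" "M$1$1"] o by (auto simp: power2_eq_square)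
    then have t': "M$2$1 = - sin t" by simp
    \<comment> \<open>Half turn about the first axis. It reverses the third axis, and conjugation by
      it turns \<open>Zrot t\<close> into \<open>Zrot (- t)\<close>: a negative sine is absorbed
      into the frame, and the angle stays in [0, pi].\<close>
    define D :: "real^3^3" where "D = vector [vector [1,0,0], vector [0,-1,0], vector [0,0,-1]]"
    have DSO: "D \<in> SO3"
      by (simp add: SO3_iff orthogonal_matrix D_def det_3 mat3_simps)
    have "M = D ** Zrot t ** transpose D"
      by (simp add: Zrot_eq mat3_simps c3 r e t t' D_def)
    then have "Q = (U ** D) ** Zrot t ** transpose (U ** D)"
      by (simp add: QM matrix_transpose_mul matrix_mul_assoc)
    then show thesis using that SO3_mult[OF USO DSO] t by blast
  qed
qed

text \<open>On rotations this is 1 - cos t for the rotation angle t: it is 0 only at the identity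
  and 2 exactly at the half turns.\<close>

definition attitude_gap :: "real^3^3 \<Rightarrow> real" where
  "attitude_gap Q = (3 - trace Q) / 2"

lemma trace_3: "trace A = A$1$1 + A$2$2 + (A::real^3^3)$3$3"
  by (simp add: trace_def sum_3)

lemma inner_mat3: "(A::real^3^3) \<bullet> B = trace (transpose A ** B)"
  by (simp add: inner_vec_def sum_3 trace_3 mat3_simps)

lemma norm_diff_SO3:
  assumes "R \<in> SO3" "S \<in> SO3"
  shows "(norm (R - S))\<^sup>2 = 4 * attitude_gap (transpose S ** R)"
proof -
  have "(norm (R - S))\<^sup>2 = R \<bullet> R + S \<bullet> S - 2 * (S \<bullet> R)"
    by (simp add: power2_norm_eq_inner inner_diff inner_commute)
  moreover have "R \<bullet> R = 3" "S \<bullet> S = 3"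
    by (simp_all add: inner_mat3 SO3_orthogonal assms trace_I)
  ultimately show ?thesis by (simp add: attitude_gap_def inner_mat3 algebra_simps)
qed

lemma norm_SO3: "R \<in> SO3 \<Longrightarrow> norm R = sqrt 3"
  by (simp add: norm_eq_sqrt_inner inner_mat3 SO3_orthogonal trace_I)

lemma trace_conj_SO3: "U \<in> SO3 \<Longrightarrow> trace (U ** A ** transpose U) = trace A"
  by (metis SO3_orthogonal(1) matrix_mul_assoc matrix_mul_rid trace_mul_sym)

lemma norm_SO3_mult_vec: "U \<in> SO3 \<Longrightarrow> norm (U *v x) = norm x"
  by (rule orthogonal_transformation_norm) (simp add: orthogonal_transformation_matrix SO3_iff)

lemma trace_Zrot: "trace (Zrot t) = 1 + 2 * cos t"
  by (simp add: trace_3 Zrot_eq)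

lemma attitude_gap_bounds:
  assumes "Q \<in> SO3"
  shows "0 \<le> attitude_gap Q" "attitude_gap Q \<le> 2"
proof -
  obtain U t where "U \<in> SO3" "Q = U ** Zrot t ** transpose U"
    using euler_rotation[OF assms] by metis
  then have "attitude_gap Q = 1 - cos t"
    by (simp add: attitude_gap_def trace_conj_SO3 trace_Zrot)
  then show "0 \<le> attitude_gap Q" "attitude_gap Q \<le> 2" using cos_ge_minus_one[of t] by auto
qed

text \<open>This is the identity sin^2 t = (1 - cos t) (1 + cos t). The squared norm of the skew
  part is a combination of the traces of \<open>transpose Q ** Q\<close> and \<open>Q ** Q\<close>,
  and traces do not see the conjugation by \<open>U\<close>.\<close>

lemma norm_skew_vec_SO3:
  assumes "Q \<in> SO3"
  shows "(norm (skew_vec Q))\<^sup>2 = attitude_gap Q * (2 - attitude_gap Q)"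
proof -
  obtain U t where U: "U \<in> SO3" and Q: "Q = U ** Zrot t ** transpose U"
    using euler_rotation[OF assms] by metis
  have "(norm (skew_vec Q))\<^sup>2 = (trace (transpose Q ** Q) - trace (Q ** Q)) / 4"
    by (simp add: power2_norm_eq_inner inner_vec_def sum_3 trace_3 mat3_simps field_simps)
  also have "trace (transpose Q ** Q) = 3"
    by (simp add: SO3_orthogonal assms trace_I)
  also have "Q ** Q = U ** (Zrot t ** Zrot t) ** transpose U"
  proof -
    have "Q ** Q = U ** Zrot t ** (transpose U ** U) ** Zrot t ** transpose U"
      by (simp add: Q matrix_mul_assoc)
    then show ?thesis by (simp add: SO3_orthogonal U matrix_mul_assoc)
  qed
  also have "trace \<dots> = trace (Zrot t ** Zrot t)"
    by (simp add: trace_conj_SO3 U)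
  also have "\<dots> = 4 * (cos t)\<^sup>2 - 1"
    using sin_cos_squared_add[of t] by (simp add: trace_3 Zrot_eq mat3_simps power2_eq_square)
  finally have 1: "(norm (skew_vec Q))\<^sup>2 = 1 - (cos t)\<^sup>2" by simp
  have "attitude_gap Q = 1 - cos t"
    by (simp add: Q attitude_gap_def trace_conj_SO3 trace_Zrot U)
  then have "cos t = 1 - attitude_gap Q" by simp
  with 1 show ?thesis by (simp add: power2_eq_square algebra_simps)
qed

text \<open>The derivative of the cross term of V contains this inner product with the factor
  \<open>\<mu>\<close>, so the bound limits its cost to \<open>\<mu>\<close> times the squared
  velocity error. It holds because the form is diagonal in the frame of the rotation axis, with
  coefficients (1 + cos t) / 2 in the plane and cos t on the axis, all at most 1.\<close>

lemma inner_skew_vec_SO3_le: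
  assumes "Q \<in> SO3"
  shows "e \<bullet> skew_vec (Q ** hat e) \<le> (norm e)\<^sup>2"
proof -
  obtain U t where U: "U \<in> SO3" and Q: "Q = U ** Zrot t ** transpose U"
    using euler_rotation[OF assms] by metis
  define w where "w = transpose U *v e"
  have nw: "(norm w)\<^sup>2 = (norm e)\<^sup>2"
    unfolding w_def norm_SO3_mult_vec[OF SO3_transpose[OF U]] ..
  have "2 * (e \<bullet> skew_vec (Q ** hat e)) = trace Q * (e \<bullet> e) - e \<bullet> (Q *v e)"
    by (simp add: inner_vec_def sum_3 trace_3 mat3_simps field_simps)
  also have "trace Q = 1 + 2 * cos t"
    by (simp add: Q trace_conj_SO3 trace_Zrot U)
  also have "e \<bullet> (Q *v e) = w \<bullet> (Zrot t *v w)"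
    unfolding Q w_def
    by (simp add: dot_lmul_matrix flip: matrix_vector_mul_assoc)
  also have "\<dots> = cos t * ((w$1)\<^sup>2 + (w$2)\<^sup>2) + (w$3)\<^sup>2"
    by (simp add: inner_vec_def sum_3 mat3_simps Zrot_eq power2_eq_square algebra_simps)
  also have "e \<bullet> e = w \<bullet> w"
    using nw by (simp only: power2_norm_eq_inner)
  also have "w \<bullet> w = (w$1)\<^sup>2 + (w$2)\<^sup>2 + (w$3)\<^sup>2"
    by (simp add: inner_vec_def sum_3 power2_eq_square)
  finally have "2 * (e \<bullet> skew_vec (Q ** hat e)) =
      (1 + cos t) * ((w$1)\<^sup>2 + (w$2)\<^sup>2) + 2 * cos t * (w$3)\<^sup>2"
    by (simp add: algebra_simps)
  also have "\<dots> \<le> 2 * ((w$1)\<^sup>2 + (w$2)\<^sup>2) + 2 * 1 * (w$3)\<^sup>2"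
    by (intro add_mono mult_right_mono) auto
  also have "\<dots> = 2 * (norm e)\<^sup>2"
    unfolding nw[symmetric] unfolding power2_norm_eq_inner
    by (simp add: inner_vec_def sum_3 power2_eq_square)
  finally show ?thesis by simp
qed

text \<open>The commutator is the part of the derivative of the relative attitude that stems from
  the turning of the reference frame. It merely makes the attitude error vector turn.\<close>

lemma skew_vec_commutator: "skew_vec (Q ** hat w - hat w ** Q) = cross3 (skew_vec Q) w"
  by (simp add: mat3_simps cross3_def field_simps)

lemma trace_mult_hat: "trace (Q ** hat w) = - 2 * (skew_vec Q \<bullet> w)"
  by (simp add: trace_3 inner_vec_def sum_3 mat3_simps field_simps)

text \<open>Both rotations have the axis \<open>U *v e3\<close>, so their relative rotation has
  angle \<open>t - s\<close>, and the common factor \<open>P\<close> does not change the distance.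
  This evaluates the initial attitude errors to both references and the distance between the
  references.\<close>

lemma norm_shifted_diff:
  assumes "U \<in> SO3" "P \<in> SO3"
  shows "(norm (U ** Zrot t ** transpose U ** P - U ** Zrot s ** transpose U ** P))\<^sup>2
      = 4 * (1 - cos (t - s))"
proof -
  have "transpose (U ** Zrot s ** transpose U ** P) ** (U ** Zrot t ** transpose U ** P)
      = transpose P ** (U ** (transpose (Zrot s) ** Zrot t) ** transpose U) ** P"
    using SO3_orthogonal(1)[OF assms(1)]
    by (metis (no_types, lifting) matrix_mul_assoc matrix_mul_rid matrix_transpose_mul transpose_transpose)
  then have "trace (transpose (U ** Zrot s ** transpose U ** P) ** (U ** Zrot t ** transpose U ** P))
     = trace (transpose P ** (U ** (transpose (Zrot s) ** Zrot t) ** transpose U) ** transpose (transpose P))"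
    by simp
  also have "\<dots> = trace (transpose (Zrot s) ** Zrot t)"
    by (simp only: trace_conj_SO3 assms SO3_transpose)
  also have "\<dots> = 1 + 2 * cos (t - s)"
    by (simp add: trace_3 mat3_simps Zrot_eq cos_diff)
  finally show ?thesis
    using assms by (simp add: norm_diff_SO3 SO3_mult SO3_transpose Zrot_SO3 attitude_gap_def)
qed

lemma Zrot_0: "Zrot 0 = mat 1"
  by (simp add: Zrot_eq mat3_simps)

text \<open>Existence is Euler's theorem for \<open>R ** transpose P\<close>. For uniqueness, the
  trace determines the cosine of the angle, and cosine is injective on [0, pi].\<close>

lemma initial_angle:
  assumes "P \<in> SO3" "R \<in> SO3"
  shows "0 \<le> initial_angle P R" "initial_angle P R \<le> pi"
    "\<exists>U\<in>SO3. R = U ** Zrot (initial_angle P R) ** transpose U ** P"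
proof -
  let ?A = "\<lambda>t. t \<in> {0..pi} \<and> (\<exists>U\<in>SO3. R = U ** Zrot t ** transpose U ** P)"
  obtain U t where U: "U \<in> SO3" and t: "0 \<le> t" "t \<le> pi" and Q: "R ** transpose P = U ** Zrot t ** transpose U"
    using euler_rotation[of "R ** transpose P"] assms by (metis SO3_mult SO3_transpose)
  have "R = R ** (transpose P ** P)" by (simp add: SO3_orthogonal assms)
  also have "\<dots> = U ** Zrot t ** transpose U ** P" by (simp add: matrix_mul_assoc Q)
  finally have ex: "?A t" using U t by auto
  have uniq: "s = r" if s: "?A s" and r: "?A r" for s r
  proof -
    have "trace (R ** transpose P) = 1 + 2 * cos u" if u: "?A u" for u
    proof -
      obtain U where U: "U \<in> SO3" "R = U ** Zrot u ** transpose U ** P" using u by blast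
      then have "R ** transpose P = U ** Zrot u ** transpose U ** (P ** transpose P)"
        by (simp add: matrix_mul_assoc)
      then show ?thesis using U by (simp add: SO3_orthogonal assms trace_conj_SO3 trace_Zrot)
    qed
    from this[OF s] this[OF r] have "cos s = cos r" by simp
    then show "s = r" using s r by (auto intro: cos_inj_pi)
  qed
  have "?A (initial_angle P R)"
    unfolding initial_angle_def by (rule theI[of ?A, OF ex]) (rule uniq[OF _ ex])
  then show "0 \<le> initial_angle P R" "initial_angle P R \<le> pi"
    "\<exists>U\<in>SO3. R = U ** Zrot (initial_angle P R) ** transpose U ** P" by auto
qed

subsection \<open>Differential equations and differential inequalities\<close>

lemma vector_derivative_bound:
  fixes f :: "real \<Rightarrow> 'a::real_normed_vector"
  assumes ab: "a \<le> b"
    and der: "\<And>t. t \<in> {a..b} \<Longrightarrow> (f has_vector_derivative f' t) (at t within {a..b})"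
    and bnd: "\<And>t. t \<in> {a..b} \<Longrightarrow> norm (f' t) \<le> M"
  shows "norm (f b - f a) \<le> M * (b - a)"
proof -
  have "norm (f b - f a) \<le> M * norm (b - a)"
  proof (rule differentiable_bound)
    show "convex {a..b}" by simp
    show "(f has_derivative (\<lambda>h. h *\<^sub>R f' t)) (at t within {a..b})" if "t \<in> {a..b}" for t
      using der[OF that] by (simp add: has_vector_derivative_def)
    show "onorm (\<lambda>h. h *\<^sub>R f' t) \<le> M" if "t \<in> {a..b}" for t
      using bnd[OF that] order_trans[OF norm_ge_zero bnd[OF that]]
      by (intro onorm_bound) (auto simp: mult.commute[of M] intro!: mult_left_mono)
  qed (use ab in auto)
  then show ?thesis using ab by simp
qed

lemma real_derivative_upper_bound:
  fixes f :: "real \<Rightarrow> real"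
  assumes ab: "a \<le> b"
    and der: "\<And>t. t \<in> {a..b} \<Longrightarrow> (f has_vector_derivative f' t) (at t within {a..b})"
    and bnd: "\<And>t. t \<in> {a..b} \<Longrightarrow> f' t \<le> M"
  shows "f b \<le> f a + M * (b - a)"
proof (cases "a = b")
  case False
  then have "\<exists>x\<in>{a<..<b}. f b - f a = (\<lambda>h. h *\<^sub>R f' x) (b - a)"
    using ab der by (intro mvt_simple) (auto simp: has_vector_derivative_def)
  then obtain x where "x \<in> {a<..<b}" "f b - f a = (b - a) * f' x" by auto
  moreover from this have "(b - a) * f' x \<le> (b - a) * M"
    using ab bnd[of x] by (intro mult_left_mono) auto
  ultimately show ?thesis by (simp add: algebra_simps)
qed simp

text \<open>Barbalat's argument: if $p$ were large infinitely often, the Lipschitz bound would keep it large on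
  intervals of a fixed length, and $V$ would drop below its infimum.\<close>
lemma dissipation_tendsto_0:
  fixes V p :: "real \<Rightarrow> real"
  assumes der: "\<And>t. 0 \<le> t \<Longrightarrow> (V has_vector_derivative V' t) (at t within {0..})"
    and diss: "\<And>t. 0 \<le> t \<Longrightarrow> V' t \<le> - l * p t"
    and V: "\<And>t. 0 \<le> t \<Longrightarrow> 0 \<le> V t"
    and p: "\<And>t. 0 \<le> t \<Longrightarrow> 0 \<le> p t"
    and lip: "\<And>s t. 0 \<le> s \<Longrightarrow> s \<le> t \<Longrightarrow> \<bar>p t - p s\<bar> \<le> L * (t - s)"
    and l: "0 < l"
  shows "(p \<longlongrightarrow> 0) at_top"
proof (rule ccontr)
  have decr: "V t \<le> V s + M * (t - s)" if "0 \<le> s" "s \<le> t" "\<And>u. s \<le> u \<Longrightarrow> u \<le> t \<Longrightarrow> V' u \<le> M" for s t M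
    using that by (intro real_derivative_upper_bound[where f' = V'])
      (auto intro: has_vector_derivative_within_subset[OF der])
  have mono: "V t \<le> V s" if "0 \<le> s" "s \<le> t" for s t
  proof -
    have "V' u \<le> 0" if "s \<le> u" for u
      using that \<open>0 \<le> s\<close> l p[of u] diss[of u] by (smt (verit) mult_nonneg_nonneg mult_minus_left)
    then show ?thesis using decr[of s t 0] that by auto
  qed
  assume "\<not> (p \<longlongrightarrow> 0) at_top"
  then obtain e where e: "e > 0" "\<not> eventually (\<lambda>t. dist (p t) 0 < e) at_top"
    unfolding tendsto_iff by auto
  have often: "\<exists>t\<ge>N. 0 \<le> t \<and> e \<le> p t" for N
  proof (rule ccontr)
    assume "\<not> ?thesis"
    then have "\<forall>t\<ge>max N 0. dist (p t) 0 < e" using p by (force simp: dist_real_def)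
    then have "eventually (\<lambda>t. dist (p t) 0 < e) at_top"
      unfolding eventually_at_top_linorder by blast
    then show False using e(2) by simp
  qed
  \<comment> \<open>Within a time \<open>h\<close> the Lipschitz bound lets \<open>p\<close> lose at
    most \<open>e / 2\<close>; the summand 1 avoids a division by zero.\<close>
  define h where "h = e / (2 * (\<bar>L\<bar> + 1))"
  have h: "h > 0" using e by (simp add: h_def)
  have Lh: "\<bar>L\<bar> * h \<le> e / 2"
    using e by (simp add: h_def field_simps)
  define v where "v = Inf (V ` {0..})"
  have bb: "bdd_below (V ` {0..})" using V by (auto intro: bdd_belowI[of _ 0])
  have v: "v \<le> V t" if "0 \<le> t" for t
    unfolding v_def using that bb by (intro cInf_lower) auto
  \<comment> \<open>Some value of \<open>V\<close> exceeds the infimum by less than the loss which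
    an interval of length \<open>h\<close> is going to cause.\<close>
  have "\<exists>x\<in>V ` {0..}. x < v + l * (e/2) * h"
  proof (rule ccontr)
    assume "\<not> ?thesis"
    then have "v + l * (e/2) * h \<le> v" unfolding v_def by (intro cInf_greatest) (auto simp: not_less)
    moreover have "l * (e/2) * h > 0" using l e h by simp
    ultimately show False by linarith
  qed
  then obtain N where N: "N \<ge> 0" "V N < v + l * (e/2) * h" by auto
  obtain t where t: "t \<ge> N" "0 \<le> t" "e \<le> p t" using often by blast
  have "V' u \<le> - l * (e/2)" if "t \<le> u" "u \<le> t + h" for u
  proof -
    have "\<bar>p u - p t\<bar> \<le> \<bar>L\<bar> * h"
      using lip[of t u] t that by (smt (verit) abs_ge_self mult_mono abs_ge_zero)
    then have "e/2 \<le> p u" using Lh t by linarith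
    then have "l * (e/2) \<le> l * p u" using l by (intro mult_left_mono) auto
    then show ?thesis using diss[of u] that t by auto
  qed
  then have "V (t + h) \<le> V t + - l * (e/2) * (t + h - t)" using t h by (intro decr) auto
  moreover have "V t \<le> V N" using mono N t by auto
  moreover have "v \<le> V (t + h)" using v t h by auto
  ultimately show False using N by auto
qed

text \<open>Once \<open>h\<close> is small, \<open>z\<close> is nearly constant over a unit of time,
  so with \<open>g\<close> small the increment of \<open>y\<close> over that unit is nearly
  \<open>z t\<close>; but \<open>y\<close> is small at both ends. It is applied with the velocity
  error as \<open>y\<close> and the inverse inertia times the disturbance error as
  \<open>z\<close>.\<close>

lemma input_tendsto_0:
  fixes y z g h :: "real \<Rightarrow> 'a::real_normed_vector"
  assumes y': "\<And>t. 0 \<le> t \<Longrightarrow> (y has_vector_derivative g t + z t) (at t within {0..})"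
    and z': "\<And>t. 0 \<le> t \<Longrightarrow> (z has_vector_derivative h t) (at t within {0..})"
    and lim: "(y \<longlongrightarrow> 0) at_top" "(g \<longlongrightarrow> 0) at_top" "(h \<longlongrightarrow> 0) at_top"
  shows "(z \<longlongrightarrow> 0) at_top"
proof (rule tendstoI)
  fix e' :: real assume "e' > 0"
  define e where "e = e' / 5"
  have e: "e > 0" using \<open>e' > 0\<close> by (simp add: e_def)
  have "eventually (\<lambda>t. norm (y t) < e \<and> norm (g t) < e \<and> norm (h t) < e) at_top"
    using tendstoD[OF lim(1) e] tendstoD[OF lim(2) e] tendstoD[OF lim(3) e]
    by eventually_elim auto
  then obtain N where N: "\<And>t. t \<ge> N \<Longrightarrow> norm (y t) < e \<and> norm (g t) < e \<and> norm (h t) < e"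
    by (auto simp: eventually_at_top_linorder)
  have "dist (z t) 0 < e'" if t: "t \<ge> max N 0" for t
  proof -
    have zb: "norm (z u - z t) \<le> e" if u: "t \<le> u" "u \<le> t + 1" for u
    proof -
      have "norm (z u - z t) \<le> e * (u - t)"
      proof (rule vector_derivative_bound)
        show "(z has_vector_derivative h s) (at s within {t..u})" if "s \<in> {t..u}" for s
          using that t by (intro has_vector_derivative_within_subset[OF z']) auto
        show "norm (h s) \<le> e" if "s \<in> {t..u}" for s using N[of s] that t by auto
      qed (use u in auto)
      also have "\<dots> \<le> e * 1" using u e by (intro mult_left_mono) auto
      finally show ?thesis by simp
    qed
    have "norm ((y (t+1) - (t+1-t) *\<^sub>R z t) - (y t - (t - t) *\<^sub>R z t)) \<le> (2*e) * (t+1 - t)"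
    proof (rule vector_derivative_bound)
      show "((\<lambda>u. y u - (u - t) *\<^sub>R z t) has_vector_derivative (g s + z s) - z t) (at s within {t..t+1})"
        if "s \<in> {t..t+1}" for s
        using that t
        by (auto intro!: derivative_eq_intros has_vector_derivative_within_subset[OF y'])
      show "norm (g s + z s - z t) \<le> 2 * e" if "s \<in> {t..t+1}" for s
      proof -
        have "norm (g s + z s - z t) \<le> norm (g s) + norm (z s - z t)"
          by (metis add_diff_eq norm_triangle_ineq)
        then show ?thesis using N[of s] zb[of s] that t by auto
      qed
    qed auto
    then have "norm (y (t+1) - y t - z t) \<le> 2 * e" by (simp add: algebra_simps)
    moreover have "norm (z t) \<le> norm (y (t+1) - y t - z t) + norm (y (t+1)) + norm (y t)"
      by (smt (verit) norm_minus_commute norm_triangle_ineq4 norm_triangle_sub)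
    ultimately have "norm (z t) < e'" using N[of t] N[of "t+1"] t \<open>e' > 0\<close> by (auto simp: e_def)
    then show ?thesis by simp
  qed
  then show "eventually (\<lambda>t. dist (z t) 0 < e') at_top"
    unfolding eventually_at_top_linorder by blast
qed

text \<open>Integrating against the exponential weight gains a factor 1 / K. This is behind both
  properties of the Picard operator below: it maps into bounded functions, and it contracts.\<close>

lemma norm_integral_exp_le:
  fixes h :: "real \<Rightarrow> 'a::banach"
  assumes "continuous_on {0..t} h" "\<And>s. s \<in> {0..t} \<Longrightarrow> norm (h s) \<le> M * exp (K * s)"
    and K: "0 < K" and "0 \<le> t" "0 \<le> M"
  shows "norm (integral {0..t} h) \<le> M / K * exp (K * t)"
proof -
  have i: "((\<lambda>s. M * exp (K * s)) has_integral (M / K * exp (K * t) - M / K * exp (K * 0))) {0..t}"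
    using assms
    by (intro fundamental_theorem_of_calculus) (auto intro!: derivative_eq_intros simp flip: has_real_derivative_iff_has_vector_derivative)
  have "norm (integral {0..t} h) \<le> integral {0..t} (\<lambda>s. M * exp (K * s))"
    using assms i by (intro integral_norm_bound_integral integrable_continuous_real) (auto intro!: continuous_intros)
  also have "\<dots> = M / K * exp (K * t) - M / K"
    using integral_unique[OF i] by (simp only: mult_zero_right exp_zero mult_1_right)
  also have "\<dots> \<le> M / K * exp (K * t)" using assms by simp
  finally show ?thesis .
qed

lemma integral_has_vector_derivative_atLeast:
  fixes g :: "real \<Rightarrow> 'a::banach"
  assumes "continuous_on {0..} g" "0 \<le> t"
  shows "((\<lambda>u. integral {0..u} g) has_vector_derivative g t) (at t within {0..})"
proof -
  have "((\<lambda>u. integral {0..u} g) has_vector_derivative g t) (at t within {0..t+1})"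
    using assms by (intro integral_has_vector_derivative) (auto intro: continuous_on_subset)
  moreover have "at t within {0..t+1} = at t within {0..}"
    by (rule at_within_nhd[where S = "{..<t+1}"]) auto
  ultimately show ?thesis by simp
qed

text \<open>Picard iteration is a contraction for the norm weighted by $e^{-2Lt}$, which yields a global
  solution in one step.\<close>
lemma global_lipschitz_ode:
  fixes f :: "real \<Rightarrow> 'a::banach \<Rightarrow> 'a"
  assumes cont: "\<And>z. continuous_on {0..} z \<Longrightarrow> continuous_on {0..} (\<lambda>s. f s (z s))"
    and lip: "\<And>t x y. 0 \<le> t \<Longrightarrow> norm (f t x - f t y) \<le> L * norm (x - y)"
    and bnd: "\<And>t. 0 \<le> t \<Longrightarrow> norm (f t 0) \<le> C"
  obtains x where "x 0 = x0" "\<And>t. 0 \<le> t \<Longrightarrow> (x has_vector_derivative f t (x t)) (at t within {0..})"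
proof -
  \<comment> \<open>\<open>L\<close> may be zero or negative, and the constant is divided by later.
    With \<open>K\<close> twice this constant the contraction factor is 1/2.\<close>
  define L' where "L' = max L 1"
  have L': "0 < L'" by (simp add: L'_def)
  have lip': "norm (f t x - f t y) \<le> L' * norm (x - y)" if "0 \<le> t" for t x y
    using lip[OF that, of x y] by (smt (verit) L'_def max.cobounded1 mult_right_mono norm_ge_zero)
  define K where "K = 2 * L'"
  have K: "0 < K" using L' by (simp add: K_def)
  have C: "0 \<le> C" using bnd[of 0] norm_ge_zero[of "f 0 0"] by linarith
  define G where "G y s = f s (exp (K * s) *\<^sub>R apply_bcontfun y s)" for y s
  have Gc: "continuous_on {0..} (G y)" for y
    unfolding G_def by (intro cont continuous_intros continuous_on_apply_bcontfun)
  \<comment> \<open>The Picard operator for the unknown multiplied by the weight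
    \<open>exp (- K * t)\<close>. Bounded continuous functions live on the whole line here, so
    \<open>max t 0\<close> continues the result to negative times by its value at 0.\<close>
  define F where "F y t = exp (- K * max t 0) *\<^sub>R (x0 + integral {0..max t 0} (G y))" for y t
  have Gb: "norm (G y s) \<le> (C + L' * norm y) * exp (K * s)" if "0 \<le> s" for y s
  proof -
    have "norm (G y s) \<le> norm (f s 0) + norm (G y s - f s 0)"
      by (metis norm_triangle_sub add.commute)
    also have "\<dots> \<le> C + L' * norm (exp (K * s) *\<^sub>R apply_bcontfun y s - 0)"
      unfolding G_def using that by (intro add_mono bnd lip') auto
    also have "\<dots> \<le> C * exp (K * s) + L' * (exp (K * s) * norm y)"
      using C K that L' norm_bounded[of y s]
      by (intro add_mono mult_left_mono) (auto simp: mult_le_cancel_left1 intro!: mult_left_mono)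
    finally show ?thesis by (simp add: algebra_simps)
  qed
  have Gd: "norm (G y s - G z s) \<le> (L' * dist y z) * exp (K * s)" if "0 \<le> s" for y z s
  proof -
    have "norm (G y s - G z s) \<le> L' * norm (exp (K * s) *\<^sub>R apply_bcontfun y s - exp (K * s) *\<^sub>R apply_bcontfun z s)"
      unfolding G_def using that by (intro lip') auto
    also have "\<dots> = L' * (exp (K * s) * dist (apply_bcontfun y s) (apply_bcontfun z s))"
      by (simp add: dist_norm flip: scaleR_diff_right)
    also have "\<dots> \<le> L' * (exp (K * s) * dist y z)"
      using L' dist_bounded by (intro mult_left_mono) auto
    finally show ?thesis by (simp add: algebra_simps)
  qed
  have Fc: "continuous_on UNIV (F y)" for y
  proof -
    have "continuous_on {0..} (\<lambda>u. integral {0..u} (G y))"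
      using integral_has_vector_derivative_atLeast[OF Gc[of y]]
      by (auto simp: continuous_on_eq_continuous_within intro: has_vector_derivative_continuous)
    then have "continuous_on UNIV (\<lambda>t. integral {0..max t 0} (G y))"
      by (rule continuous_on_compose2) (auto intro!: continuous_intros)
    then show ?thesis unfolding F_def by (intro continuous_intros)
  qed
  have Fb: "norm (F y t) \<le> norm x0 + (C + L' * norm y) / K" for y t
  proof -
    define u where "u = max t 0"
    have u: "u \<ge> 0" by (simp add: u_def)
    have "norm (integral {0..u} (G y)) \<le> (C + L' * norm y) / K * exp (K * u)"
      using u K C L' Gb by (intro norm_integral_exp_le continuous_on_subset[OF Gc]) auto
    then have "norm (x0 + integral {0..u} (G y)) \<le> norm x0 + (C + L' * norm y) / K * exp (K * u)"
      using norm_triangle_ineq[of x0 "integral {0..u} (G y)"] by linarith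
    also have "\<dots> \<le> norm x0 * exp (K * u) + (C + L' * norm y) / K * exp (K * u)"
      using K u by (intro add_right_mono) (simp add: mult_le_cancel_left1)
    finally have "exp (- K * u) * norm (x0 + integral {0..u} (G y)) \<le>
        exp (- K * u) * ((norm x0 + (C + L' * norm y) / K) * exp (K * u))"
      by (intro mult_left_mono) (auto simp: algebra_simps)
    also have "\<dots> = norm x0 + (C + L' * norm y) / K"
      by (simp add: exp_minus)
    finally show ?thesis by (simp add: F_def u_def)
  qed
  have Fbc: "F y \<in> bcontfun" for y
    using Fc Fb by (rule bcontfun_normI)
  define T where "T y = Bcontfun (F y)" for y
  have Tap: "apply_bcontfun (T y) = F y" for y
    using Fbc by (simp add: T_def Bcontfun_inverse)
  have "dist (T y) (T z) \<le> (1/2) * dist y z" for y z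
  proof (rule dist_bound)
    fix t :: real
    define u where "u = max t 0"
    have u: "u \<ge> 0" by (simp add: u_def)
    have sub: "(G w) integrable_on {0..u}" for w
      by (intro integrable_continuous_real continuous_on_subset[OF Gc]) auto
    have "F y t - F z t = exp (- K * u) *\<^sub>R (integral {0..u} (G y) - integral {0..u} (G z))"
      by (simp add: F_def u_def flip: scaleR_diff_right)
    also have "\<dots> = exp (- K * u) *\<^sub>R integral {0..u} (\<lambda>s. G y s - G z s)"
      by (simp add: integral_diff sub)
    finally have "dist (F y t) (F z t) = exp (- K * u) * norm (integral {0..u} (\<lambda>s. G y s - G z s))"
      by (simp add: dist_norm)
    also have "\<dots> \<le> exp (- K * u) * ((L' * dist y z) / K * exp (K * u))"
      using u K L' Gd
      by (intro mult_left_mono norm_integral_exp_le continuous_on_diff continuous_on_subset[OF Gc]) auto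
    also have "\<dots> = (1/2) * dist y z"
      using L' by (simp add: K_def exp_minus)
    finally show "dist (apply_bcontfun (T y) t) (apply_bcontfun (T z) t) \<le> (1/2) * dist y z"
      by (simp add: Tap)
  qed
  then have "\<exists>!y. T y = y"
    by (intro banach_fix_type[where c = "1/2"]) auto
  then obtain y where y: "T y = y" by blast
  define x where "x t = x0 + integral {0..t} (G y)" for t
  have xy: "exp (K * t) *\<^sub>R apply_bcontfun y t = x t" if "0 \<le> t" for t
  proof -
    have "apply_bcontfun y t = F y t" using Tap[of y] y by simp
    then show ?thesis using that by (simp add: F_def x_def exp_minus)
  qed
  show thesis
  proof (rule that[of x])
    show "x 0 = x0" by (simp add: x_def)
    show "(x has_vector_derivative f t (x t)) (at t within {0..})" if "0 \<le> t" for t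
    proof -
      have "(x has_vector_derivative 0 + G y t) (at t within {0..})"
        unfolding x_def
        by (intro has_vector_derivative_add has_vector_derivative_const integral_has_vector_derivative_atLeast Gc that)
      then show ?thesis using xy[OF that] by (simp add: G_def)
    qed
  qed
qed

subsection \<open>The Lyapunov function\<close>

lemma bounded_bilinear_matrix_mult: "bounded_bilinear ((**) :: real^3^3 \<Rightarrow> real^3^3 \<Rightarrow> real^3^3)"
  by (subst bilinear_conv_bounded_bilinear[symmetric])
    (auto simp: bilinear_def linear_iff mat3_simps algebra_simps)

lemma bounded_linear_skew_vec: "bounded_linear skew_vec"
  by (subst linear_conv_bounded_linear[symmetric]) (auto simp: linear_iff mat3_simps field_simps)

lemma bounded_linear_transpose3: "bounded_linear (transpose :: real^3^3 \<Rightarrow> real^3^3)"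
  by (subst linear_conv_bounded_linear[symmetric]) (auto simp: linear_iff mat3_simps)

lemma bounded_linear_hat: "bounded_linear hat"
  by (subst linear_conv_bounded_linear[symmetric]) (auto simp: linear_iff mat3_simps)

lemma bounded_linear_trace3: "bounded_linear (trace :: real^3^3 \<Rightarrow> real)"
  by (subst linear_conv_bounded_linear[symmetric]) (auto simp: linear_iff trace_3 algebra_simps)

lemma bounded_bilinear_cross3: "bounded_bilinear cross3"
  using bilinear_cross bilinear_conv_bounded_bilinear by blast

lemma bounded_linear_matrix_vector_mult: "bounded_linear ((*v) (A :: real^3^3))"
  by (rule matrix_vector_mul_bounded_linear)

lemma transpose_hat: "transpose (hat w) = - hat w"
  by (simp add: mat3_simps)

section \<open>The inertia matrix and the gain conditions\<close>

lemma sym_pos_def_inverse: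
  assumes "sym_pos_def (J :: real^'n^'n)"
  shows "J *v (matrix_inv J *v x) = x" "matrix_inv J *v (J *v x) = x"
    "x \<bullet> (matrix_inv J *v y) = (matrix_inv J *v x) \<bullet> y"
proof -
  have "J *v x = 0 \<longrightarrow> x = 0" for x
    using assms by (metis inner_zero_right less_irrefl sym_pos_def_def)
  then have "invertible J"
    using matrix_left_invertible_ker invertible_left_inverse by blast
  then have "\<exists>A'. J ** A' = mat 1 \<and> A' ** J = mat 1"
    by (simp add: invertible_def)
  then have i: "J ** matrix_inv J = mat 1 \<and> matrix_inv J ** J = mat 1"
    unfolding matrix_inv_def by (rule someI_ex)
  show 1: "J *v (matrix_inv J *v x) = x" for x
    by (simp add: i matrix_vector_mul_assoc)
  show "matrix_inv J *v (J *v x) = x"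
    by (simp add: i matrix_vector_mul_assoc)
  have sym: "u \<bullet> (J *v v) = (J *v u) \<bullet> v" for u v
    using assms by (metis dot_lmul_matrix sym_pos_def_def transpose_matrix_vector)
  show "x \<bullet> (matrix_inv J *v y) = (matrix_inv J *v x) \<bullet> y"
    using sym[of "matrix_inv J *v x" "matrix_inv J *v y"] by (simp add: 1)
qed

text \<open>The witness is the determinant divided by the trace of the matrix of the form, a lower
  bound for its smaller eigenvalue. Subtracting it from both diagonal entries leaves the product
  \<open>\<beta>\<^sup>2 / 4 + l\<^sup>2\<close>, so completing the square applies.\<close>

lemma positive_definite_form_bound:
  fixes \<alpha> \<beta> \<gamma> :: real
  assumes "0 < \<alpha>" "0 < \<gamma>" "\<beta>\<^sup>2 < 4 * \<alpha> * \<gamma>"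
  obtains l where "0 < l" "\<And>x y. l * (x\<^sup>2 + y\<^sup>2) \<le> \<alpha> * x\<^sup>2 + \<gamma> * y\<^sup>2 - \<beta> * x * y"
proof -
  define l where "l = (4 * \<alpha> * \<gamma> - \<beta>\<^sup>2) / (4 * (\<alpha> + \<gamma>))"
  have l: "0 < l" using assms by (simp add: l_def)
  have lag: "4 * l * (\<alpha> + \<gamma>) = 4 * \<alpha> * \<gamma> - \<beta>\<^sup>2"
  proof -
    have "4 * (\<alpha> + \<gamma>) \<noteq> 0" using assms by simp
    then have "4 * \<alpha> * \<gamma> - \<beta>\<^sup>2 = l * (4 * (\<alpha> + \<gamma>))"
      using l_def nonzero_divide_eq_eq by metis
    then show ?thesis by (simp add: mult_ac)
  qed
  have "4 * l * (\<alpha> + \<gamma>) \<le> 4 * \<alpha> * \<gamma>" unfolding lag by simp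
  then have "l * (\<alpha> + \<gamma>) \<le> \<alpha> * \<gamma>" by simp
  also have "\<dots> < \<alpha> * (\<alpha> + \<gamma>)" using assms by (simp add: algebra_simps)
  finally have A: "0 < \<alpha> - l" using assms by (simp add: mult.commute)
  have "4 * ((\<alpha> - l) * (\<gamma> - l)) = \<beta>\<^sup>2 + 4 * l\<^sup>2"
    using lag by (simp add: algebra_simps power2_eq_square)
  then have AG: "4 * ((\<alpha> - l) * (\<gamma> - l)) \<ge> \<beta>\<^sup>2" by simp
  have "l * (x\<^sup>2 + y\<^sup>2) \<le> \<alpha> * x\<^sup>2 + \<gamma> * y\<^sup>2 - \<beta> * x * y" for x y
  proof -
    have "4 * (\<alpha> - l) * ((\<alpha> - l) * x\<^sup>2 - \<beta> * x * y + (\<gamma> - l) * y\<^sup>2)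
        = (2 * (\<alpha> - l) * x - \<beta> * y)\<^sup>2 + (4 * ((\<alpha> - l) * (\<gamma> - l)) - \<beta>\<^sup>2) * y\<^sup>2"
      by (simp add: algebra_simps power2_eq_square)
    also have "\<dots> \<ge> 0" using AG by simp
    finally have "(\<alpha> - l) * x\<^sup>2 - \<beta> * x * y + (\<gamma> - l) * y\<^sup>2 \<ge> 0"
      using A by (simp add: zero_le_mult_iff)
    then show ?thesis by (simp add: algebra_simps)
  qed
  with l show thesis by (rule that)
qed

locale adaptive_gains =
  fixes J :: "real^3^3" and kR k\<Omega> k\<Delta> a \<mu> \<delta> :: real
  assumes J: "sym_pos_def J"
    and pos: "0 < kR" "0 < k\<Omega>" "0 < k\<Delta>"
    and a: "0 < a" "a < 1"
    and mu: "0 < \<mu>" "\<mu> < 4 * (1 - a) * kR * k\<Omega> / (4 * (1 - a) * kR + k\<Omega>\<^sup>2)"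
begin

abbreviation "B \<equiv> level_B a \<mu> k\<Delta> \<delta> kR"

lemma mu_mult: "\<mu> * (4 * (1 - a) * kR + k\<Omega>\<^sup>2) < 4 * (1 - a) * kR * k\<Omega>"
proof -
  have "0 < 4 * (1 - a) * kR + k\<Omega>\<^sup>2" using pos a by (simp add: add_pos_pos)
  then show ?thesis using mu by (simp add: pos_less_divide_eq)
qed

text \<open>With c = sqrt ((1 - a) kR), the arithmetic-geometric inequality 4 c k\<Omega> \<le> 4
  c^2 + k\<Omega>^2 reduces the condition on \<open>\<mu>\<close> to \<open>\<mu> < c\<close>. This
  is what keeps V bounded below by a positive multiple of the energy.\<close>

lemma mu_less_sqrt: "\<mu> < sqrt kR"
proof -
  define c where "c = sqrt ((1 - a) * kR)"
  have c: "c > 0" "c\<^sup>2 = (1 - a) * kR" using pos a by (auto simp: c_def)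
  have "0 \<le> (2 * c - k\<Omega>)\<^sup>2" by simp
  then have "4 * c * k\<Omega> \<le> 4 * c\<^sup>2 + k\<Omega>\<^sup>2" by (simp add: power2_eq_square algebra_simps)
  then have "\<mu> * (4 * c * k\<Omega>) \<le> \<mu> * (4 * c\<^sup>2 + k\<Omega>\<^sup>2)" using mu by simp
  also have "\<dots> < 4 * c\<^sup>2 * k\<Omega>"
  proof -
    have "4 * (1 - a) * kR = 4 * c\<^sup>2" using c(2) by (simp only: mult.assoc)
    with mu_mult show ?thesis by (simp only:)
  qed
  also have "\<dots> = c * (4 * c * k\<Omega>)" by (simp add: power2_eq_square)
  finally have "\<mu> < c" using c pos by simp
  also have "c \<le> sqrt kR" unfolding c_def using a pos by (simp add: mult_le_cancel_right1)
  finally show ?thesis .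
qed

lemma mu_less_k\<Omega>: "\<mu> < k\<Omega>"
proof -
  have "4 * (1 - a) * kR * \<mu> + \<mu> * k\<Omega>\<^sup>2 < 4 * (1 - a) * kR * k\<Omega>"
    using mu_mult by (simp add: algebra_simps)
  moreover have "0 < \<mu> * k\<Omega>\<^sup>2" using mu pos by simp
  ultimately have "(4 * (1 - a) * kR) * \<mu> < (4 * (1 - a) * kR) * k\<Omega>" by linarith
  then show ?thesis using a pos by (simp add: mult_less_cancel_left)
qed

text \<open>The coefficients are those of the upper bound for the derivative of V. Cleared of its
  denominator, the condition on \<open>\<mu>\<close> reads \<mu> k\<Omega>^2 < 4 (1 - a) kR
  (k\<Omega> - \<mu>), which implies the discriminant condition because 1 - a is at most 1.\<close>

lemma dissipation_rate:
  obtains l where "0 < l"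
    "\<And>x y. l * (x\<^sup>2 + y\<^sup>2) \<le> (\<mu> * kR) * x\<^sup>2 + (k\<Omega> - \<mu>) * y\<^sup>2 - (\<mu> * k\<Omega>) * x * y"
proof (rule positive_definite_form_bound)
  have "\<mu> * k\<Omega>\<^sup>2 < 4 * (1 - a) * kR * (k\<Omega> - \<mu>)" using mu_mult by (simp add: algebra_simps)
  also have "\<dots> \<le> 4 * 1 * kR * (k\<Omega> - \<mu>)"
    using a pos mu_less_k\<Omega> by (intro mult_right_mono mult_left_mono) auto
  finally have "\<mu> * (\<mu> * k\<Omega>\<^sup>2) < \<mu> * (4 * kR * (k\<Omega> - \<mu>))" using mu by simp
  then show "(\<mu> * k\<Omega>)\<^sup>2 < 4 * (\<mu> * kR) * (k\<Omega> - \<mu>)"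
    by (simp add: power2_eq_square algebra_simps)
qed (use mu pos mu_less_k\<Omega> in auto)

text \<open>The cross term is dominated because $|s|^2 \le 2 q$ and $\mu < \sqrt{k_R}$.\<close>
lemma cross_term_bound:
  fixes s e :: "real^3"
  assumes "(norm s)\<^sup>2 \<le> 2 * q"
  shows "\<bar>\<mu> * (s \<bullet> e)\<bar> \<le> \<mu> / sqrt kR * (kR * q + (norm e)\<^sup>2 / 2)"
proof -
  define r where "r = sqrt kR"
  have r: "r > 0" "r\<^sup>2 = kR" using pos by (auto simp: r_def)
  have "\<bar>s \<bullet> e\<bar> \<le> norm s * norm e" by (rule Cauchy_Schwarz_ineq2)
  moreover have "0 \<le> (r * norm s - norm e)\<^sup>2" by simp
  then have "2 * r * (norm s * norm e) \<le> r\<^sup>2 * (norm s)\<^sup>2 + (norm e)\<^sup>2"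
    by (simp add: power2_eq_square algebra_simps)
  moreover have "r\<^sup>2 * (norm s)\<^sup>2 \<le> r\<^sup>2 * (2 * q)" using assms by (intro mult_left_mono) auto
  moreover have "2 * r * \<bar>s \<bullet> e\<bar> \<le> 2 * r * (norm s * norm e)"
    using calculation(1) r by (intro mult_left_mono) auto
  ultimately have "r * \<bar>s \<bullet> e\<bar> \<le> kR * q + (norm e)\<^sup>2 / 2"
    using r(2) by (simp add: algebra_simps)
  then have "\<bar>s \<bullet> e\<bar> \<le> (kR * q + (norm e)\<^sup>2 / 2) / r" using r by (simp add: field_simps)
  then have "\<mu> * \<bar>s \<bullet> e\<bar> \<le> \<mu> * ((kR * q + (norm e)\<^sup>2 / 2) / r)" using mu by (intro mult_left_mono) auto
  then show ?thesis using mu by (simp add: abs_mult r_def)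
qed

text \<open>The quotient in \<open>level_B\<close> is (1 - r) / (1 + r). The left side of the
  inequality bounds the initial value of V, the right side is the lower bound for V at energy
  \<open>2 * a * kR\<close>, so V cannot climb to a larger energy. \<open>B\<close> subtracts all of
  D = \<delta>^2 / (2 k\<Delta>), which leaves the slack r D.\<close>

lemma level_B_mult:
  defines "r \<equiv> \<mu> / sqrt kR"
  shows "(1 + r) * B + \<delta>\<^sup>2 / (2 * k\<Delta>) \<le> (1 - r) * (2 * a * kR)" "0 < r" "r < 1"
proof -
  show r: "0 < r" "r < 1" using mu mu_less_sqrt pos by (auto simp: r_def)
  have "sqrt kR - \<mu> = sqrt kR * (1 - r)" "sqrt kR + \<mu> = sqrt kR * (1 + r)"
    using pos by (simp_all add: r_def algebra_simps)
  then have "(sqrt kR - \<mu>) / (sqrt kR + \<mu>) = (1 - r) / (1 + r)"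
    using pos by simp
  moreover define D where "D = \<delta>\<^sup>2 / (2 * k\<Delta>)"
  ultimately have "B = 2 * a * ((1 - r) / (1 + r)) * kR - D"
    by (simp add: level_B_def)
  then have "(1 + r) * B = (1 - r) * (2 * a * kR) - (1 + r) * D"
    using r by (simp add: field_simps)
  moreover have "0 \<le> r * D" using r pos by (simp add: D_def)
  ultimately have "(1 + r) * B + D \<le> (1 - r) * (2 * a * kR)"
    by (simp add: algebra_simps)
  then show "(1 + r) * B + \<delta>\<^sup>2 / (2 * k\<Delta>) \<le> (1 - r) * (2 * a * kR)"
    by (simp only: D_def)
qed

end

text \<open>The interface that both references satisfy. Continuity and bounds uniform in time serve
  global existence; the bound on \<open>\<Omega>r\<close> is used again for the limit of the
  disturbance error.\<close>

locale tracking_reference =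
  fixes Rr :: "real \<Rightarrow> real^3^3" and \<Omega>r d\<Omega>r :: "real \<Rightarrow> real^3"
  assumes Rr_SO3: "\<And>t. 0 \<le> t \<Longrightarrow> Rr t \<in> SO3"
    and Rr_deriv: "\<And>t. 0 \<le> t \<Longrightarrow> (Rr has_vector_derivative Rr t ** hat (\<Omega>r t)) (at t within {0..})"
    and \<Omega>r_deriv: "\<And>t. 0 \<le> t \<Longrightarrow> (\<Omega>r has_vector_derivative d\<Omega>r t) (at t within {0..})"
    and d\<Omega>r_cont: "continuous_on {0..} d\<Omega>r"
    and \<Omega>r_bounded: "bounded (\<Omega>r ` {0..})"
    and d\<Omega>r_bounded: "bounded (d\<Omega>r ` {0..})"

locale tracking_loop = adaptive_gains + tracking_reference
begin

text \<open>The plant with the control inserted, solved for the derivative of the angular velocity: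
  the gyroscopic term has cancelled, and the inertia survives only in front of the disturbance
  error.\<close>

definition acceleration :: "real^3 \<Rightarrow> real \<Rightarrow> real^3^3 \<Rightarrow> real^3 \<Rightarrow> real^3 \<Rightarrow> real^3" where
  "acceleration \<Delta> t R \<Omega> D = - kR *\<^sub>R skew_vec (transpose (Rr t) ** R) - k\<Omega> *\<^sub>R (\<Omega> - \<Omega>r t)
     + cross3 \<Omega> (\<Omega>r t) + d\<Omega>r t + matrix_inv J *v (\<Delta> - D)"

definition adaptation :: "real \<Rightarrow> real^3^3 \<Rightarrow> real^3 \<Rightarrow> real^3" where
  "adaptation t R \<Omega> = k\<Delta> *\<^sub>R (matrix_inv J *v ((\<Omega> - \<Omega>r t) + \<mu> *\<^sub>R skew_vec (transpose (Rr t) ** R)))"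

definition solution_on :: "real set \<Rightarrow> real^3 \<Rightarrow> (real \<Rightarrow> real^3^3) \<Rightarrow> (real \<Rightarrow> real^3) \<Rightarrow> (real \<Rightarrow> real^3) \<Rightarrow> bool" where
  "solution_on I \<Delta> R \<Omega> D \<longleftrightarrow> (\<forall>t\<in>I. R t \<in> SO3
     \<and> (R has_vector_derivative R t ** hat (\<Omega> t)) (at t within I)
     \<and> (\<Omega> has_vector_derivative acceleration \<Delta> t (R t) (\<Omega> t) (D t)) (at t within I)
     \<and> (D has_vector_derivative adaptation t (R t) (\<Omega> t)) (at t within I))"

end

text \<open>The interval is left open on purpose: compact intervals feed the existence proof, at a
  stage where no global solution is known, and the half-line feeds the convergence proof.\<close>

locale tracking_solution = tracking_loop +
  fixes I :: "real set" and \<Delta> :: "real^3"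
    and R :: "real \<Rightarrow> real^3^3" and \<Omega> D :: "real \<Rightarrow> real^3"
  assumes I: "I = {0..} \<or> (\<exists>T\<ge>0. I = {0..T})"
    and sol: "solution_on I \<Delta> R \<Omega> D"
    and D0: "D 0 = 0" and \<Delta>_le: "norm \<Delta> \<le> \<delta>"
    and energy0: "kR * attitude_gap (transpose (Rr 0) ** R 0) + (norm (\<Omega> 0 - \<Omega>r 0))\<^sup>2 / 2 \<le> B"
begin

definition "Q t = transpose (Rr t) ** R t"
definition "s t = skew_vec (Q t)"
definition "q t = attitude_gap (Q t)"
definition "e t = \<Omega> t - \<Omega>r t"
definition "d t = \<Delta> - D t"

definition "V t = kR * q t + 1/2 * (e t \<bullet> e t) + \<mu> * (s t \<bullet> e t) + 1 / (2 * k\<Delta>) * (d t \<bullet> d t)"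

section \<open>Derivatives of the errors along the closed loop\<close>

lemma I_simps: "0 \<in> I" "I \<subseteq> {0..}" "t \<in> I \<Longrightarrow> {0..t} \<subseteq> I" "t \<in> I \<Longrightarrow> 0 \<le> t"
  using I by auto

lemma Q_SO3: "t \<in> I \<Longrightarrow> Q t \<in> SO3"
  using sol Rr_SO3 I_simps unfolding Q_def solution_on_def by (meson SO3_mult SO3_transpose)

text \<open>Writing the angular velocity as \<open>e t\<close> plus \<open>\<Omega>r t\<close>
  separates the part driven by the error from a commutator, which is harmless for the trace and for
  V.\<close>

lemma Q_deriv:
  assumes t: "t \<in> I"
  shows "(Q has_vector_derivative (Q t ** hat (e t) + (Q t ** hat (\<Omega>r t) - hat (\<Omega>r t) ** Q t))) (at t within I)"
proof -
  have "((\<lambda>t. transpose (Rr t)) has_vector_derivative transpose (Rr t ** hat (\<Omega>r t))) (at t within I)"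
    using t I_simps
    by (intro bounded_linear.has_vector_derivative[OF bounded_linear_transpose3]
        has_vector_derivative_within_subset[OF Rr_deriv]) auto
  moreover have "(R has_vector_derivative R t ** hat (\<Omega> t)) (at t within I)"
    using sol t by (simp add: solution_on_def)
  ultimately have "(Q has_vector_derivative
     transpose (Rr t) ** (R t ** hat (\<Omega> t)) + transpose (Rr t ** hat (\<Omega>r t)) ** R t) (at t within I)"
    unfolding Q_def[abs_def] by (rule bounded_bilinear.has_vector_derivative[OF bounded_bilinear_matrix_mult])
  moreover have "transpose (Rr t) ** (R t ** hat (\<Omega> t)) = Q t ** hat (\<Omega> t)"
    by (simp add: Q_def matrix_mul_assoc)
  moreover have "transpose (Rr t ** hat (\<Omega>r t)) ** R t = - (hat (\<Omega>r t) ** Q t)"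
    by (simp add: Q_def matrix_transpose_mul transpose_hat matrix_mul_assoc
      bounded_bilinear.minus_left[OF bounded_bilinear_matrix_mult])
  moreover have "Q t ** hat (\<Omega> t) = Q t ** hat (e t) + Q t ** hat (\<Omega>r t)"
    by (simp add: e_def bounded_linear.linear[OF bounded_linear_hat, THEN linear_diff] flip: matrix_add_ldistrib)
  ultimately show ?thesis by (simp add: algebra_simps)
qed

lemma s_deriv:
  assumes t: "t \<in> I"
  shows "(s has_vector_derivative (skew_vec (Q t ** hat (e t)) + cross3 (s t) (\<Omega>r t))) (at t within I)"
proof -
  have "(s has_vector_derivative
      skew_vec (Q t ** hat (e t) + (Q t ** hat (\<Omega>r t) - hat (\<Omega>r t) ** Q t))) (at t within I)"
    unfolding s_def[abs_def]
    by (intro bounded_linear.has_vector_derivative[OF bounded_linear_skew_vec] Q_deriv t)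
  then show ?thesis
    by (simp add: linear_add[OF bounded_linear.linear[OF bounded_linear_skew_vec]] skew_vec_commutator s_def)
qed

lemma q_deriv:
  assumes t: "t \<in> I"
  shows "(q has_vector_derivative (s t \<bullet> e t)) (at t within I)"
proof -
  have "((\<lambda>t. trace (Q t)) has_vector_derivative
      trace (Q t ** hat (e t) + (Q t ** hat (\<Omega>r t) - hat (\<Omega>r t) ** Q t))) (at t within I)"
    by (intro bounded_linear.has_vector_derivative[OF bounded_linear_trace3] Q_deriv t)
  then have "((\<lambda>t. trace (Q t)) has_vector_derivative - 2 * (s t \<bullet> e t)) (at t within I)"
    by (simp add: trace_add trace_sub trace_mul_sym[of "hat (\<Omega>r t)"] trace_mult_hat s_def)
  then have "((\<lambda>t. (3 - trace (Q t)) / 2) has_vector_derivative (0 - - 2 * (s t \<bullet> e t)) / 2) (at t within I)"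
    by (intro has_vector_derivative_divide has_vector_derivative_diff has_vector_derivative_const)
  then show ?thesis by (simp add: q_def[abs_def] attitude_gap_def)
qed

lemma e_deriv:
  assumes t: "t \<in> I"
  shows "(e has_vector_derivative
     (- kR *\<^sub>R s t - k\<Omega> *\<^sub>R e t + cross3 (e t) (\<Omega>r t)) + matrix_inv J *v d t) (at t within I)"
proof -
  have "(e has_vector_derivative acceleration \<Delta> t (R t) (\<Omega> t) (D t) - d\<Omega>r t) (at t within I)"
    unfolding e_def[abs_def] using t sol I_simps
    by (intro has_vector_derivative_diff has_vector_derivative_within_subset[OF \<Omega>r_deriv])
      (auto simp: solution_on_def)
  moreover have "cross3 (e t) (\<Omega>r t) = cross3 (\<Omega> t) (\<Omega>r t)"
    by (simp add: e_def Cross3.left_diff_distrib)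
  ultimately show ?thesis
    by (simp add: acceleration_def e_def s_def Q_def d_def algebra_simps)
qed

lemma d_deriv:
  assumes t: "t \<in> I"
  shows "(d has_vector_derivative - (k\<Delta> *\<^sub>R (matrix_inv J *v (e t + \<mu> *\<^sub>R s t)))) (at t within I)"
proof -
  have "(d has_vector_derivative 0 - adaptation t (R t) (\<Omega> t)) (at t within I)"
    unfolding d_def[abs_def] using t sol
    by (intro has_vector_derivative_diff has_vector_derivative_const) (auto simp: solution_on_def)
  then show ?thesis by (simp add: adaptation_def e_def s_def Q_def)
qed

lemmas inner_deriv = bounded_bilinear.has_vector_derivative[OF bounded_bilinear_inner]

text \<open>The weights of V are matched to the loop: the derivative of \<open>q\<close> cancels
  against the proportional feedback, and both inner products with the disturbance error cancel
  against the adaptation. What remains is quadratic in \<open>s\<close> and \<open>e\<close>, apart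
  from the form estimated by \<open>inner_skew_vec_SO3_le\<close>.\<close>

lemma V_deriv:
  assumes t: "t \<in> I"
  shows "(V has_vector_derivative - k\<Omega> * (e t \<bullet> e t)
      + \<mu> * (e t \<bullet> skew_vec (Q t ** hat (e t)) - kR * (s t \<bullet> s t) - k\<Omega> * (s t \<bullet> e t))) (at t within I)"
proof -
  define Ji where "Ji = matrix_inv J"
  define e' where "e' = (- kR *\<^sub>R s t - k\<Omega> *\<^sub>R e t + cross3 (e t) (\<Omega>r t)) + Ji *v d t"
  define s' where "s' = skew_vec (Q t ** hat (e t)) + cross3 (s t) (\<Omega>r t)"
  define d' where "d' = - (k\<Delta> *\<^sub>R (Ji *v (e t + \<mu> *\<^sub>R s t)))"
  note ders = e_deriv[OF t, folded Ji_def, folded e'_def] s_deriv[OF t, folded s'_def]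
     d_deriv[OF t, folded Ji_def, folded d'_def] q_deriv[OF t]
  have f0: "(V has_vector_derivative kR * (s t \<bullet> e t) + 1/2 * (e t \<bullet> e' + e' \<bullet> e t) + \<mu> * (s t \<bullet> e' + s' \<bullet> e t)
      + 1 / (2 * k\<Delta>) * (d t \<bullet> d' + d' \<bullet> d t)) (at t within I)"
    unfolding V_def[abs_def]
    by (intro has_vector_derivative_add has_vector_derivative_mult_right inner_deriv ders)
  have f1: "e t \<bullet> e' = - kR * (s t \<bullet> e t) - k\<Omega> * (e t \<bullet> e t) + (Ji *v d t) \<bullet> e t"
    by (simp add: e'_def inner_right_distrib inner_diff_right dot_cross_self inner_commute)
  have f2: "s t \<bullet> e' + s' \<bullet> e t = - kR * (s t \<bullet> s t) - k\<Omega> * (s t \<bullet> e t) + (Ji *v d t) \<bullet> s t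
     + e t \<bullet> skew_vec (Q t ** hat (e t))"
  proof -
    \<comment> \<open>The turning of the reference frame enters through two scalar triple products
      of the same vectors with opposite orientation.\<close>
    have "s t \<bullet> cross3 (e t) (\<Omega>r t) + cross3 (s t) (\<Omega>r t) \<bullet> e t = 0"
      by (simp add: cross3_def inner_vec_def sum_3 algebra_simps)
    then show ?thesis
      by (simp add: e'_def s'_def inner_left_distrib inner_right_distrib inner_diff_right inner_commute)
  qed
  have f3: "1 / (2 * k\<Delta>) * (d t \<bullet> d' + d' \<bullet> d t) = - ((Ji *v d t) \<bullet> e t) - \<mu> * ((Ji *v d t) \<bullet> s t)"
  proof -
    have "d t \<bullet> d' = - (k\<Delta> * ((Ji *v d t) \<bullet> e t + \<mu> * ((Ji *v d t) \<bullet> s t)))"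
      using J by (simp add: d'_def sym_pos_def_inverse(3) Ji_def inner_right_distrib)
    moreover have "d' \<bullet> d t = d t \<bullet> d'" by (rule inner_commute)
    ultimately show ?thesis using pos by (simp add: field_simps)
  qed
  have f4: "e' \<bullet> e t = e t \<bullet> e'" by (rule inner_commute)
  have f5: "1/2 * (x + x) = x" for x :: real by simp
  have "(V has_vector_derivative kR * (s t \<bullet> e t)
      + (- kR * (s t \<bullet> e t) - k\<Omega> * (e t \<bullet> e t) + (Ji *v d t) \<bullet> e t)
      + \<mu> * (- kR * (s t \<bullet> s t) - k\<Omega> * (s t \<bullet> e t) + (Ji *v d t) \<bullet> s t
          + e t \<bullet> skew_vec (Q t ** hat (e t)))
      + (- ((Ji *v d t) \<bullet> e t) - \<mu> * ((Ji *v d t) \<bullet> s t))) (at t within I)"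
    using f0 unfolding f4 f5 f1 f2 f3 .
  then show ?thesis
    by (rule back_subst[where P = "\<lambda>v. (V has_vector_derivative v) (at t within I)"])
      (simp add: algebra_simps)
qed

end

subsection \<open>Convergence\<close>

lemma bounded_bilinear_skew_vec_hat: "bounded_bilinear (\<lambda>A w. skew_vec (A ** hat w))"
  by (subst bilinear_conv_bounded_bilinear[symmetric])
    (auto simp: bilinear_def linear_iff mat3_simps field_simps)

context tracking_solution
begin

section \<open>A priori bounds from the Lyapunov function\<close>

lemma q_bounds: "t \<in> I \<Longrightarrow> 0 \<le> q t" "t \<in> I \<Longrightarrow> q t \<le> 2"
  using attitude_gap_bounds[OF Q_SO3] by (auto simp: q_def)

lemma norm_s_sq: "t \<in> I \<Longrightarrow> (norm (s t))\<^sup>2 = q t * (2 - q t)"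
  by (simp add: s_def q_def norm_skew_vec_SO3 Q_SO3)

lemma norm_s_sq_le: "t \<in> I \<Longrightarrow> (norm (s t))\<^sup>2 \<le> 2 * q t"
  by (simp add: norm_s_sq algebra_simps)

lemma V_dissipation:
  obtains l where "0 < l"
    "\<And>t. t \<in> I \<Longrightarrow> \<exists>v. (V has_vector_derivative v) (at t within I) \<and> v \<le> - l * ((norm (s t))\<^sup>2 + (norm (e t))\<^sup>2)"
proof -
  obtain l where l: "0 < l"
    "\<And>x y. l * (x\<^sup>2 + y\<^sup>2) \<le> (\<mu> * kR) * x\<^sup>2 + (k\<Omega> - \<mu>) * y\<^sup>2 - (\<mu> * k\<Omega>) * x * y"
    by (rule dissipation_rate) (rule that)
  show thesis
  proof (rule that[OF l(1)])
    fix t assume t: "t \<in> I"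
    have "- (s t \<bullet> e t) \<le> norm (s t) * norm (e t)"
      using Cauchy_Schwarz_ineq2[of "s t" "e t"] by linarith
    then have 1: "(\<mu> * k\<Omega>) * - (s t \<bullet> e t) \<le> (\<mu> * k\<Omega>) * (norm (s t) * norm (e t))"
      using mu pos by (intro mult_left_mono) auto
    have 2: "\<mu> * (e t \<bullet> skew_vec (Q t ** hat (e t))) \<le> \<mu> * (norm (e t))\<^sup>2"
      using mu by (intro mult_left_mono inner_skew_vec_SO3_le Q_SO3 t) auto
    have "- k\<Omega> * (e t \<bullet> e t)
      + \<mu> * (e t \<bullet> skew_vec (Q t ** hat (e t)) - kR * (s t \<bullet> s t) - k\<Omega> * (s t \<bullet> e t))
      = - k\<Omega> * (norm (e t))\<^sup>2 + \<mu> * (e t \<bullet> skew_vec (Q t ** hat (e t)))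
        - \<mu> * kR * (norm (s t))\<^sup>2 + (\<mu> * k\<Omega>) * - (s t \<bullet> e t)"
      by (simp add: power2_norm_eq_inner algebra_simps)
    also have "\<dots> \<le> - l * ((norm (s t))\<^sup>2 + (norm (e t))\<^sup>2)"
      using 1 2 l(2)[of "norm (s t)" "norm (e t)"] by (simp add: algebra_simps)
    finally show "\<exists>v. (V has_vector_derivative v) (at t within I) \<and> v \<le> - l * ((norm (s t))\<^sup>2 + (norm (e t))\<^sup>2)"
      using V_deriv[OF t] by blast
  qed
qed

lemma V_le_V0:
  assumes t: "t \<in> I"
  shows "V t \<le> V 0"
proof -
  obtain l where l: "0 < l"
    "\<And>t. t \<in> I \<Longrightarrow> \<exists>v. (V has_vector_derivative v) (at t within I) \<and> v \<le> - l * ((norm (s t))\<^sup>2 + (norm (e t))\<^sup>2)"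
    using V_dissipation by blast
  have "\<exists>v. (V has_vector_derivative v) (at u within I) \<and> v \<le> 0" if "u \<in> I" for u
  proof -
    have "- l * ((norm (s u))\<^sup>2 + (norm (e u))\<^sup>2) \<le> 0" using l(1) by simp
    then show ?thesis using l(2)[OF that] order_trans by blast
  qed
  then obtain v where v: "\<And>u. u \<in> I \<Longrightarrow> (V has_vector_derivative v u) (at u within I) \<and> v u \<le> 0"
    by metis
  have "V t \<le> V 0 + 0 * (t - 0)"
  proof (rule real_derivative_upper_bound)
    fix u assume "u \<in> {0..t}"
    then have u: "u \<in> I" using I_simps(3)[OF t] by blast
    show "(V has_vector_derivative v u) (at u within {0..t})"
      using v[OF u] I_simps(3)[OF t] has_vector_derivative_within_subset by blast
    show "v u \<le> 0" using v[OF u] by simp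
  qed (use I_simps(4)[OF t] in simp)
  then show ?thesis by simp
qed

lemma V_ge:
  assumes t: "t \<in> I"
  shows "(1 - \<mu> / sqrt kR) * (kR * q t + (norm (e t))\<^sup>2 / 2) + (norm (d t))\<^sup>2 / (2 * k\<Delta>) \<le> V t"
  using cross_term_bound[OF norm_s_sq_le[OF t], of "e t"]
  by (simp add: V_def left_diff_distrib flip: power2_norm_eq_inner)

lemma V0_le: "V 0 \<le> (1 + \<mu> / sqrt kR) * B + \<delta>\<^sup>2 / (2 * k\<Delta>)"
proof -
  have 0: "0 \<in> I" by (rule I_simps)
  have "V 0 \<le> (1 + \<mu> / sqrt kR) * (kR * q 0 + (norm (e 0))\<^sup>2 / 2) + (norm (d 0))\<^sup>2 / (2 * k\<Delta>)"
    using cross_term_bound[OF norm_s_sq_le[OF 0], of "e 0"]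
    by (simp add: V_def distrib_right flip: power2_norm_eq_inner)
  also have "\<dots> \<le> (1 + \<mu> / sqrt kR) * B + \<delta>\<^sup>2 / (2 * k\<Delta>)"
    using energy0 level_B_mult(2) pos D0 \<Delta>_le
    by (intro add_mono mult_left_mono divide_right_mono power_mono) (auto simp: q_def Q_def e_def d_def)
  finally show ?thesis .
qed

lemma energy_le:
  assumes t: "t \<in> I"
  shows "kR * q t + (norm (e t))\<^sup>2 / 2 \<le> 2 * a * kR"
proof -
  have "0 \<le> (norm (d t))\<^sup>2 / (2 * k\<Delta>)" using pos by simp
  then have "(1 - \<mu> / sqrt kR) * (kR * q t + (norm (e t))\<^sup>2 / 2) \<le> V t" using V_ge[OF t] by linarith
  also have "\<dots> \<le> (1 - \<mu> / sqrt kR) * (2 * a * kR)"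
    using V_le_V0[OF t] V0_le level_B_mult(1) by linarith
  finally show ?thesis using level_B_mult(3) by simp
qed

lemma q_le: "t \<in> I \<Longrightarrow> q t \<le> 2 * a"
proof -
  assume t: "t \<in> I"
  have "0 \<le> (norm (e t))\<^sup>2 / 2" by simp
  then have "kR * q t \<le> 2 * a * kR" using energy_le[OF t] by linarith
  also have "\<dots> = kR * (2 * a)" by simp
  finally have "kR * q t \<le> kR * (2 * a)" .
  then show ?thesis using pos by simp
qed

text \<open>The bound depends on \<open>kR\<close> alone, so a cut-off radius can be fixed from it
  before any solution is known.\<close>

lemma norm_e_le: "t \<in> I \<Longrightarrow> norm (e t) \<le> 2 * sqrt kR"
proof -
  assume t: "t \<in> I"
  have "0 \<le> kR * q t" using q_bounds(1)[OF t] pos by simp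
  then have "(norm (e t))\<^sup>2 \<le> 4 * (a * kR)" using energy_le[OF t] by simp
  also have "\<dots> \<le> 4 * kR" using a pos by simp
  also have "\<dots> = (2 * sqrt kR)\<^sup>2" using pos by (simp add: power_mult_distrib)
  finally show ?thesis by (rule power2_le_imp_le) (use pos in auto)
qed

lemma V_nonneg: "t \<in> I \<Longrightarrow> 0 \<le> V t"
proof -
  assume t: "t \<in> I"
  have "0 \<le> (1 - \<mu> / sqrt kR) * (kR * q t + (norm (e t))\<^sup>2 / 2) + (norm (d t))\<^sup>2 / (2 * k\<Delta>)"
    using level_B_mult(3) pos q_bounds(1)[OF t] by (intro add_nonneg_nonneg mult_nonneg_nonneg) auto
  then show "0 \<le> V t" using V_ge[OF t] by linarith
qed

lemma norm_d_le:
  assumes t: "t \<in> I"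
  shows "norm (d t) \<le> sqrt (2 * k\<Delta> * V 0)"
proof -
  have "0 \<le> (1 - \<mu> / sqrt kR) * (kR * q t + (norm (e t))\<^sup>2 / 2)"
    using level_B_mult(3) pos q_bounds(1)[OF t] by (intro add_nonneg_nonneg mult_nonneg_nonneg) auto
  then have "(norm (d t))\<^sup>2 / (2 * k\<Delta>) \<le> V 0" using V_ge[OF t] V_le_V0[OF t] by linarith
  then have "(norm (d t))\<^sup>2 \<le> 2 * k\<Delta> * V 0" using pos by (simp add: field_simps)
  then show ?thesis by (rule real_le_rsqrt)
qed

lemma norm_s_le_1:
  assumes t: "t \<in> I"
  shows "norm (s t) \<le> 1"
proof -
  have "0 \<le> (q t - 1)\<^sup>2" by simp
  then have "(norm (s t))\<^sup>2 \<le> 1\<^sup>2"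
    using norm_s_sq[OF t] by (simp add: power2_eq_square algebra_simps)
  then show ?thesis by (rule power2_le_imp_le) auto
qed

context
  assumes I_all: "I = {0..}"
begin

text \<open>Barbalat's argument needs a Lipschitz constant for the sum of squares. In its derivative
  the cross products with \<open>\<Omega>r\<close> are orthogonal to \<open>s\<close> and
  \<open>e\<close> and vanish; the rest is bounded because \<open>s\<close>, \<open>e\<close>,
  \<open>d\<close> and the norm \<open>sqrt 3\<close> of \<open>Q\<close> are.\<close>

lemma s_e_tendsto_0: "((\<lambda>t. (norm (s t))\<^sup>2 + (norm (e t))\<^sup>2) \<longlongrightarrow> 0) at_top"
proof -
  define p where "p t = (norm (s t))\<^sup>2 + (norm (e t))\<^sup>2" for t
  obtain l where l: "0 < l"
    "\<And>t. t \<in> I \<Longrightarrow> \<exists>v. (V has_vector_derivative v) (at t within I) \<and> v \<le> - l * p t"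
    using V_dissipation unfolding p_def by blast
  obtain v where v: "\<And>t. 0 \<le> t \<Longrightarrow> (V has_vector_derivative v t) (at t within {0..}) \<and> v t \<le> - l * p t"
    using l(2) I_all by (metis atLeast_iff)
  define e' where "e' t = (- kR *\<^sub>R s t - k\<Omega> *\<^sub>R e t + cross3 (e t) (\<Omega>r t)) + matrix_inv J *v d t" for t
  define s' where "s' t = skew_vec (Q t ** hat (e t)) + cross3 (s t) (\<Omega>r t)" for t
  have p': "(p has_vector_derivative (s t \<bullet> s' t + s' t \<bullet> s t) + (e t \<bullet> e' t + e' t \<bullet> e t)) (at t within I)"
    if "t \<in> I" for t
    unfolding p_def[abs_def] power2_norm_eq_inner e'_def s'_def
    by (intro has_vector_derivative_add inner_deriv s_deriv e_deriv that)
  obtain K where K: "0 < K" "\<And>A w. norm (skew_vec (A ** hat w)) \<le> norm A * norm w * K"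
    using bounded_bilinear.pos_bounded[OF bounded_bilinear_skew_vec_hat] by blast
  obtain Kj where Kj: "0 < Kj" "\<And>w. norm (matrix_inv J *v w) \<le> norm w * Kj"
    using bounded_linear.pos_bounded[OF bounded_linear_matrix_vector_mult[of "matrix_inv J"]] by blast
  define E where "E = 2 * sqrt kR"
  define Dm where "Dm = sqrt (2 * k\<Delta> * V 0)"
  have E: "E \<ge> 0" using pos by (simp add: E_def)
  define L where "L = 2 * (sqrt 3 * E * K) + 2 * (E * (kR + k\<Omega> * E + Dm * Kj))"
  have p'b: "\<bar>(s t \<bullet> s' t + s' t \<bullet> s t) + (e t \<bullet> e' t + e' t \<bullet> e t)\<bar> \<le> L" if t: "t \<in> I" for t
  proof -
    have "\<bar>s t \<bullet> skew_vec (Q t ** hat (e t))\<bar> \<le> norm (s t) * norm (skew_vec (Q t ** hat (e t)))"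
      by (rule Cauchy_Schwarz_ineq2)
    also have "\<dots> \<le> 1 * (sqrt 3 * norm (e t) * K)"
      using K(2)[of "Q t" "e t"] norm_s_le_1[OF t] norm_SO3[OF Q_SO3[OF t]] by (intro mult_mono) auto
    also have "\<dots> \<le> 1 * (sqrt 3 * E * K)"
      using norm_e_le[OF t] K(1) unfolding E_def by (intro mult_left_mono mult_right_mono) auto
    also have "s t \<bullet> skew_vec (Q t ** hat (e t)) = s t \<bullet> s' t"
      by (simp add: s'_def inner_right_distrib dot_cross_self)
    finally have 1: "\<bar>s t \<bullet> s' t\<bar> \<le> sqrt 3 * E * K" by simp
    define w where "w = - kR *\<^sub>R s t - k\<Omega> *\<^sub>R e t + matrix_inv J *v d t"
    have "norm w \<le> norm (- kR *\<^sub>R s t - k\<Omega> *\<^sub>R e t) + norm (matrix_inv J *v d t)"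
      unfolding w_def by (rule norm_triangle_ineq)
    also have "\<dots> \<le> (norm (- kR *\<^sub>R s t) + norm (k\<Omega> *\<^sub>R e t)) + norm (d t) * Kj"
      by (intro add_mono norm_triangle_ineq4 Kj)
    also have "\<dots> = kR * norm (s t) + k\<Omega> * norm (e t) + norm (d t) * Kj"
      using pos by simp
    also have "\<dots> \<le> kR * 1 + k\<Omega> * E + Dm * Kj"
      using norm_s_le_1[OF t] norm_e_le[OF t] norm_d_le[OF t] pos Kj(1) unfolding E_def Dm_def
      by (intro add_mono mult_left_mono mult_right_mono) auto
    finally have w: "norm w \<le> kR + k\<Omega> * E + Dm * Kj" by simp
    have "\<bar>e t \<bullet> w\<bar> \<le> norm (e t) * norm w" by (rule Cauchy_Schwarz_ineq2)
    also have "\<dots> \<le> E * (kR + k\<Omega> * E + Dm * Kj)"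
      using w norm_e_le[OF t] E unfolding E_def by (intro mult_mono) auto
    also have "e t \<bullet> w = e t \<bullet> e' t"
      by (simp add: w_def e'_def inner_right_distrib inner_diff_right dot_cross_self)
    finally have "\<bar>e t \<bullet> e' t\<bar> \<le> E * (kR + k\<Omega> * E + Dm * Kj)" .
    with 1 show ?thesis
      unfolding L_def inner_commute[of "s' t"] inner_commute[of "e' t"] by linarith
  qed
  have lip: "\<bar>p t - p r\<bar> \<le> L * (t - r)" if "0 \<le> r" "r \<le> t" for r t
  proof -
    have "norm (p t - p r) \<le> L * (t - r)"
      using that I_all p'b
      by (intro vector_derivative_bound[where f' = "\<lambda>t. (s t \<bullet> s' t + s' t \<bullet> s t) + (e t \<bullet> e' t + e' t \<bullet> e t)"]
          has_vector_derivative_within_subset[OF p']) auto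
    then show ?thesis by simp
  qed
  have "(p \<longlongrightarrow> 0) at_top"
    using v V_nonneg I_all l(1) lip by (intro dissipation_tendsto_0[where V = V and V' = v]) (auto simp: p_def)
  then show ?thesis by (simp only: p_def[abs_def])
qed

lemma s_tendsto_0: "(s \<longlongrightarrow> 0) at_top" and e_tendsto_0: "(e \<longlongrightarrow> 0) at_top"
proof -
  have "((\<lambda>t. sqrt ((norm (s t))\<^sup>2 + (norm (e t))\<^sup>2)) \<longlongrightarrow> sqrt 0) at_top"
    by (intro tendsto_real_sqrt s_e_tendsto_0)
  then have lim: "((\<lambda>t. sqrt ((norm (s t))\<^sup>2 + (norm (e t))\<^sup>2)) \<longlongrightarrow> 0) at_top" by simp
  show "(s \<longlongrightarrow> 0) at_top" "(e \<longlongrightarrow> 0) at_top"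
    by (rule Lim_null_comparison[OF _ lim], simp add: real_le_rsqrt)+
qed

lemma q_tendsto_0: "(q \<longlongrightarrow> 0) at_top"
proof (rule Lim_null_comparison)
  have "((\<lambda>t. (norm (s t))\<^sup>2 / (2 * (1 - a))) \<longlongrightarrow> (norm (0 :: real^3))\<^sup>2 / (2 * (1 - a))) at_top"
    by (intro tendsto_intros s_tendsto_0) (use a in auto)
  then show "((\<lambda>t. (norm (s t))\<^sup>2 / (2 * (1 - a))) \<longlongrightarrow> 0) at_top" by simp
  have "norm (q t) \<le> (norm (s t))\<^sup>2 / (2 * (1 - a))" if "0 \<le> t" for t
  proof -
    have t: "t \<in> I" using that I_all by simp
    have "q t * (2 * (1 - a)) \<le> q t * (2 - q t)"
      using q_bounds(1)[OF t] q_le[OF t] by (intro mult_left_mono) auto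
    then show ?thesis using a q_bounds(1)[OF t] norm_s_sq[OF t] by (simp add: pos_le_divide_eq)
  qed
  then show "eventually (\<lambda>t. norm (q t) \<le> (norm (s t))\<^sup>2 / (2 * (1 - a))) at_top"
    by (auto simp: eventually_at_top_linorder)
qed

lemma d_tendsto_0: "(d \<longlongrightarrow> 0) at_top"
proof -
  obtain M where M: "\<And>t. 0 \<le> t \<Longrightarrow> norm (\<Omega>r t) \<le> M"
    using \<Omega>r_bounded unfolding bounded_iff by auto
  obtain Kc where Kc: "0 < Kc" "\<And>v w. norm (cross3 v w) \<le> norm v * norm w * Kc"
    using bounded_bilinear.pos_bounded[OF bounded_bilinear_cross3] by blast
  have cr: "((\<lambda>t. cross3 (e t) (\<Omega>r t)) \<longlongrightarrow> 0) at_top"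
  proof (rule Lim_null_comparison)
    have "((\<lambda>t. norm (e t) * M * Kc) \<longlongrightarrow> norm (0 :: real^3) * M * Kc) at_top"
      by (intro tendsto_intros e_tendsto_0)
    then show "((\<lambda>t. norm (e t) * M * Kc) \<longlongrightarrow> 0) at_top" by simp
    have "norm (cross3 (e t) (\<Omega>r t)) \<le> norm (e t) * M * Kc" if "0 \<le> t" for t
      using Kc(2)[of "e t" "\<Omega>r t"] M[OF that] Kc(1)
      by (meson mult_left_mono mult_right_mono norm_ge_zero less_imp_le order_trans)
    then show "eventually (\<lambda>t. norm (cross3 (e t) (\<Omega>r t)) \<le> norm (e t) * M * Kc) at_top"
      by (auto simp: eventually_at_top_linorder)
  qed
  define h where "h t = matrix_inv J *v (- (k\<Delta> *\<^sub>R (matrix_inv J *v (e t + \<mu> *\<^sub>R s t))))" for t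
  note Jl = bounded_linear_matrix_vector_mult
  have "((\<lambda>t. matrix_inv J *v d t) \<longlongrightarrow> 0) at_top"
  proof (rule input_tendsto_0[OF _ _ e_tendsto_0])
    show "(e has_vector_derivative (- kR *\<^sub>R s t - k\<Omega> *\<^sub>R e t + cross3 (e t) (\<Omega>r t)) + matrix_inv J *v d t)
        (at t within {0..})" if "0 \<le> t" for t
      using e_deriv[of t] that I_all by simp
    show "((\<lambda>t. matrix_inv J *v d t) has_vector_derivative h t) (at t within {0..})" if "0 \<le> t" for t
      using bounded_linear.has_vector_derivative[OF Jl d_deriv[of t]] that I_all by (simp add: h_def)
    have "((\<lambda>t. - kR *\<^sub>R s t - k\<Omega> *\<^sub>R e t + cross3 (e t) (\<Omega>r t)) \<longlongrightarrow> - kR *\<^sub>R 0 - k\<Omega> *\<^sub>R 0 + 0) at_top"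
      by (intro tendsto_intros cr s_tendsto_0 e_tendsto_0)
    then show "((\<lambda>t. - kR *\<^sub>R s t - k\<Omega> *\<^sub>R e t + cross3 (e t) (\<Omega>r t)) \<longlongrightarrow> 0) at_top" by simp
    have "(h \<longlongrightarrow> matrix_inv J *v (- (k\<Delta> *\<^sub>R (matrix_inv J *v (0 + \<mu> *\<^sub>R 0))))) at_top"
      unfolding h_def
      by (intro bounded_linear.tendsto[OF Jl] tendsto_intros s_tendsto_0 e_tendsto_0)
    then show "(h \<longlongrightarrow> 0) at_top" by simp
  qed
  from bounded_linear.tendsto[OF Jl[of J] this] show ?thesis
    using sym_pos_def_inverse(1)[OF J] by simp
qed

end

end

subsection \<open>Existence of solutions\<close>

text \<open>One constant for all nonnegative times is what \<open>global_lipschitz_ode\<close> asks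
  for. The closure rules below then assemble the right-hand side piece by piece.\<close>

definition uniformly_lipschitz :: "(real \<Rightarrow> 'a::real_normed_vector \<Rightarrow> 'b::real_normed_vector) \<Rightarrow> bool" where
  "uniformly_lipschitz h \<longleftrightarrow> (\<exists>L\<ge>0. \<forall>t\<ge>0. \<forall>x y. norm (h t x - h t y) \<le> L * norm (x - y))"

lemma uniformly_lipschitzI:
  assumes "0 \<le> L" "\<And>t x y. 0 \<le> t \<Longrightarrow> norm (h t x - h t y) \<le> L * norm (x - y)"
  shows "uniformly_lipschitz h"
  using assms unfolding uniformly_lipschitz_def by blast

lemma uniformly_lipschitzE:
  assumes "uniformly_lipschitz h"
  obtains L where "0 \<le> L" "\<And>t x y. 0 \<le> t \<Longrightarrow> norm (h t x - h t y) \<le> L * norm (x - y)"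
  using assms unfolding uniformly_lipschitz_def by blast

lemma uniformly_lipschitz_const: "uniformly_lipschitz (\<lambda>t x. c t)"
  by (rule uniformly_lipschitzI[of 0]) auto

lemma uniformly_lipschitz_id: "uniformly_lipschitz (\<lambda>t x. x)"
  by (rule uniformly_lipschitzI[of 1]) auto

lemma uniformly_lipschitz_bounded_linear:
  assumes B: "bounded_linear B" and h: "uniformly_lipschitz h"
  shows "uniformly_lipschitz (\<lambda>t x. B (h t x))"
proof -
  obtain L where L: "0 \<le> L" "\<And>t x y. 0 \<le> t \<Longrightarrow> norm (h t x - h t y) \<le> L * norm (x - y)"
    by (rule uniformly_lipschitzE[OF h]) (rule that)
  obtain K where K: "0 < K" "\<And>v. norm (B v) \<le> norm v * K"
    using bounded_linear.pos_bounded[OF B] by blast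
  show ?thesis
  proof (rule uniformly_lipschitzI)
    show "0 \<le> L * K" using L K by simp
    fix t :: real and x y assume t: "0 \<le> t"
    have "norm (B (h t x) - B (h t y)) = norm (B (h t x - h t y))"
      by (simp add: linear_diff[OF bounded_linear.linear[OF B]])
    also have "\<dots> \<le> norm (h t x - h t y) * K" by (rule K)
    also have "\<dots> \<le> (L * norm (x - y)) * K" using L(2)[OF t] K by (intro mult_right_mono) auto
    finally show "norm (B (h t x) - B (h t y)) \<le> L * K * norm (x - y)" by (simp add: mult_ac)
  qed
qed

lemma uniformly_lipschitz_add:
  assumes h: "uniformly_lipschitz h" and g: "uniformly_lipschitz g"
  shows "uniformly_lipschitz (\<lambda>t x. h t x + g t x)"
proof -
  obtain L where L: "0 \<le> L" "\<And>t x y. 0 \<le> t \<Longrightarrow> norm (h t x - h t y) \<le> L * norm (x - y)"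
    by (rule uniformly_lipschitzE[OF h]) (rule that)
  obtain K where K: "0 \<le> K" "\<And>t x y. 0 \<le> t \<Longrightarrow> norm (g t x - g t y) \<le> K * norm (x - y)"
    by (rule uniformly_lipschitzE[OF g]) (rule that)
  show ?thesis
  proof (rule uniformly_lipschitzI)
    show "0 \<le> L + K" using L K by simp
    fix t :: real and x y assume t: "0 \<le> t"
    have "norm ((h t x + g t x) - (h t y + g t y)) \<le> norm (h t x - h t y) + norm (g t x - g t y)"
      by (rule norm_diff_triangle_ineq)
    then show "norm ((h t x + g t x) - (h t y + g t y)) \<le> (L + K) * norm (x - y)"
      using L(2)[OF t, of x y] K(2)[OF t, of x y] by (simp add: distrib_right)
  qed
qed

lemma uniformly_lipschitz_minus:
  "uniformly_lipschitz h \<Longrightarrow> uniformly_lipschitz (\<lambda>t x. - h t x)"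
  by (rule uniformly_lipschitz_bounded_linear) (auto intro: bounded_linear_minus bounded_linear_ident)

lemma uniformly_lipschitz_diff:
  "uniformly_lipschitz h \<Longrightarrow> uniformly_lipschitz g \<Longrightarrow> uniformly_lipschitz (\<lambda>t x. h t x - g t x)"
  using uniformly_lipschitz_add[of h "\<lambda>t x. - g t x"] uniformly_lipschitz_minus[of g] by simp

lemma uniformly_lipschitz_Pair:
  assumes h: "uniformly_lipschitz h" and g: "uniformly_lipschitz g"
  shows "uniformly_lipschitz (\<lambda>t x. (h t x, g t x))"
proof -
  have "bounded_linear (\<lambda>v. (v, 0))" "bounded_linear (\<lambda>v. (0, v))"
    by (auto intro: bounded_linear_Pair bounded_linear_ident bounded_linear_zero)
  from uniformly_lipschitz_add[OF uniformly_lipschitz_bounded_linear[OF this(1) h]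
      uniformly_lipschitz_bounded_linear[OF this(2) g]]
  show ?thesis by simp
qed

lemma uniformly_lipschitz_bilinear_coeff:
  assumes p: "bounded_bilinear p" and c: "\<And>t. 0 \<le> t \<Longrightarrow> norm (c t) \<le> M"
    and h: "uniformly_lipschitz h"
  shows "uniformly_lipschitz (\<lambda>t x. p (c t) (h t x))"
proof -
  obtain L where L: "0 \<le> L" "\<And>t x y. 0 \<le> t \<Longrightarrow> norm (h t x - h t y) \<le> L * norm (x - y)"
    by (rule uniformly_lipschitzE[OF h]) (rule that)
  obtain K where K: "0 < K" "\<And>v w. norm (p v w) \<le> norm v * norm w * K"
    using bounded_bilinear.pos_bounded[OF p] by blast
  have M: "0 \<le> M" using c[of 0] norm_ge_zero[of "c 0"] by linarith
  show ?thesis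
  proof (rule uniformly_lipschitzI)
    show "0 \<le> M * L * K" using L K M by simp
    fix t :: real and x y assume t: "0 \<le> t"
    have "norm (p (c t) (h t x) - p (c t) (h t y)) = norm (p (c t) (h t x - h t y))"
      by (simp add: bounded_bilinear.diff_right[OF p])
    also have "\<dots> \<le> norm (c t) * norm (h t x - h t y) * K" by (rule K)
    also have "\<dots> \<le> M * (L * norm (x - y)) * K"
      using L(2)[OF t] c[OF t] K M by (intro mult_right_mono mult_mono) auto
    finally show "norm (p (c t) (h t x) - p (c t) (h t y)) \<le> M * L * K * norm (x - y)"
      by (simp add: mult_ac)
  qed
qed

text \<open>A product of two Lipschitz factors is Lipschitz here because both are bounded. The
  cut-off of attitude and angular velocity exists to provide these bounds.\<close>

lemma uniformly_lipschitz_bilinear: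
  assumes p: "bounded_bilinear p"
    and h: "uniformly_lipschitz h" "\<And>t x. norm (h t x) \<le> M"
    and g: "uniformly_lipschitz g" "\<And>t x. norm (g t x) \<le> N"
  shows "uniformly_lipschitz (\<lambda>t x. p (h t x) (g t x))"
proof -
  obtain L where L: "0 \<le> L" "\<And>t x y. 0 \<le> t \<Longrightarrow> norm (h t x - h t y) \<le> L * norm (x - y)"
    by (rule uniformly_lipschitzE[OF h(1)]) (rule that)
  obtain L' where L': "0 \<le> L'" "\<And>t x y. 0 \<le> t \<Longrightarrow> norm (g t x - g t y) \<le> L' * norm (x - y)"
    by (rule uniformly_lipschitzE[OF g(1)]) (rule that)
  obtain K where K: "0 < K" "\<And>v w. norm (p v w) \<le> norm v * norm w * K"
    using bounded_bilinear.pos_bounded[OF p] by blast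
  have M: "0 \<le> M" using h(2) norm_ge_zero order_trans by blast
  have N: "0 \<le> N" using g(2) norm_ge_zero order_trans by blast
  show ?thesis
  proof (rule uniformly_lipschitzI)
    show "0 \<le> M * L' * K + L * N * K" using L L' K M N by simp
    fix t :: real and x y assume t: "0 \<le> t"
    have "p (h t x) (g t x) - p (h t y) (g t y) = p (h t x) (g t x - g t y) + p (h t x - h t y) (g t y)"
      by (simp add: bounded_bilinear.diff_right[OF p] bounded_bilinear.diff_left[OF p])
    then have "norm (p (h t x) (g t x) - p (h t y) (g t y)) \<le>
        norm (p (h t x) (g t x - g t y)) + norm (p (h t x - h t y) (g t y))"
      by (metis norm_triangle_ineq)
    also have "\<dots> \<le> norm (h t x) * norm (g t x - g t y) * K + norm (h t x - h t y) * norm (g t y) * K"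
      by (intro add_mono K)
    also have "\<dots> \<le> M * (L' * norm (x - y)) * K + (L * norm (x - y)) * N * K"
      using L L' h(2) g(2) K M N t by (intro add_mono mult_right_mono mult_mono) auto
    finally show "norm (p (h t x) (g t x) - p (h t y) (g t y)) \<le> (M * L' * K + L * N * K) * norm (x - y)"
      by (simp add: algebra_simps)
  qed
qed

text \<open>Projection onto a closed ball is nonexpansive and is the identity on the ball, hence a
  suitable cut-off.\<close>

lemma uniformly_lipschitz_closest_point:
  fixes h :: "real \<Rightarrow> 'a::real_normed_vector \<Rightarrow> 'b::euclidean_space"
  assumes r: "0 \<le> r" and h: "uniformly_lipschitz h"
  shows "uniformly_lipschitz (\<lambda>t x. closest_point (cball 0 r) (h t x))"
proof -
  obtain L where L: "0 \<le> L" "\<And>t x y. 0 \<le> t \<Longrightarrow> norm (h t x - h t y) \<le> L * norm (x - y)"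
    by (rule uniformly_lipschitzE[OF h]) (rule that)
  have "norm (closest_point (cball 0 r) u - closest_point (cball 0 r) v) \<le> norm (u - v)" for u v :: 'b
    using closest_point_lipschitz[of "cball 0 r" u v] assms by (simp add: dist_norm)
  then show ?thesis using L order_trans by (intro uniformly_lipschitzI[of L]) blast+
qed

lemmas uniformly_lipschitz_intros =
  uniformly_lipschitz_const uniformly_lipschitz_id uniformly_lipschitz_add uniformly_lipschitz_minus
  uniformly_lipschitz_diff uniformly_lipschitz_Pair uniformly_lipschitz_closest_point

lemma norm_closest_point_cball_le:
  fixes x :: "'a::euclidean_space"
  assumes "0 \<le> r"
  shows "norm (closest_point (cball 0 r) x) \<le> r"
  using closest_point_in_set[of "cball (0::'a) r" x] assms by simp

text \<open>Since \<open>hat\<close> takes skew-symmetric values,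
  \<open>R t ** transpose (R t)\<close> has derivative 0. The determinant is then 1 or -1 at all
  times, and by continuity it cannot jump between them.\<close>

lemma SO3_invariant:
  fixes R :: "real \<Rightarrow> real^3^3"
  assumes R0: "R 0 \<in> SO3" and "0 \<le> T"
    and R': "\<And>t. t \<in> {0..T} \<Longrightarrow> (R has_vector_derivative R t ** hat (w t)) (at t within {0..T})"
  shows "R T \<in> SO3"
proof -
  have orth: "R t ** transpose (R t) = mat 1" if t: "t \<in> {0..T}" for t
  proof -
    have "norm (R t ** transpose (R t) - R 0 ** transpose (R 0)) \<le> 0 * (t - 0)"
    proof (rule vector_derivative_bound)
      fix u assume u: "u \<in> {0..t}"
      have dR: "(R has_vector_derivative R u ** hat (w u)) (at u within {0..t})"
        using u t by (intro has_vector_derivative_within_subset[OF R']) auto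
      show "((\<lambda>t. R t ** transpose (R t)) has_vector_derivative
          (R u ** transpose (R u ** hat (w u)) + (R u ** hat (w u)) ** transpose (R u))) (at u within {0..t})"
        by (intro bounded_bilinear.has_vector_derivative[OF bounded_bilinear_matrix_mult]
           bounded_linear.has_vector_derivative[OF bounded_linear_transpose3] dR)
      have "R u ** transpose (R u ** hat (w u)) = - ((R u ** hat (w u)) ** transpose (R u))"
        by (simp add: matrix_transpose_mul transpose_hat matrix_mul_assoc
            bounded_bilinear.minus_left[OF bounded_bilinear_matrix_mult]
            bounded_bilinear.minus_right[OF bounded_bilinear_matrix_mult])
      then show "norm (R u ** transpose (R u ** hat (w u)) + (R u ** hat (w u)) ** transpose (R u)) \<le> 0"
        by simp
    qed (use t in auto)
    then show ?thesis using SO3_orthogonal(2)[OF R0] by simp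
  qed
  have om: "orthogonal_matrix (R t)" if "t \<in> {0..T}" for t
    using orth[OF that] by (simp add: orthogonal_matrix_def matrix_left_right_inverse)
  have contR: "continuous_on {0..T} R"
    using R' has_vector_derivative_continuous continuous_on_eq_continuous_within by blast
  have contd: "continuous_on {0..T} (\<lambda>t. det (R t))"
    unfolding det_3 by (intro continuous_intros contR)
  have "det (R T) = 1"
  proof (rule ccontr)
    assume "det (R T) \<noteq> 1"
    then have "det (R T) = -1" using det_orthogonal_matrix[OF om[of T]] \<open>0 \<le> T\<close> by auto
    moreover have "det (R 0) = 1" using R0 by (simp add: SO3_iff)
    ultimately obtain t where "0 \<le> t" "t \<le> T" "det (R t) = 0"
      using IVT2'[of "\<lambda>t. det (R t)" T 0 0] contd \<open>0 \<le> T\<close> by auto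
    then show False using det_orthogonal_matrix[OF om[of t]] by auto
  qed
  then show ?thesis using om[of T] \<open>0 \<le> T\<close> by (simp add: SO3_iff)
qed

lemma bounded_bilinear_skew_vec_transpose: "bounded_bilinear (\<lambda>(A::real^3^3) B. skew_vec (transpose A ** B))"
  by (subst bilinear_conv_bounded_bilinear[symmetric])
    (auto simp: bilinear_def linear_iff mat3_simps field_simps)

context tracking_loop
begin

lemma norm_Rr: "0 \<le> t \<Longrightarrow> norm (Rr t) \<le> sqrt 3"
  using norm_SO3[OF Rr_SO3] by simp

lemma Rr_cont: "continuous_on {0..} Rr"
  using Rr_deriv has_vector_derivative_continuous continuous_on_eq_continuous_within atLeast_iff by metis

lemma \<Omega>r_cont: "continuous_on {0..} \<Omega>r"
  using \<Omega>r_deriv has_vector_derivative_continuous continuous_on_eq_continuous_within atLeast_iff by metis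

text \<open>Only the product $R\hat\Omega$ is nonlinear in the state; cutting off its factors makes the
  right-hand side globally Lipschitz, and the energy bound shows that the cut-off never acts.\<close>
lemma truncated_solution:
  assumes r: "0 \<le> r"
  obtains R :: "real \<Rightarrow> real^3^3" and \<Omega> D :: "real \<Rightarrow> real^3" where "R 0 = R0" "\<Omega> 0 = \<Omega>0" "D 0 = 0"
    "\<And>t. 0 \<le> t \<Longrightarrow> (R has_vector_derivative
       closest_point (cball 0 2) (R t) ** hat (closest_point (cball 0 r) (\<Omega> t))) (at t within {0..})"
    "\<And>t. 0 \<le> t \<Longrightarrow> (\<Omega> has_vector_derivative acceleration \<Delta> t (R t) (\<Omega> t) (D t)) (at t within {0..})"
    "\<And>t. 0 \<le> t \<Longrightarrow> (D has_vector_derivative adaptation t (R t) (\<Omega> t)) (at t within {0..})"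
proof -
  \<comment> \<open>The radius 2 exceeds \<open>sqrt 3\<close>, the norm of every rotation matrix,
    so this cut-off is inactive on \<open>SO3\<close>.\<close>
  define f1 where "f1 t x = closest_point (cball 0 2) (fst x) ** hat (closest_point (cball 0 r) (fst (snd x)))"
    for t :: real and x :: "(real^3^3) \<times> (real^3) \<times> (real^3)"
  define f2 where "f2 t x = acceleration \<Delta> t (fst x) (fst (snd x)) (snd (snd x))" for t x
  define f3 where "f3 t x = adaptation t (fst x) (fst (snd x))"
    for t and x :: "(real^3^3) \<times> (real^3) \<times> (real^3)"
  define f where "f t x = (f1 t x, f2 t x, f3 t x)" for t x
  obtain M where M: "\<And>t. 0 \<le> t \<Longrightarrow> norm (\<Omega>r t) \<le> M"
    using \<Omega>r_bounded unfolding bounded_iff by auto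
  obtain M' where M': "\<And>t. 0 \<le> t \<Longrightarrow> norm (d\<Omega>r t) \<le> M'"
    using d\<Omega>r_bounded unfolding bounded_iff by auto
  note Jl = bounded_linear_matrix_vector_mult
  note p = bounded_linear_fst bounded_linear_compose[OF bounded_linear_fst bounded_linear_snd]
    bounded_linear_compose[OF bounded_linear_snd bounded_linear_snd]
  note up = p[THEN uniformly_lipschitz_bounded_linear, OF uniformly_lipschitz_id]
  note us = uniformly_lipschitz_bilinear_coeff[OF bounded_bilinear_skew_vec_transpose norm_Rr up(1)]
  note usc = bounded_linear_scaleR_right[THEN uniformly_lipschitz_bounded_linear]
  note uJ = Jl[THEN uniformly_lipschitz_bounded_linear]
  have "uniformly_lipschitz f1"
    unfolding f1_def
    by (intro uniformly_lipschitz_bilinear[where M = 2 and N = r, OF bounded_bilinear.comp[OF bounded_bilinear_matrix_mult bounded_linear_ident bounded_linear_hat]]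
      uniformly_lipschitz_intros up norm_closest_point_cball_le r) auto
  moreover have "uniformly_lipschitz f2"
    unfolding f2_def acceleration_def
    by (intro uniformly_lipschitz_intros up us usc uJ
        uniformly_lipschitz_bilinear_coeff[OF bounded_bilinear.flip[OF bounded_bilinear_cross3] M]) auto
  moreover have "uniformly_lipschitz f3"
    unfolding f3_def adaptation_def
    by (intro uniformly_lipschitz_intros up us usc uJ) auto
  ultimately have "uniformly_lipschitz f"
    unfolding f_def by (intro uniformly_lipschitz_intros)
  then obtain L where lip: "\<And>t x y. 0 \<le> t \<Longrightarrow> norm (f t x - f t y) \<le> L * norm (x - y)"
    unfolding uniformly_lipschitz_def by blast
  obtain Kj where Kj: "0 < Kj" "\<And>w. norm (matrix_inv J *v w) \<le> norm w * Kj"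
    using bounded_linear.pos_bounded[OF Jl[of "matrix_inv J"]] by blast
  have bnd: "norm (f t 0) \<le> (k\<Omega> * M + M' + norm \<Delta> * Kj) + k\<Delta> * (M * Kj)" if t: "0 \<le> t" for t
  proof -
    have [simp]: "skew_vec 0 = 0" "skew_vec (A ** 0) = 0" for A
      by (simp_all add: mat3_simps)
    have "f1 t 0 = 0"
      using r by (simp add: f1_def closest_point_self mat3_simps)
    moreover have "norm (f2 t 0) \<le> k\<Omega> * M + M' + norm \<Delta> * Kj"
    proof -
      have "norm (f2 t 0) \<le> norm (k\<Omega> *\<^sub>R \<Omega>r t) + norm (d\<Omega>r t) + norm (matrix_inv J *v \<Delta>)"
        unfolding f2_def acceleration_def
        by (simp del: norm_scaleR) (meson norm_triangle_ineq add_right_mono order_trans)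
      also have "\<dots> \<le> k\<Omega> * M + M' + norm \<Delta> * Kj"
        using M[OF t] M'[OF t] Kj pos by (intro add_mono) auto
      finally show ?thesis .
    qed
    moreover have "norm (f3 t 0) \<le> k\<Delta> * (M * Kj)"
    proof -
      have "norm (f3 t 0) = k\<Delta> * norm (matrix_inv J *v (- \<Omega>r t))"
        using pos by (simp add: f3_def adaptation_def)
      also have "\<dots> \<le> k\<Delta> * (norm (- \<Omega>r t) * Kj)" using pos by (intro mult_left_mono Kj) auto
      also have "\<dots> \<le> k\<Delta> * (M * Kj)"
        using pos M[OF t] Kj by (intro mult_left_mono mult_right_mono) auto
      finally show ?thesis .
    qed
    ultimately have "norm (f1 t 0) + (norm (f2 t 0) + norm (f3 t 0)) \<le> (k\<Omega> * M + M' + norm \<Delta> * Kj) + k\<Delta> * (M * Kj)"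
      by simp
    moreover have "norm (f t 0) \<le> norm (f1 t 0) + (norm (f2 t 0) + norm (f3 t 0))"
      unfolding f_def by (meson norm_Pair_le add_left_mono order_trans)
    ultimately show ?thesis by linarith
  qed
  have cont: "continuous_on {0..} (\<lambda>s. f s (z s))" if z: "continuous_on {0..} z" for z
  proof -
    have zc: "continuous_on {0..} (\<lambda>s. fst (z s))" "continuous_on {0..} (\<lambda>s. fst (snd (z s)))"
      "continuous_on {0..} (\<lambda>s. snd (snd (z s)))"
      using z by (auto intro!: continuous_intros)
    have cp: "continuous_on {0..} (\<lambda>s. closest_point (cball 0 c) (g s))"
      if "continuous_on {0..} g" "0 \<le> c" for g :: "real \<Rightarrow> 'c::euclidean_space" and c
      using that
      by (intro continuous_on_compose2[OF continuous_on_closest_point[of "cball 0 c" UNIV]]) auto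
    note sk = bounded_bilinear.continuous_on[OF bounded_bilinear_skew_vec_transpose Rr_cont zc(1)]
    show ?thesis
      unfolding f_def f1_def f2_def f3_def acceleration_def adaptation_def
      by (intro continuous_intros zc cp sk \<Omega>r_cont d\<Omega>r_cont r
          bounded_bilinear.continuous_on[OF bounded_bilinear_matrix_mult]
          bounded_linear.continuous_on[OF bounded_linear_hat] bounded_linear.continuous_on[OF Jl]
          bounded_bilinear.continuous_on[OF bounded_bilinear_cross3]) auto
  qed
  obtain x where x: "x 0 = (R0, \<Omega>0, 0)"
    "\<And>t. 0 \<le> t \<Longrightarrow> (x has_vector_derivative f t (x t)) (at t within {0..})"
    using global_lipschitz_ode[of f, OF cont lip bnd] by blast
  show thesis
  proof (rule that[of "\<lambda>t. fst (x t)" "\<lambda>t. fst (snd (x t))" "\<lambda>t. snd (snd (x t))"])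
    fix t :: real assume t: "0 \<le> t"
    note dx = p[THEN bounded_linear.has_vector_derivative, OF x(2)[OF t]]
    show "((\<lambda>t. fst (x t)) has_vector_derivative
       closest_point (cball 0 2) (fst (x t)) ** hat (closest_point (cball 0 r) (fst (snd (x t))))) (at t within {0..})"
      using dx(1) by (simp add: f_def f1_def)
    show "((\<lambda>t. fst (snd (x t))) has_vector_derivative
        acceleration \<Delta> t (fst (x t)) (fst (snd (x t))) (snd (snd (x t)))) (at t within {0..})"
      using dx(2) by (simp add: f_def f2_def)
    show "((\<lambda>t. snd (snd (x t))) has_vector_derivative adaptation t (fst (x t)) (fst (snd (x t)))) (at t within {0..})"
      using dx(3) by (simp add: f_def f3_def)
  qed (simp_all add: x)
qed

text \<open>A continuation argument: as long as the cut-off has been inactive, the truncated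
  solution solves the true loop, and then the energy bound puts it strictly inside the cut-off
  region. So there is no first time at which the boundary is reached.\<close>

lemma solution_exists:
  assumes R0: "R0 \<in> SO3" and \<Delta>: "norm \<Delta> \<le> \<delta>"
    and energy0: "kR * attitude_gap (transpose (Rr 0) ** R0) + (norm (\<Omega>0 - \<Omega>r 0))\<^sup>2 / 2 \<le> B"
  obtains R \<Omega> D where "R 0 = R0" "\<Omega> 0 = \<Omega>0" "D 0 = 0" "solution_on {0..} \<Delta> R \<Omega> D"
proof -
  obtain M where M: "\<And>t. 0 \<le> t \<Longrightarrow> norm (\<Omega>r t) \<le> M"
    using \<Omega>r_bounded unfolding bounded_iff by auto
  have M0: "0 \<le> M" using M[of 0] norm_ge_zero[of "\<Omega>r 0"] by linarith
  \<comment> \<open>Room for the a priori bound \<open>2 * sqrt kR + M\<close> on the angular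
    velocity and for its initial value; the final 1 makes the inequalities strict.\<close>
  define r where "r = 2 * sqrt kR + M + norm \<Omega>0 + 1"
  have r: "0 \<le> r" using M0 pos by (simp add: r_def)
  obtain R \<Omega> D where init: "R 0 = R0" "\<Omega> 0 = \<Omega>0" "D 0 = 0" and der:
    "\<And>t. 0 \<le> t \<Longrightarrow> (R has_vector_derivative
       closest_point (cball 0 2) (R t) ** hat (closest_point (cball 0 r) (\<Omega> t))) (at t within {0..})"
    "\<And>t. 0 \<le> t \<Longrightarrow> (\<Omega> has_vector_derivative acceleration \<Delta> t (R t) (\<Omega> t) (D t)) (at t within {0..})"
    "\<And>t. 0 \<le> t \<Longrightarrow> (D has_vector_derivative adaptation t (R t) (\<Omega> t)) (at t within {0..})"
    using truncated_solution[OF r, of R0 \<Omega>0 \<Delta>] by metis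
  \<comment> \<open>A nonpositive value of \<open>\<phi>\<close> means that both projections act as
    the identity.\<close>
  define \<phi> where "\<phi> t = max (norm (R t) - 2) (norm (\<Omega> t) - r)" for t
  have cont: "continuous_on {0..} R" "continuous_on {0..} \<Omega>"
    using der has_vector_derivative_continuous continuous_on_eq_continuous_within atLeast_iff by metis+
  have c\<phi>: "continuous_on {0..} \<phi>"
    unfolding \<phi>_def by (intro continuous_intros cont)
  have solves: "solution_on I \<Delta> R \<Omega> D"
    if I: "I = {0..} \<or> (\<exists>T\<ge>0. I = {0..T})" and le: "\<And>t. t \<in> I \<Longrightarrow> \<phi> t \<le> 0" for I
  proof -
    have sub: "I \<subseteq> {0..}" "\<And>t. t \<in> I \<Longrightarrow> {0..t} \<subseteq> I" using I by auto
    have dR: "(R has_vector_derivative R t ** hat (\<Omega> t)) (at t within {0..})" if t: "t \<in> I" for t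
    proof -
      have "closest_point (cball 0 2) (R t) = R t" "closest_point (cball 0 r) (\<Omega> t) = \<Omega> t"
        using le[OF t] by (auto simp: \<phi>_def intro!: closest_point_self)
      then show ?thesis using der(1)[of t] t sub by auto
    qed
    have "R t \<in> SO3" if t: "t \<in> I" for t
    proof (rule SO3_invariant)
      show "R 0 \<in> SO3" using init R0 by simp
      show "(R has_vector_derivative R u ** hat (\<Omega> u)) (at u within {0..t})" if "u \<in> {0..t}" for u
        using that sub(2)[OF t] by (intro has_vector_derivative_within_subset[OF dR]) auto
    qed (use t sub in auto)
    then show ?thesis unfolding solution_on_def
      using sub(1)
      by (intro ballI conjI has_vector_derivative_within_subset[OF dR sub(1)]
          has_vector_derivative_within_subset[OF der(2) sub(1)]
          has_vector_derivative_within_subset[OF der(3) sub(1)]) auto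
  qed
  have strict: "\<phi> T < 0" if T0: "0 \<le> T" and le: "\<And>t. t \<in> {0..T} \<Longrightarrow> \<phi> t \<le> 0" for T
  proof -
    have sol: "solution_on {0..T} \<Delta> R \<Omega> D"
    proof (rule solves)
      show "{0..T} = {0..} \<or> (\<exists>T'\<ge>0. {0..T} = {0..T'})" using T0 by blast
    qed (rule le)
    interpret tracking_solution J kR k\<Omega> k\<Delta> a \<mu> \<delta> Rr \<Omega>r d\<Omega>r "{0..T}" \<Delta> R \<Omega> D
    proof
      show "{0..T} = {0..} \<or> (\<exists>T'\<ge>0. {0..T} = {0..T'})" using T0 by blast
    qed (use sol init \<Delta> energy0 in auto)
    have T: "T \<in> {0..T}" using T0 by simp
    have "norm (\<Omega> T) \<le> norm (e T) + norm (\<Omega>r T)"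
      unfolding e_def by (metis diff_add_cancel norm_triangle_ineq)
    also have "\<dots> < r" using norm_e_le[OF T] M[OF T0] norm_ge_zero[of \<Omega>0] unfolding r_def by linarith
    finally have "norm (\<Omega> T) < r" .
    moreover have "norm (R T) = sqrt 3"
      using sol T by (intro norm_SO3) (auto simp: solution_on_def)
    moreover have "sqrt 3 < 2" by (rule real_less_lsqrt) auto
    ultimately show ?thesis by (simp add: \<phi>_def)
  qed
  have neg: "\<phi> t < 0" if "0 \<le> t" for t
  proof (rule ccontr)
    assume "\<not> \<phi> t < 0"
    \<comment> \<open>\<open>S\<close> is the set of times at which the boundary has been reached or
      passed; its infimum belongs to it by continuity and is the first such time.\<close>
    define S where "S = {0..} \<inter> \<phi> -` {0..}"
    have S: "closed S" "S \<noteq> {}" "bdd_below S"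
      unfolding S_def using \<open>\<not> \<phi> t < 0\<close> that
      by (auto intro!: continuous_closed_preimage c\<phi> bdd_belowI[of _ 0])
    define T where "T = Inf S"
    have TS: "T \<in> S" unfolding T_def using S by (intro closed_contains_Inf)
    then have T: "0 \<le> T" "0 \<le> \<phi> T" by (auto simp: S_def)
    have below: "\<phi> u < 0" if "0 \<le> u" "u < T" for u
    proof (rule ccontr)
      assume "\<not> \<phi> u < 0"
      then have "u \<in> S" using that by (simp add: S_def)
      then have "T \<le> u" unfolding T_def using S by (intro cInf_lower)
      then show False using that by simp
    qed
    have "\<phi> 0 < 0"
    proof -
      have "norm (R 0) = sqrt 3" using init R0 norm_SO3 by simp
      moreover have "sqrt 3 < 2" by (rule real_less_lsqrt) auto
      moreover have "norm (\<Omega> 0) < r"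
        unfolding r_def init(2) using M0 real_sqrt_gt_zero[OF pos(1)] by linarith
      ultimately show ?thesis by (simp add: \<phi>_def)
    qed
    then have "\<exists>u. 0 \<le> u \<and> u \<le> T \<and> \<phi> u = 0"
      using T by (intro IVT') (auto intro: continuous_on_subset[OF c\<phi>])
    then have "\<phi> T = 0" using below by (metis order_le_less less_irrefl)
    then have "\<phi> T < 0"
      using T below by (intro strict) (auto simp: order_le_less)
    then show False using T by simp
  qed
  have "solution_on {0..} \<Delta> R \<Omega> D" using neg by (intro solves) (auto simp: less_imp_le)
  then show thesis using init that by blast
qed

end

subsection \<open>The shifted reference\<close>

text \<open>At time 0 the filter is one-sided. It always contains the nontrivial filter
  \<open>at_right t\<close>, hence the derivative is unique.\<close>

lemma tderiv_eq:
  assumes "0 \<le> t" "(f has_vector_derivative v) (at t within {0..})"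
  shows "tderiv f t = v"
proof -
  have "at_right t \<le> at t within {0..}"
    using assms(1) by (intro at_le) auto
  then have "at t within {0..} \<noteq> bot"
    using trivial_limit_at_right_real[of t] by (metis bot.extremum_uniqueI)
  then show ?thesis
    unfolding tderiv_def using assms(2) by (rule vector_derivative_within)
qed

lemma smooth_signal_imp:
  assumes "smooth_signal f"
  shows "0 \<le> t \<Longrightarrow> (f has_vector_derivative tderiv f t) (at t within {0..})"
    and "continuous_on {0..} (tderiv f)"
proof -
  have "(tderiv ^^ n) f differentiable_on {0..}" for n using assms by (simp add: smooth_signal_def)
  from this[of 0] this[of 1] have d: "f differentiable_on {0..}" "tderiv f differentiable_on {0..}" by auto
  show "(f has_vector_derivative tderiv f t) (at t within {0..})" if "0 \<le> t"
    using d(1) that unfolding tderiv_def by (simp add: differentiable_on_def flip: vector_derivative_works)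
  show "continuous_on {0..} (tderiv f)" using d(2) by (rule differentiable_imp_continuous_on)
qed

lemma tracking_reference_original:
  assumes "reference_trajectory Rd \<Omega>d"
  shows "tracking_reference Rd \<Omega>d (tderiv \<Omega>d)"
  using assms smooth_signal_imp[of \<Omega>d] unfolding reference_trajectory_def tracking_reference_def by blast

lemma Zrot_deriv: "(Zrot has_vector_derivative Zrot t ** hat e3) (at t within S)"
proof -
  define E1 :: "real^3^3" where "E1 = vector [vector [1,0,0], vector [0,1,0], vector [0,0,0]]"
  define E2 :: "real^3^3" where "E2 = vector [vector [0,-1,0], vector [1,0,0], vector [0,0,0]]"
  define E3 :: "real^3^3" where "E3 = vector [vector [0,0,0], vector [0,0,0], vector [0,0,1]]"
  have Z: "Zrot = (\<lambda>t. cos t *\<^sub>R E1 + sin t *\<^sub>R E2 + E3)"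
    by (rule ext) (simp add: Zrot_eq mat3_simps E1_def E2_def E3_def)
  have d: "(cos has_vector_derivative - sin t) (at t within S)" "(sin has_vector_derivative cos t) (at t within S)"
    by (auto intro!: derivative_eq_intros simp flip: has_real_derivative_iff_has_vector_derivative)
  have "((\<lambda>t. cos t *\<^sub>R E1 + sin t *\<^sub>R E2 + E3) has_vector_derivative - sin t *\<^sub>R E1 + cos t *\<^sub>R E2 + 0)
      (at t within S)"
    by (intro has_vector_derivative_add has_vector_derivative_const
        bounded_linear.has_vector_derivative[OF bounded_linear_scaleR_left] d)
  moreover have "Zrot t ** hat e3 = - sin t *\<^sub>R E1 + cos t *\<^sub>R E2 + 0"
    by (simp add: Zrot_eq mat3_simps E1_def E2_def e3_def)
  ultimately show ?thesis by (simp only: Z)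
qed

text \<open>Rotations preserve cross products. This moves the angular velocity of the shift, given
  in the frame of its axis, past the attitude factors.\<close>

lemma hat_conj_SO3:
  assumes "A \<in> SO3"
  shows "A ** hat (transpose A *v v) = hat v ** A"
proof -
  have "A *v cross3 (transpose A *v v) x = cross3 v (A *v x)" for x
  proof -
    have "A *v cross3 (transpose A *v v) x = cross3 (A *v (transpose A *v v)) (A *v x)"
      using assms by (simp add: SO3_def cross_rotation_matrix)
    also have "A *v (transpose A *v v) = v"
      unfolding matrix_vector_mul_assoc SO3_orthogonal(2)[OF assms] by simp
    finally show ?thesis .
  qed
  then show ?thesis
    by (simp add: matrix_eq hat_mult flip: matrix_vector_mul_assoc)
qed

lemma shift_angle_deriv:
  "(shift_angle b \<gamma> has_vector_derivative - (\<gamma> / 2) * shift_angle b \<gamma> t) (at t within S)"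
  unfolding shift_angle_def[abs_def]
  by (auto intro!: derivative_eq_intros simp flip: has_real_derivative_iff_has_vector_derivative)

lemma shift_angle_tendsto_0:
  assumes "0 < \<gamma>"
  shows "(shift_angle b \<gamma> \<longlongrightarrow> 0) at_top"
proof -
  have "filterlim (\<lambda>t. - (\<gamma> / 2) * t) at_bot at_top"
    using assms by (intro filterlim_tendsto_neg_mult_at_bot[OF tendsto_const] filterlim_ident) auto
  then have "((\<lambda>t. exp (- (\<gamma> / 2) * t)) \<longlongrightarrow> 0) at_top"
    by (rule filterlim_compose[OF exp_at_bot])
  then have "((\<lambda>t. b * exp (- (\<gamma> / 2) * t)) \<longlongrightarrow> b * 0) at_top"
    by (intro tendsto_intros)
  then show ?thesis by (simp add: shift_angle_def[abs_def])
qed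

text \<open>The shift rotates about \<open>U *v e3\<close> and so fixes this vector. The shifted
  attitude may be replaced by \<open>Rd t\<close> in the feedforward term, whose derivative is then
  easy to compute.\<close>

lemma shifted_\<Omega>d_eq:
  assumes t: "0 \<le> t" and U: "U \<in> SO3"
  shows "shifted_\<Omega>d U b \<gamma> Rd \<Omega>d t
     = \<Omega>d t + (- (\<gamma> / 2) * shift_angle b \<gamma> t) *\<^sub>R (transpose (Rd t) *v (U *v e3))"
proof -
  define Z where "Z = Zrot (shift_angle b \<gamma> t)"
  have "transpose Z *v e3 = e3"
    by (simp add: Z_def Zrot_eq mat3_simps e3_def del: transpose_matrix_vector)
  moreover have "transpose (shifted_Rd U b \<gamma> Rd t) = transpose (Rd t) ** U ** transpose Z ** transpose U"
    by (simp add: shifted_Rd_def Z_def matrix_transpose_mul matrix_mul_assoc)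
  moreover have "transpose U *v (U *v e3) = e3"
    unfolding matrix_vector_mul_assoc SO3_orthogonal(1)[OF U] by simp
  ultimately have "transpose (shifted_Rd U b \<gamma> Rd t) *v (U *v e3) = transpose (Rd t) *v (U *v e3)"
    by (simp only: matrix_vector_mul_assoc[symmetric])
  moreover have "tderiv (shift_angle b \<gamma>) t = - (\<gamma> / 2) * shift_angle b \<gamma> t"
    using t shift_angle_deriv by (rule tderiv_eq)
  ultimately show ?thesis by (simp only: shifted_\<Omega>d_def)
qed

lemma norm_e3: "norm e3 = 1"
  by (simp add: norm_eq_sqrt_inner inner_vec_def sum_3 e3_def)

lemma shift_angle_le:
  assumes "0 < b" "0 < \<gamma>" "0 \<le> t"
  shows "0 < shift_angle b \<gamma> t" "shift_angle b \<gamma> t \<le> b"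
  using assms by (auto simp: shift_angle_def mult_le_cancel_left1)

text \<open>The added rotation has the bounded rate \<open>w\<close>, a multiple of a decaying
  exponential, along a unit vector carried by the bounded motion of \<open>Rd\<close>. So the
  regularity and the bounds pass from the original reference to the shifted one.\<close>

lemma tracking_reference_shifted:
  assumes ref: "reference_trajectory Rd \<Omega>d" and U: "U \<in> SO3" and b: "0 < b" "0 < \<gamma>"
  shows "tracking_reference (shifted_Rd U b \<gamma> Rd) (shifted_\<Omega>d U b \<gamma> Rd \<Omega>d) (tderiv (shifted_\<Omega>d U b \<gamma> Rd \<Omega>d))"
proof -
  interpret tracking_reference Rd \<Omega>d "tderiv \<Omega>d"
    using ref by (rule tracking_reference_original)
  define c where "c = U *v e3"
  define \<theta> where "\<theta> = shift_angle b \<gamma>"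
  define w where "w t = - (\<gamma> / 2) * \<theta> t" for t
  \<comment> \<open>The product rule for \<open>w t\<close> times the axis seen from the reference
    frame: the axis turns with velocity \<open>- cross3 (\<Omega>d t)\<close>, and \<open>w\<close>
    satisfies the same decay equation as \<open>\<theta>\<close>.\<close>
  define d\<Omega> where "d\<Omega> t = tderiv \<Omega>d t + (w t *\<^sub>R (- cross3 (\<Omega>d t) (transpose (Rd t) *v c))
      + (- (\<gamma> / 2) * w t) *\<^sub>R (transpose (Rd t) *v c))" for t
  have \<theta>': "(\<theta> has_vector_derivative w t) (at t within S)" for t S
    unfolding \<theta>_def w_def by (rule shift_angle_deriv)
  have w': "(w has_vector_derivative - (\<gamma> / 2) * w t) (at t within S)" for t S
    using has_vector_derivative_mult_right[OF \<theta>', of "- (\<gamma> / 2)"] by (simp only: w_def[symmetric])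
  have \<Omega>eq: "shifted_\<Omega>d U b \<gamma> Rd \<Omega>d t = \<Omega>d t + w t *\<^sub>R (transpose (Rd t) *v c)" if "0 \<le> t" for t
    using shifted_\<Omega>d_eq[OF that U] by (simp add: w_def \<theta>_def c_def)
  have Rc': "((\<lambda>t. transpose (Rd t) *v c) has_vector_derivative - cross3 (\<Omega>d t) (transpose (Rd t) *v c)) (at t within {0..})"
    if t: "0 \<le> t" for t
  proof -
    have "bounded_linear (\<lambda>A. transpose A *v c)"
      by (subst linear_conv_bounded_linear[symmetric]) (auto simp: linear_iff mat3_simps algebra_simps simp del: transpose_matrix_vector)
    from bounded_linear.has_vector_derivative[OF this Rr_deriv[OF t]]
    have "((\<lambda>t. transpose (Rd t) *v c) has_vector_derivative transpose (Rd t ** hat (\<Omega>d t)) *v c) (at t within {0..})" .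
    moreover have "transpose (Rd t ** hat (\<Omega>d t)) *v c = - (hat (\<Omega>d t) *v (transpose (Rd t) *v c))"
      unfolding matrix_transpose_mul transpose_hat
      by (simp add: mat3_simps algebra_simps del: transpose_matrix_vector)
    ultimately show ?thesis by (simp add: hat_mult)
  qed
  have \<Omega>': "(shifted_\<Omega>d U b \<gamma> Rd \<Omega>d has_vector_derivative d\<Omega> t) (at t within {0..})" if t: "0 \<le> t" for t
  proof (rule has_vector_derivative_transform)
    show "((\<lambda>t. \<Omega>d t + w t *\<^sub>R (transpose (Rd t) *v c)) has_vector_derivative d\<Omega> t) (at t within {0..})"
      unfolding d\<Omega>_def
      by (intro has_vector_derivative_add \<Omega>r_deriv t
          bounded_bilinear.has_vector_derivative[OF bounded_bilinear_scaleR] w' Rc')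
  qed (use t \<Omega>eq in auto)
  have td: "tderiv (shifted_\<Omega>d U b \<gamma> Rd \<Omega>d) t = d\<Omega> t" if "0 \<le> t" for t
    using that \<Omega>'[OF that] by (rule tderiv_eq)
  have nRc: "norm (transpose (Rd t) *v c) = 1" if "0 \<le> t" for t
    unfolding c_def norm_SO3_mult_vec[OF SO3_transpose[OF Rr_SO3[OF that]]] norm_SO3_mult_vec[OF U] norm_e3 ..
  have nw: "\<bar>w t\<bar> \<le> \<gamma> / 2 * b" if "0 \<le> t" for t
    using shift_angle_le[OF b that] b by (simp add: w_def \<theta>_def abs_mult)
  obtain M where M: "\<And>t. 0 \<le> t \<Longrightarrow> norm (\<Omega>d t) \<le> M"
    using \<Omega>r_bounded unfolding bounded_iff by auto
  obtain M' where M': "\<And>t. 0 \<le> t \<Longrightarrow> norm (tderiv \<Omega>d t) \<le> M'"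
    using d\<Omega>r_bounded unfolding bounded_iff by auto
  obtain K where K: "0 < K" "\<And>v w. norm (cross3 v w) \<le> norm v * norm w * K"
    using bounded_bilinear.pos_bounded[OF bounded_bilinear_cross3] by blast
  show ?thesis
  proof
    fix t :: real assume t: "0 \<le> t"
    show "shifted_Rd U b \<gamma> Rd t \<in> SO3"
      unfolding shifted_Rd_def by (intro SO3_mult SO3_transpose Zrot_SO3 U Rr_SO3 t)
    show "(shifted_\<Omega>d U b \<gamma> Rd \<Omega>d has_vector_derivative tderiv (shifted_\<Omega>d U b \<gamma> Rd \<Omega>d) t) (at t within {0..})"
      using \<Omega>'[OF t] td[OF t] by simp
    show "(shifted_Rd U b \<gamma> Rd has_vector_derivative
        shifted_Rd U b \<gamma> Rd t ** hat (shifted_\<Omega>d U b \<gamma> Rd \<Omega>d t)) (at t within {0..})"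
    proof -
      have "(Zrot \<circ> \<theta> has_vector_derivative w t *\<^sub>R (Zrot (\<theta> t) ** hat e3)) (at t within {0..})"
        by (intro vector_diff_chain_within \<theta>' Zrot_deriv)
      then have Z': "((\<lambda>t. Zrot (\<theta> t)) has_vector_derivative w t *\<^sub>R (Zrot (\<theta> t) ** hat e3)) (at t within {0..})"
        by (simp add: o_def)
      have bl: "bounded_linear (\<lambda>A. U ** A ** transpose U)"
        by (subst linear_conv_bounded_linear[symmetric]) (auto simp: linear_iff mat3_simps algebra_simps)
      have "(shifted_Rd U b \<gamma> Rd has_vector_derivative
         (U ** Zrot (\<theta> t) ** transpose U) ** (Rd t ** hat (\<Omega>d t))
          + (U ** (w t *\<^sub>R (Zrot (\<theta> t) ** hat e3)) ** transpose U) ** Rd t) (at t within {0..})"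
        unfolding shifted_Rd_def[abs_def] \<theta>_def[symmetric]
        by (intro bounded_bilinear.has_vector_derivative[OF bounded_bilinear_matrix_mult] Rr_deriv t
            bounded_linear.has_vector_derivative[OF bl] Z')
      \<comment> \<open>The rate of the shift appears between \<open>Zrot\<close> and
        \<open>transpose U\<close>; conjugation by \<open>transpose U ** Rd t\<close> moves it to
        the right end, where it adds to \<open>\<Omega>d t\<close>.\<close>
      moreover have "(U ** (w t *\<^sub>R (Zrot (\<theta> t) ** hat e3)) ** transpose U) ** Rd t
          = U ** Zrot (\<theta> t) ** transpose U ** Rd t ** hat (w t *\<^sub>R (transpose (Rd t) *v c))"
      proof -
        define A where "A = transpose U ** Rd t"
        have A: "A \<in> SO3" unfolding A_def by (intro SO3_mult SO3_transpose U Rr_SO3 t)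
        have Ac: "transpose A *v e3 = transpose (Rd t) *v c"
          by (simp only: A_def c_def matrix_transpose_mul transpose_transpose matrix_vector_mul_assoc)
        have "U ** Zrot (\<theta> t) ** transpose U ** Rd t ** hat (w t *\<^sub>R (transpose (Rd t) *v c))
            = U ** Zrot (\<theta> t) ** (A ** hat (w t *\<^sub>R (transpose (Rd t) *v c)))"
          by (simp only: A_def matrix_mul_assoc)
        also have "\<dots> = w t *\<^sub>R (U ** Zrot (\<theta> t) ** (A ** hat (transpose A *v e3)))"
          unfolding Ac
          by (simp only: linear_scale[OF bounded_linear.linear[OF bounded_linear_hat]]
              bounded_bilinear.scaleR_right[OF bounded_bilinear_matrix_mult])
        also have "A ** hat (transpose A *v e3) = hat e3 ** A" by (rule hat_conj_SO3[OF A])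
        also have "w t *\<^sub>R (U ** Zrot (\<theta> t) ** (hat e3 ** A))
            = (U ** (w t *\<^sub>R (Zrot (\<theta> t) ** hat e3)) ** transpose U) ** Rd t"
          by (simp only: bounded_bilinear.scaleR_right[OF bounded_bilinear_matrix_mult]
            bounded_bilinear.scaleR_left[OF bounded_bilinear_matrix_mult] A_def matrix_mul_assoc)
        finally show ?thesis by simp
      qed
      moreover have "(U ** Zrot (\<theta> t) ** transpose U) ** (Rd t ** hat (\<Omega>d t))
          + U ** Zrot (\<theta> t) ** transpose U ** Rd t ** hat (w t *\<^sub>R (transpose (Rd t) *v c))
          = shifted_Rd U b \<gamma> Rd t ** hat (shifted_\<Omega>d U b \<gamma> Rd \<Omega>d t)"
        unfolding \<Omega>eq[OF t] shifted_Rd_def \<theta>_def[symmetric]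
        by (simp only: linear_add[OF bounded_linear.linear[OF bounded_linear_hat]] matrix_add_ldistrib matrix_mul_assoc)
      ultimately show ?thesis by simp
    qed
  next
    have cont: "continuous_on {0..} \<Omega>d" "continuous_on {0..} w" "continuous_on {0..} (\<lambda>t. transpose (Rd t) *v c)"
      using \<Omega>r_deriv w' Rc' has_vector_derivative_continuous continuous_on_eq_continuous_within atLeast_iff
      by metis+
    have "continuous_on {0..} d\<Omega>"
      unfolding d\<Omega>_def
      by (intro continuous_intros cont d\<Omega>r_cont bounded_bilinear.continuous_on[OF bounded_bilinear_cross3])
    then show "continuous_on {0..} (tderiv (shifted_\<Omega>d U b \<gamma> Rd \<Omega>d))"
      using td by (subst continuous_on_cong[OF refl, of _ _ d\<Omega>]) auto
    have "norm (shifted_\<Omega>d U b \<gamma> Rd \<Omega>d t) \<le> M + \<gamma> / 2 * b" if "0 \<le> t" for t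
    proof -
      have "norm (shifted_\<Omega>d U b \<gamma> Rd \<Omega>d t) \<le> norm (\<Omega>d t) + norm (w t *\<^sub>R (transpose (Rd t) *v c))"
        unfolding \<Omega>eq[OF that] by (rule norm_triangle_ineq)
      then show ?thesis using M[OF that] nw[OF that] nRc[OF that] by simp
    qed
    then show "bounded (shifted_\<Omega>d U b \<gamma> Rd \<Omega>d ` {0..})"
      unfolding bounded_iff by auto
    have "norm (d\<Omega> t) \<le> M' + (\<gamma> / 2 * b * (M * K) + \<gamma> / 2 * (\<gamma> / 2 * b))" if t: "0 \<le> t" for t
    proof -
      have "norm (cross3 (\<Omega>d t) (transpose (Rd t) *v c)) \<le> norm (\<Omega>d t) * 1 * K"
        using K(2)[of "\<Omega>d t" "transpose (Rd t) *v c"] nRc[OF t] by simp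
      also have "\<dots> \<le> M * K" using M[OF t] K by simp
      finally have 1: "norm (cross3 (\<Omega>d t) (transpose (Rd t) *v c)) \<le> M * K" .
      have "norm (d\<Omega> t) \<le> norm (tderiv \<Omega>d t) + (norm (w t *\<^sub>R (- cross3 (\<Omega>d t) (transpose (Rd t) *v c)))
         + norm ((- (\<gamma> / 2) * w t) *\<^sub>R (transpose (Rd t) *v c)))"
        unfolding d\<Omega>_def by (meson norm_triangle_ineq add_left_mono order_trans)
      also have "\<dots> = norm (tderiv \<Omega>d t) + (\<bar>w t\<bar> * norm (cross3 (\<Omega>d t) (transpose (Rd t) *v c))
         + \<gamma> / 2 * \<bar>w t\<bar>)"
        using nRc[OF t] b by (simp add: abs_mult)
      also have "\<dots> \<le> M' + (\<gamma> / 2 * b * (M * K) + \<gamma> / 2 * (\<gamma> / 2 * b))"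
        using M'[OF t] nw[OF t] 1 b by (intro add_mono mult_mono mult_left_mono) auto
      finally show ?thesis .
    qed
    then show "bounded (tderiv (shifted_\<Omega>d U b \<gamma> Rd \<Omega>d) ` {0..})"
      unfolding bounded_iff using td by auto
  qed
qed

subsection \<open>The closed loop and the rate bound\<close>

lemma energy_eq_V0:
  assumes "R \<in> SO3" "Rr t \<in> SO3"
  shows "kR * attitude_gap (transpose (Rr t) ** R) + (norm (\<Omega> - \<Omega>r t))\<^sup>2 / 2 = V0 kR Rr \<Omega>r R \<Omega> t"
  using norm_diff_SO3[OF assms] by (simp add: V0_def)

text \<open>The reference acceleration is instantiated with \<open>tderiv \<Omega>r\<close>, the
  feedforward term that the control law uses.\<close>

locale closed_tracking_loop = tracking_loop J kR k\<Omega> k\<Delta> a \<mu> \<delta> Rr \<Omega>r "tderiv \<Omega>r"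
  for J kR k\<Omega> k\<Delta> a \<mu> \<delta> Rr \<Omega>r
begin

lemma loop_exists:
  assumes "R0 \<in> SO3" "norm \<Delta> \<le> \<delta>" "V0 kR Rr \<Omega>r R0 \<Omega>0 0 \<le> B"
  shows "\<exists>R \<Omega> Db \<tau>. R 0 = R0 \<and> \<Omega> 0 = \<Omega>0 \<and> plant J \<Delta> \<tau> R \<Omega> \<and>
    adaptive_tracking J kR k\<Omega> k\<Delta> \<mu> Rr \<Omega>r R \<Omega> Db \<tau>"
proof -
  obtain R \<Omega> D where init: "R 0 = R0" "\<Omega> 0 = \<Omega>0" "D 0 = 0" and sol: "solution_on {0..} \<Delta> R \<Omega> D"
    by (rule solution_exists[of R0 \<Delta> \<Omega>0]) (use assms Rr_SO3[of 0] in \<open>auto simp: energy_eq_V0\<close>)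
  define \<tau> where "\<tau> t = - cross3 (J *v \<Omega> t) (\<Omega> t)
              + J *v (- kR *\<^sub>R e_R (Rr t) (R t) - k\<Omega> *\<^sub>R (\<Omega> t - \<Omega>r t)
                      + cross3 (\<Omega> t) (\<Omega>r t) + tderiv \<Omega>r t)
              - D t" for t
  have acc: "J *v acceleration \<Delta> t (R t) (\<Omega> t) (D t) = cross3 (J *v \<Omega> t) (\<Omega> t) + \<tau> t + \<Delta>" for t
    by (simp add: acceleration_def \<tau>_def e_R_eq matrix_vector_right_distrib sym_pos_def_inverse(1)[OF J])
  have "plant J \<Delta> \<tau> R \<Omega>"
    unfolding plant_def
  proof (intro allI impI conjI exI)
    fix t :: real assume t: "0 \<le> t"
    show "R t \<in> SO3" "(R has_vector_derivative R t ** hat (\<Omega> t)) (at t within {0..})"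
      "(\<Omega> has_vector_derivative acceleration \<Delta> t (R t) (\<Omega> t) (D t)) (at t within {0..})"
      using sol t by (auto simp: solution_on_def)
    show "J *v acceleration \<Delta> t (R t) (\<Omega> t) (D t) = cross3 (J *v \<Omega> t) (\<Omega> t) + \<tau> t + \<Delta>" by (rule acc)
  qed
  moreover have "adaptive_tracking J kR k\<Omega> k\<Delta> \<mu> Rr \<Omega>r R \<Omega> D \<tau>"
    using sol init unfolding adaptive_tracking_def solution_on_def adaptation_def \<tau>_def e_R_eq by auto
  ultimately show ?thesis using init by blast
qed

lemma loop_converges:
  assumes "norm \<Delta> \<le> \<delta>" "V0 kR Rr \<Omega>r (R 0) (\<Omega> 0) 0 \<le> B"
    and pl: "plant J \<Delta> \<tau> R \<Omega>" and ad: "adaptive_tracking J kR k\<Omega> k\<Delta> \<mu> Rr \<Omega>r R \<Omega> Db \<tau>"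
  shows "((\<lambda>t. norm (R t - Rr t)) \<longlongrightarrow> 0) at_top" "((\<lambda>t. norm (\<Omega> t - \<Omega>r t)) \<longlongrightarrow> 0) at_top"
    "((\<lambda>t. norm (\<Delta> - Db t)) \<longlongrightarrow> 0) at_top"
proof -
  have RSO: "R t \<in> SO3" if "0 \<le> t" for t using pl that by (auto simp: plant_def)
  have "(\<Omega> has_vector_derivative acceleration \<Delta> t (R t) (\<Omega> t) (Db t)) (at t within {0..})" if t: "0 \<le> t" for t
  proof -
    obtain w where w: "(\<Omega> has_vector_derivative w) (at t within {0..})"
      "J *v w = cross3 (J *v \<Omega> t) (\<Omega> t) + \<tau> t + \<Delta>"
      using pl t by (auto simp: plant_def)
    \<comment> \<open>The plant determines the derivative of \<open>\<Omega>\<close> through the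
      inertia matrix, which is injective.\<close>
    have "J *v w = J *v acceleration \<Delta> t (R t) (\<Omega> t) (Db t)"
      using ad t unfolding w(2)
      by (simp add: adaptive_tracking_def acceleration_def e_R_eq matrix_vector_right_distrib sym_pos_def_inverse(1)[OF J])
    then have "w = acceleration \<Delta> t (R t) (\<Omega> t) (Db t)"
      using sym_pos_def_inverse(2)[OF J] by metis
    with w show ?thesis by simp
  qed
  then have sol: "solution_on {0..} \<Delta> R \<Omega> Db"
    using pl ad by (auto simp: solution_on_def plant_def adaptive_tracking_def adaptation_def e_R_eq)
  interpret tracking_solution J kR k\<Omega> k\<Delta> a \<mu> \<delta> Rr \<Omega>r "tderiv \<Omega>r" "{0..}" \<Delta> R \<Omega> Db
    using sol ad assms(1,2) RSO[of 0] Rr_SO3[of 0]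
    by unfold_locales (auto simp: adaptive_tracking_def energy_eq_V0)
  have "((\<lambda>t. 2 * sqrt (q t)) \<longlongrightarrow> 2 * sqrt 0) at_top"
    by (intro tendsto_intros q_tendsto_0 refl)
  then have "((\<lambda>t. 2 * sqrt (q t)) \<longlongrightarrow> 0) at_top" by simp
  moreover have "norm (R t - Rr t) = 2 * sqrt (q t)" if "0 \<le> t" for t
  proof -
    have "norm (R t - Rr t) = sqrt ((norm (R t - Rr t))\<^sup>2)" by simp
    then show ?thesis
      using norm_diff_SO3[OF RSO[OF that] Rr_SO3[OF that]] by (simp add: q_def Q_def real_sqrt_mult)
  qed
  ultimately show "((\<lambda>t. norm (R t - Rr t)) \<longlongrightarrow> 0) at_top"
    by (subst tendsto_cong[of _ "\<lambda>t. 2 * sqrt (q t)"]) (auto simp: eventually_at_top_linorder)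
  show "((\<lambda>t. norm (\<Omega> t - \<Omega>r t)) \<longlongrightarrow> 0) at_top"
    using e_tendsto_0[OF refl] by (simp add: e_def[abs_def] tendsto_norm_zero_iff)
  show "((\<lambda>t. norm (\<Delta> - Db t)) \<longlongrightarrow> 0) at_top"
    using d_tendsto_0[OF refl] by (simp add: d_def[abs_def] tendsto_norm_zero_iff)
qed

end

section \<open>Comparison of the shifted with the original reference\<close>

lemma norm_shifted_Rd_diff:
  assumes "U \<in> SO3" "Rd t \<in> SO3"
  shows "(norm (shifted_Rd U b \<gamma> Rd t - Rd t))\<^sup>2 = 4 * (1 - cos (shift_angle b \<gamma> t))"
  using norm_shifted_diff[OF assms, of "shift_angle b \<gamma> t" 0] assms
  by (simp add: shifted_Rd_def Zrot_0 SO3_orthogonal)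

lemma norm_shifted_\<Omega>d_diff:
  assumes "U \<in> SO3" "Rd t \<in> SO3" "0 \<le> t" "0 < b" "0 < \<gamma>"
  shows "norm (shifted_\<Omega>d U b \<gamma> Rd \<Omega>d t - \<Omega>d t) = \<gamma> / 2 * shift_angle b \<gamma> t"
  using assms shift_angle_le(1)[of b \<gamma> t]
  by (simp add: shifted_\<Omega>d_eq norm_SO3_mult_vec norm_SO3_mult_vec[OF SO3_transpose] norm_e3 abs_mult
      del: transpose_matrix_vector)

lemma shifted_reference_tendsto:
  assumes ref: "reference_trajectory Rd \<Omega>d" and U: "U \<in> SO3" and b: "0 < b" "0 < \<gamma>"
  shows "((\<lambda>t. norm (shifted_Rd U b \<gamma> Rd t - Rd t)) \<longlongrightarrow> 0) at_top"
    and "((\<lambda>t. norm (shifted_\<Omega>d U b \<gamma> Rd \<Omega>d t - \<Omega>d t)) \<longlongrightarrow> 0) at_top"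
proof -
  have Rd: "Rd t \<in> SO3" if "0 \<le> t" for t using ref that by (auto simp: reference_trajectory_def)
  note lim = shift_angle_tendsto_0[OF b(2), of b]
  have "((\<lambda>t. sqrt (4 * (1 - cos (shift_angle b \<gamma> t)))) \<longlongrightarrow> sqrt (4 * (1 - cos 0))) at_top"
    by (intro tendsto_intros lim)
  moreover have "norm (shifted_Rd U b \<gamma> Rd t - Rd t) = sqrt (4 * (1 - cos (shift_angle b \<gamma> t)))" if "0 \<le> t" for t
    using norm_shifted_Rd_diff[of U Rd t b \<gamma>] U Rd[OF that]
    by (metis norm_ge_zero real_sqrt_unique)
  ultimately show "((\<lambda>t. norm (shifted_Rd U b \<gamma> Rd t - Rd t)) \<longlongrightarrow> 0) at_top"
    by (subst tendsto_cong[of _ "\<lambda>t. sqrt (4 * (1 - cos (shift_angle b \<gamma> t)))"])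
      (auto simp: eventually_at_top_linorder)
  have "((\<lambda>t. \<gamma> / 2 * shift_angle b \<gamma> t) \<longlongrightarrow> \<gamma> / 2 * 0) at_top"
    by (intro tendsto_intros lim)
  moreover have "norm (shifted_\<Omega>d U b \<gamma> Rd \<Omega>d t - \<Omega>d t) = \<gamma> / 2 * shift_angle b \<gamma> t" if "0 \<le> t" for t
    by (rule norm_shifted_\<Omega>d_diff) (use U Rd that b in auto)
  ultimately show "((\<lambda>t. norm (shifted_\<Omega>d U b \<gamma> Rd \<Omega>d t - \<Omega>d t)) \<longlongrightarrow> 0) at_top"
    by (subst tendsto_cong[of _ "\<lambda>t. \<gamma> / 2 * shift_angle b \<gamma> t"]) (auto simp: eventually_at_top_linorder)
qed

lemma norm_diff_tendsto_trans:
  fixes f g h :: "'a \<Rightarrow> 'b::real_normed_vector"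
  assumes "((\<lambda>t. norm (f t - g t)) \<longlongrightarrow> 0) F" "((\<lambda>t. norm (g t - h t)) \<longlongrightarrow> 0) F"
  shows "((\<lambda>t. norm (f t - h t)) \<longlongrightarrow> 0) F"
proof -
  have "((\<lambda>t. (f t - g t) + (g t - h t)) \<longlongrightarrow> 0 + 0) F"
    using assms unfolding tendsto_norm_zero_iff by (rule tendsto_add)
  then show ?thesis by (simp add: tendsto_norm_zero_iff)
qed

lemma V0_initial:
  assumes "U \<in> SO3" "Rd 0 \<in> SO3" "R0 = U ** Zrot \<theta> ** transpose U ** Rd 0"
  shows "V0 kR Rd \<Omega>d R0 \<Omega>0 0 = kR * (1 - cos \<theta>) + (norm (\<Omega>0 - \<Omega>d 0))\<^sup>2 / 2"
  using norm_shifted_diff[OF assms(1,2), of \<theta> 0] assms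
  by (simp add: V0_def Zrot_0 SO3_orthogonal)

text \<open>The trade made by the shift: the attitude angle to be overcome drops from
  \<open>\<theta>\<close> to \<open>\<theta> - b\<close>, and the velocity error grows by at most
  \<open>\<gamma> / 2 * b\<close>, the initial speed of the added rotation.\<close>

lemma V0_initial_shifted:
  assumes "U \<in> SO3" "Rd 0 \<in> SO3" "R0 = U ** Zrot \<theta> ** transpose U ** Rd 0" "0 < b" "0 < \<gamma>" "0 < kR"
  shows "V0 kR (shifted_Rd U b \<gamma> Rd) (shifted_\<Omega>d U b \<gamma> Rd \<Omega>d) R0 \<Omega>0 0
    \<le> kR * (1 - cos (\<theta> - b)) + (norm (\<Omega>0 - \<Omega>d 0) + \<gamma> / 2 * b)\<^sup>2 / 2"
proof -
  have b0: "shift_angle b \<gamma> 0 = b" by (simp add: shift_angle_def)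
  have "norm (\<Omega>0 - shifted_\<Omega>d U b \<gamma> Rd \<Omega>d 0)
      \<le> norm (\<Omega>0 - \<Omega>d 0) + norm (shifted_\<Omega>d U b \<gamma> Rd \<Omega>d 0 - \<Omega>d 0)"
    using norm_triangle_ineq4[of "\<Omega>0 - \<Omega>d 0" "shifted_\<Omega>d U b \<gamma> Rd \<Omega>d 0 - \<Omega>d 0"] by simp
  also have "norm (shifted_\<Omega>d U b \<gamma> Rd \<Omega>d 0 - \<Omega>d 0) = \<gamma> / 2 * b"
    using norm_shifted_\<Omega>d_diff[of U Rd 0 b \<gamma> \<Omega>d] assms b0 by simp
  finally have e\<Omega>: "(norm (\<Omega>0 - shifted_\<Omega>d U b \<gamma> Rd \<Omega>d 0))\<^sup>2 \<le> (norm (\<Omega>0 - \<Omega>d 0) + \<gamma> / 2 * b)\<^sup>2"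
    by (intro power_mono) auto
  have eR: "(norm (R0 - shifted_Rd U b \<gamma> Rd 0))\<^sup>2 = 4 * (1 - cos (\<theta> - b))"
    using norm_shifted_diff[OF assms(1,2), of \<theta> b] assms(3) by (simp add: shifted_Rd_def b0)
  have h: "kR / 4 * (4 * (1 - cos (\<theta> - b))) = kR * (1 - cos (\<theta> - b))" by (simp add: field_simps)
  show ?thesis unfolding V0_def eR h using e\<Omega> by simp
qed

text \<open>The second assumption excludes a maximum over the empty set: for
  \<open>\<theta> = 0\<close> the second entry is omitted, and the first one is then
  present.\<close>

lemma rate_bound_cases:
  assumes "x < rate_bound a \<mu> \<epsilon> k\<Delta> \<delta> \<theta> b \<gamma> kR" and "\<theta> = 0 \<Longrightarrow> 0 \<le> level_B a \<mu> k\<Delta> \<delta> kR"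
  shows "(level_B a \<mu> k\<Delta> \<delta> kR - kR * (1 - cos \<theta>) \<ge> 0 \<and> x < sqrt (level_B a \<mu> k\<Delta> \<delta> kR - kR * (1 - cos \<theta>)))
    \<or> (\<theta> \<noteq> 0 \<and> x < sqrt (2 * (1 - \<epsilon>) * level_B a \<mu> k\<Delta> \<delta> kR) - \<gamma> / 2 * b)"
  using assms unfolding rate_bound_def Let_def by (auto split: if_splits)

text \<open>The quotient tends to 1, so the level grows like \<open>2 * a * k\<close>.\<close>

lemma level_B_at_top:
  assumes "0 < a"
  shows "filterlim (\<lambda>k. level_B a \<mu> k\<Delta> \<delta> k) at_top at_top"
proof -
  have "((\<lambda>k. 2 * a * ((sqrt k - \<mu>) / (sqrt k + \<mu>))) \<longlongrightarrow> 2 * a * 1) at_top"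
  proof (intro tendsto_intros)
    have "((\<lambda>x. (x - \<mu>) / (x + \<mu>)) \<longlongrightarrow> 1) at_top"
    proof -
      have "filterlim (\<lambda>x. \<mu> + x) at_top at_top"
        by (intro filterlim_tendsto_add_at_top[OF tendsto_const] filterlim_ident)
      then have "((\<lambda>x. 1 - 2 * \<mu> * inverse (\<mu> + x)) \<longlongrightarrow> 1 - 2 * \<mu> * 0) at_top"
        by (intro tendsto_intros tendsto_inverse_0_at_top)
      then have lim: "((\<lambda>x. 1 - 2 * \<mu> * inverse (\<mu> + x)) \<longlongrightarrow> 1) at_top" by simp
      have "1 - 2 * \<mu> * inverse (\<mu> + x) = (x - \<mu>) / (x + \<mu>)" if "x \<ge> \<bar>\<mu>\<bar> + 1" for x
      proof -
        have "\<mu> + x \<noteq> 0" using that by linarith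
        then show ?thesis by (simp add: field_simps)
      qed
      then show ?thesis using lim
        by (subst tendsto_cong[of _ "\<lambda>x. 1 - 2 * \<mu> * inverse (\<mu> + x)"])
          (auto simp: eventually_at_top_linorder intro!: exI[of _ "\<bar>\<mu>\<bar> + 1"])
    qed
    then show "((\<lambda>k. (sqrt k - \<mu>) / (sqrt k + \<mu>)) \<longlongrightarrow> 1) at_top"
      using sqrt_at_top by (rule filterlim_compose)
  qed
  then have "filterlim (\<lambda>k. 2 * a * ((sqrt k - \<mu>) / (sqrt k + \<mu>)) * k) at_top at_top"
    by (rule filterlim_tendsto_pos_mult_at_top[OF _ _ filterlim_ident]) (use assms in simp)
  then have "filterlim (\<lambda>k. - (1 / (2 * k\<Delta>) * \<delta>\<^sup>2) + 2 * a * ((sqrt k - \<mu>) / (sqrt k + \<mu>)) * k) at_top at_top"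
    by (intro filterlim_tendsto_add_at_top[OF tendsto_const])
  then show ?thesis by (simp only: level_B_def add.commute[of "- _"] diff_conv_add_uminus)
qed

text \<open>The maximum dominates an entry that is certain to be present: the second one for
  \<open>\<theta> \<noteq> 0\<close>; for \<open>\<theta> = 0\<close> the first one, which is the
  square root of the level as soon as the level is nonnegative.\<close>

lemma rate_bound_at_top:
  assumes "0 < a" "\<epsilon> < 1"
  shows "filterlim (\<lambda>k. rate_bound a \<mu> \<epsilon> k\<Delta> \<delta> \<theta> b \<gamma> k) at_top at_top"
proof (cases "\<theta> = 0")
  case True
  have "filterlim (\<lambda>k. sqrt (level_B a \<mu> k\<Delta> \<delta> k)) at_top at_top"
    using sqrt_at_top level_B_at_top[OF assms(1)] by (rule filterlim_compose)
  moreover have "eventually (\<lambda>k. sqrt (level_B a \<mu> k\<Delta> \<delta> k) \<le> rate_bound a \<mu> \<epsilon> k\<Delta> \<delta> \<theta> b \<gamma> k) at_top"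
  proof -
    have "eventually (\<lambda>k. 0 \<le> level_B a \<mu> k\<Delta> \<delta> k) at_top"
      using level_B_at_top[OF assms(1)] unfolding filterlim_at_top by blast
    then show ?thesis
    proof eventually_elim
      case (elim k)
      then show ?case unfolding rate_bound_def Let_def True by (intro Max_ge) auto
    qed
  qed
  ultimately show ?thesis by (rule filterlim_at_top_mono)
next
  case False
  have "filterlim (\<lambda>k. 2 * (1 - \<epsilon>) * level_B a \<mu> k\<Delta> \<delta> k) at_top at_top"
    using assms by (intro filterlim_tendsto_pos_mult_at_top[OF tendsto_const] level_B_at_top) auto
  then have "filterlim (\<lambda>k. sqrt (2 * (1 - \<epsilon>) * level_B a \<mu> k\<Delta> \<delta> k)) at_top at_top"
    by (rule filterlim_compose[OF sqrt_at_top])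
  then have "filterlim (\<lambda>k. - (\<gamma> / 2 * b) + sqrt (2 * (1 - \<epsilon>) * level_B a \<mu> k\<Delta> \<delta> k)) at_top at_top"
    by (intro filterlim_tendsto_add_at_top[OF tendsto_const])
  moreover have "- (\<gamma> / 2 * b) + sqrt (2 * (1 - \<epsilon>) * level_B a \<mu> k\<Delta> \<delta> k) \<le> rate_bound a \<mu> \<epsilon> k\<Delta> \<delta> \<theta> b \<gamma> k" for k
    unfolding rate_bound_def Let_def using False by (intro Max_ge) auto
  then have "eventually (\<lambda>k. - (\<gamma> / 2 * b) + sqrt (2 * (1 - \<epsilon>) * level_B a \<mu> k\<Delta> \<delta> k)
      \<le> rate_bound a \<mu> \<epsilon> k\<Delta> \<delta> \<theta> b \<gamma> k) at_top" by simp
  ultimately show ?thesis by (rule filterlim_at_top_mono)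
qed

text \<open>The upper limit on \<open>\<gamma>\<close> says exactly that the second entry is
  positive. Positivity of the bound admits zero initial velocity error, hence every initial
  attitude.\<close>

lemma rate_bound_pos:
  assumes B: "0 < level_B a \<mu> k\<Delta> \<delta> kR" and "0 \<le> \<theta>"
    and g: "0 < \<theta> \<Longrightarrow> 0 < b \<and> \<gamma> < 2 / b * sqrt (2 * (1 - \<epsilon>) * level_B a \<mu> k\<Delta> \<delta> kR)"
  shows "0 < rate_bound a \<mu> \<epsilon> k\<Delta> \<delta> \<theta> b \<gamma> kR"
proof (cases "\<theta> = 0")
  case True
  then show ?thesis using B by (simp add: rate_bound_def)
next
  case False
  then have "0 < sqrt (2 * (1 - \<epsilon>) * level_B a \<mu> k\<Delta> \<delta> kR) - \<gamma> / 2 * b"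
    using g assms(2) by (auto simp: field_simps)
  also have "\<dots> \<le> rate_bound a \<mu> \<epsilon> k\<Delta> \<delta> \<theta> b \<gamma> kR"
    unfolding rate_bound_def Let_def using False by (intro Max_ge) auto
  finally show ?thesis .
qed

text \<open>Existence of a closed-loop solution stands beside the convergence claim so that the
  limits are not vacuous, and both are asserted for every admissible frame \<open>U0\<close>. In the
  last conjunct \<open>\<theta>b0\<close> and \<open>\<gamma>\<close> stay fixed while the gain
  varies.\<close>

theorem mainTheorem13:
  fixes J :: "real^3^3"
    and Rd :: "real \<Rightarrow> real^3^3" and \<Omega>d :: "real \<Rightarrow> real^3"
    and kR k\<Omega> k\<Delta> a \<mu> \<epsilon> \<delta> B :: real
    and \<theta>0 \<theta>b0 \<gamma> :: "real^3^3 \<Rightarrow> real"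
  defines "B \<equiv> level_B a \<mu> k\<Delta> \<delta> kR"
    and "\<theta>0 \<equiv> initial_angle (Rd 0)"
  assumes J: "sym_pos_def J"
    and reference: "reference_trajectory Rd \<Omega>d"
    and pos: "0 < \<delta>" "0 < kR" "0 < k\<Omega>" "0 < k\<Delta>"
    and a: "0 < a" "a < 1"
    and eps: "0 < \<epsilon>" "\<epsilon> < 1"
    and mu: "0 < \<mu>" "\<mu> < 4 * (1 - a) * kR * k\<Omega> / (4 * (1 - a) * kR + k\<Omega>\<^sup>2)"
    and B: "B > 0"
    and theta_b0: "\<And>R0. R0 \<in> SO3 \<Longrightarrow> \<theta>0 R0 > 0 \<Longrightarrow> 0 < \<theta>b0 R0 \<and> \<theta>b0 R0 < \<theta>0 R0"
    and shift: "\<And>R0. R0 \<in> SO3 \<Longrightarrow> \<theta>0 R0 > 0 \<Longrightarrow>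
      1 - cos (\<theta>0 R0 - \<theta>b0 R0)
        \<le> (2 * a * ((sqrt kR - \<mu>) / (sqrt kR + \<mu>)) - 1 / (2 * k\<Delta> * kR) * \<delta>\<^sup>2) * \<epsilon>"
    and gamma: "\<And>R0. R0 \<in> SO3 \<Longrightarrow> \<theta>0 R0 > 0 \<Longrightarrow>
      0 < \<gamma> R0 \<and> \<gamma> R0 < 2 / \<theta>b0 R0 * sqrt (2 * (1 - \<epsilon>) * B)"
  shows
    "(\<forall>(R0, \<Omega>0) \<in> region a \<mu> \<epsilon> k\<Delta> \<delta> kR \<theta>b0 \<gamma> Rd \<Omega>d.
        \<forall>\<Delta>. norm \<Delta> \<le> \<delta> \<longrightarrow>
        (\<forall>U0 \<in> SO3. R0 = U0 ** Zrot (\<theta>0 R0) ** transpose U0 ** Rd 0 \<longrightarrow>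
           (\<exists>R \<Omega> Db \<tau>. R 0 = R0 \<and> \<Omega> 0 = \<Omega>0 \<and>
              closed_loop J kR k\<Omega> k\<Delta> a \<mu> \<delta> Rd \<Omega>d U0 (\<theta>b0 R0) (\<gamma> R0) \<Delta> R \<Omega> Db \<tau>) \<and>
           (\<forall>R \<Omega> Db \<tau>. R 0 = R0 \<and> \<Omega> 0 = \<Omega>0 \<and>
              closed_loop J kR k\<Omega> k\<Delta> a \<mu> \<delta> Rd \<Omega>d U0 (\<theta>b0 R0) (\<gamma> R0) \<Delta> R \<Omega> Db \<tau> \<longrightarrow>
              ((\<lambda>t. norm (R t - Rd t)) \<longlongrightarrow> 0) at_top \<and>
              ((\<lambda>t. norm (\<Omega> t - \<Omega>d t)) \<longlongrightarrow> 0) at_top \<and>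
              ((\<lambda>t. norm (\<Delta> - Db t)) \<longlongrightarrow> 0) at_top))) \<and>
     (\<forall>R0 \<in> SO3. \<exists>\<Omega>0. (R0, \<Omega>0) \<in> region a \<mu> \<epsilon> k\<Delta> \<delta> kR \<theta>b0 \<gamma> Rd \<Omega>d) \<and>
     (\<forall>R0 \<in> SO3.
        filterlim (\<lambda>k. rate_bound a \<mu> \<epsilon> k\<Delta> \<delta> (\<theta>0 R0) (\<theta>b0 R0) (\<gamma> R0) k) at_top at_top)"
proof (intro conjI)
  interpret gains: adaptive_gains J kR k\<Omega> k\<Delta> a \<mu> \<delta>
    using J pos a mu by unfold_locales
  have Rd0: "Rd 0 \<in> SO3" using reference by (simp add: reference_trajectory_def)
  have angle_nonneg: "0 \<le> \<theta>0 R0" if "R0 \<in> SO3" for R0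
    using initial_angle(1)[OF Rd0 that] by (simp add: \<theta>0_def)
  show "\<forall>R0\<in>SO3. filterlim (\<lambda>k. rate_bound a \<mu> \<epsilon> k\<Delta> \<delta> (\<theta>0 R0) (\<theta>b0 R0) (\<gamma> R0) k) at_top at_top"
    using rate_bound_at_top a eps by blast
  show "\<forall>R0\<in>SO3. \<exists>\<Omega>0. (R0, \<Omega>0) \<in> region a \<mu> \<epsilon> k\<Delta> \<delta> kR \<theta>b0 \<gamma> Rd \<Omega>d"
  proof (intro ballI exI)
    fix R0 assume R0: "R0 \<in> SO3"
    have "0 < rate_bound a \<mu> \<epsilon> k\<Delta> \<delta> (\<theta>0 R0) (\<theta>b0 R0) (\<gamma> R0) kR"
      using B theta_b0[OF R0] gamma[OF R0] angle_nonneg[OF R0]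
      unfolding B_def by (intro rate_bound_pos) auto
    then show "(R0, \<Omega>d 0) \<in> region a \<mu> \<epsilon> k\<Delta> \<delta> kR \<theta>b0 \<gamma> Rd \<Omega>d"
      using R0 by (simp add: region_def \<theta>0_def)
  qed
  show "\<forall>(R0, \<Omega>0) \<in> region a \<mu> \<epsilon> k\<Delta> \<delta> kR \<theta>b0 \<gamma> Rd \<Omega>d.
        \<forall>\<Delta>. norm \<Delta> \<le> \<delta> \<longrightarrow>
        (\<forall>U0 \<in> SO3. R0 = U0 ** Zrot (\<theta>0 R0) ** transpose U0 ** Rd 0 \<longrightarrow>
           (\<exists>R \<Omega> Db \<tau>. R 0 = R0 \<and> \<Omega> 0 = \<Omega>0 \<and>
              closed_loop J kR k\<Omega> k\<Delta> a \<mu> \<delta> Rd \<Omega>d U0 (\<theta>b0 R0) (\<gamma> R0) \<Delta> R \<Omega> Db \<tau>) \<and>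
           (\<forall>R \<Omega> Db \<tau>. R 0 = R0 \<and> \<Omega> 0 = \<Omega>0 \<and>
              closed_loop J kR k\<Omega> k\<Delta> a \<mu> \<delta> Rd \<Omega>d U0 (\<theta>b0 R0) (\<gamma> R0) \<Delta> R \<Omega> Db \<tau> \<longrightarrow>
              ((\<lambda>t. norm (R t - Rd t)) \<longlongrightarrow> 0) at_top \<and>
              ((\<lambda>t. norm (\<Omega> t - \<Omega>d t)) \<longlongrightarrow> 0) at_top \<and>
              ((\<lambda>t. norm (\<Delta> - Db t)) \<longlongrightarrow> 0) at_top))"
  proof (rule ballI, clarify)
    fix R0 :: "real^3^3" and \<Omega>0 \<Delta> :: "real^3" and U0 :: "real^3^3"
    assume reg: "(R0, \<Omega>0) \<in> region a \<mu> \<epsilon> k\<Delta> \<delta> kR \<theta>b0 \<gamma> Rd \<Omega>d"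
      and \<Delta>: "norm \<Delta> \<le> \<delta>" and U0: "U0 \<in> SO3"
      and R0eq: "R0 = U0 ** Zrot (\<theta>0 R0) ** transpose U0 ** Rd 0"
    define \<theta> b g where "\<theta> = \<theta>0 R0" and "b = \<theta>b0 R0" and "g = \<gamma> R0"
    have R0: "R0 \<in> SO3"
      and rate: "norm (\<Omega>0 - \<Omega>d 0) < rate_bound a \<mu> \<epsilon> k\<Delta> \<delta> \<theta> b g kR"
      using reg by (auto simp: region_def \<theta>0_def \<theta>_def b_def g_def)
    note R0eq' = R0eq[folded \<theta>_def]
    let ?loop = "closed_loop J kR k\<Omega> k\<Delta> a \<mu> \<delta> Rd \<Omega>d U0 b g \<Delta>"
    have "(\<exists>R \<Omega> Db \<tau>. R 0 = R0 \<and> \<Omega> 0 = \<Omega>0 \<and> ?loop R \<Omega> Db \<tau>) \<and>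
       (\<forall>R \<Omega> Db \<tau>. R 0 = R0 \<and> \<Omega> 0 = \<Omega>0 \<and> ?loop R \<Omega> Db \<tau> \<longrightarrow>
              ((\<lambda>t. norm (R t - Rd t)) \<longlongrightarrow> 0) at_top \<and>
              ((\<lambda>t. norm (\<Omega> t - \<Omega>d t)) \<longlongrightarrow> 0) at_top \<and>
              ((\<lambda>t. norm (\<Delta> - Db t)) \<longlongrightarrow> 0) at_top)"
    proof (cases "V0 kR Rd \<Omega>d R0 \<Omega>0 0 \<le> B")
      case True
      interpret tracking_reference Rd \<Omega>d "tderiv \<Omega>d"
        using reference by (rule tracking_reference_original)
      interpret closed_tracking_loop J kR k\<Omega> k\<Delta> a \<mu> \<delta> Rd \<Omega>d
        by unfold_locales
      have loop: "?loop R \<Omega> Db \<tau> \<longleftrightarrow> plant J \<Delta> \<tau> R \<Omega> \<and> adaptive_tracking J kR k\<Omega> k\<Delta> \<mu> Rd \<Omega>d R \<Omega> Db \<tau>"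
        if "R 0 = R0" "\<Omega> 0 = \<Omega>0" for R \<Omega> Db \<tau>
        using True that by (simp add: closed_loop_def B_def)
      show ?thesis
      proof (intro conjI allI impI)
        show "\<exists>R \<Omega> Db \<tau>. R 0 = R0 \<and> \<Omega> 0 = \<Omega>0 \<and> ?loop R \<Omega> Db \<tau>"
          using loop loop_exists[OF R0 \<Delta> True[unfolded B_def]] by blast
        fix R \<Omega> Db \<tau>
        assume "R 0 = R0 \<and> \<Omega> 0 = \<Omega>0 \<and> ?loop R \<Omega> Db \<tau>"
        then have pl: "plant J \<Delta> \<tau> R \<Omega>"
          and ad: "adaptive_tracking J kR k\<Omega> k\<Delta> \<mu> Rd \<Omega>d R \<Omega> Db \<tau>"
          and V: "V0 kR Rd \<Omega>d (R 0) (\<Omega> 0) 0 \<le> level_B a \<mu> k\<Delta> \<delta> kR"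
          using loop True by (auto simp: B_def)
        note lim = loop_converges[OF \<Delta> V pl ad]
        show "((\<lambda>t. norm (R t - Rd t)) \<longlongrightarrow> 0) at_top" by (rule lim(1))
        show "((\<lambda>t. norm (\<Omega> t - \<Omega>d t)) \<longlongrightarrow> 0) at_top" by (rule lim(2))
        show "((\<lambda>t. norm (\<Delta> - Db t)) \<longlongrightarrow> 0) at_top" by (rule lim(3))
      qed
    next
      case False
      have "V0 kR Rd \<Omega>d R0 \<Omega>0 0 = kR * (1 - cos \<theta>) + (norm (\<Omega>0 - \<Omega>d 0))\<^sup>2 / 2"
        by (rule V0_initial[where U = U0]) (rule U0 Rd0 R0eq')+
      with False have V0: "B < kR * (1 - cos \<theta>) + (norm (\<Omega>0 - \<Omega>d 0))\<^sup>2 / 2" by simp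
      \<comment> \<open>Above the level \<open>B\<close> the first entry of the maximum cannot be
        the operative one: it would bound the attitude energy plus the full square of the velocity
        error by \<open>B\<close>, although half of that square already carries the sum beyond
        \<open>B\<close>.\<close>
      have "\<not> norm (\<Omega>0 - \<Omega>d 0) < sqrt (B - kR * (1 - cos \<theta>))"
      proof
        assume "norm (\<Omega>0 - \<Omega>d 0) < sqrt (B - kR * (1 - cos \<theta>))"
        then have "(norm (\<Omega>0 - \<Omega>d 0))\<^sup>2 < B - kR * (1 - cos \<theta>)"
          using real_le_lsqrt[of "norm (\<Omega>0 - \<Omega>d 0)" "B - kR * (1 - cos \<theta>)"] by force
        then show False using V0 zero_le_power2[of "norm (\<Omega>0 - \<Omega>d 0)"] by linarith
      qed
      then have \<theta>: "\<theta> \<noteq> 0" and e0: "norm (\<Omega>0 - \<Omega>d 0) < sqrt (2 * (1 - \<epsilon>) * B) - g / 2 * b"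
        using rate_bound_cases[OF rate] B by (auto simp: B_def)
      have "0 < \<theta>" using \<theta> angle_nonneg[OF R0] by (simp add: \<theta>_def)
      then have b: "0 < b" "0 < g"
        and cosb: "1 - cos (\<theta> - b) \<le> (2 * a * ((sqrt kR - \<mu>) / (sqrt kR + \<mu>)) - 1 / (2 * k\<Delta> * kR) * \<delta>\<^sup>2) * \<epsilon>"
        using theta_b0[OF R0] gamma[OF R0] shift[OF R0] by (auto simp: \<theta>_def b_def g_def)
      let ?Rs = "shifted_Rd U0 b g Rd" and ?\<Omega>s = "shifted_\<Omega>d U0 b g Rd \<Omega>d"
      interpret tracking_reference ?Rs ?\<Omega>s "tderiv ?\<Omega>s"
        using reference U0 b by (rule tracking_reference_shifted)
      interpret closed_tracking_loop J kR k\<Omega> k\<Delta> a \<mu> \<delta> ?Rs ?\<Omega>s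
        by unfold_locales
      \<comment> \<open>Multiplied by \<open>kR\<close>, the condition on the shift angle says that
        the remaining attitude energy is at most \<open>\<epsilon> * B\<close>. The rate bound
        supplies \<open>(1 - \<epsilon>) * B\<close> for the velocity part.\<close>
      have "kR * (1 - cos (\<theta> - b)) \<le>
          kR * ((2 * a * ((sqrt kR - \<mu>) / (sqrt kR + \<mu>)) - 1 / (2 * k\<Delta> * kR) * \<delta>\<^sup>2) * \<epsilon>)"
        using pos cosb by (intro mult_left_mono) auto
      also have "\<dots> = \<epsilon> * B"
      proof -
        have "kR * ((x - 1 / (2 * k\<Delta> * kR) * y) * \<epsilon>) = \<epsilon> * (x * kR - 1 / (2 * k\<Delta>) * y)" for x y
          using pos by (simp add: field_simps)
        then show ?thesis unfolding B_def level_B_def .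
      qed
      finally have 1: "kR * (1 - cos (\<theta> - b)) \<le> \<epsilon> * B" .
      have "(norm (\<Omega>0 - \<Omega>d 0) + g / 2 * b)\<^sup>2 \<le> (sqrt (2 * (1 - \<epsilon>) * B))\<^sup>2"
        using e0 b by (intro power_mono) auto
      also have "\<dots> = 2 * (1 - \<epsilon>) * B" using eps B by simp
      finally have "kR * (1 - cos (\<theta> - b)) + (norm (\<Omega>0 - \<Omega>d 0) + g / 2 * b)\<^sup>2 / 2 \<le> B"
        using 1 by (simp add: algebra_simps)
      then have V0s: "V0 kR ?Rs ?\<Omega>s R0 \<Omega>0 0 \<le> B"
        using V0_initial_shifted[of U0 Rd R0 \<theta> b g kR \<Omega>d \<Omega>0] U0 Rd0 R0eq' b pos by linarith
      have loop: "?loop R \<Omega> Db \<tau> \<longleftrightarrow> plant J \<Delta> \<tau> R \<Omega> \<and> adaptive_tracking J kR k\<Omega> k\<Delta> \<mu> ?Rs ?\<Omega>s R \<Omega> Db \<tau>"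
        if "R 0 = R0" "\<Omega> 0 = \<Omega>0" for R \<Omega> Db \<tau>
        using False that by (simp add: closed_loop_def B_def)
      note conv = shifted_reference_tendsto[OF reference U0 b]
      show ?thesis
      proof (intro conjI allI impI)
        show "\<exists>R \<Omega> Db \<tau>. R 0 = R0 \<and> \<Omega> 0 = \<Omega>0 \<and> ?loop R \<Omega> Db \<tau>"
          using loop loop_exists[OF R0 \<Delta> V0s[unfolded B_def]] by blast
        fix R \<Omega> Db \<tau>
        assume "R 0 = R0 \<and> \<Omega> 0 = \<Omega>0 \<and> ?loop R \<Omega> Db \<tau>"
        then have pl: "plant J \<Delta> \<tau> R \<Omega>"
          and ad: "adaptive_tracking J kR k\<Omega> k\<Delta> \<mu> ?Rs ?\<Omega>s R \<Omega> Db \<tau>"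
          and V: "V0 kR ?Rs ?\<Omega>s (R 0) (\<Omega> 0) 0 \<le> level_B a \<mu> k\<Delta> \<delta> kR"
          using loop V0s by (auto simp: B_def)
        note lim = loop_converges[OF \<Delta> V pl ad]
        show "((\<lambda>t. norm (R t - Rd t)) \<longlongrightarrow> 0) at_top"
          by (rule norm_diff_tendsto_trans[OF lim(1) conv(1)])
        show "((\<lambda>t. norm (\<Omega> t - \<Omega>d t)) \<longlongrightarrow> 0) at_top"
          by (rule norm_diff_tendsto_trans[OF lim(2) conv(2)])
        show "((\<lambda>t. norm (\<Delta> - Db t)) \<longlongrightarrow> 0) at_top" by (rule lim(3))
      qed
    qed
    then show "(\<exists>R \<Omega> Db \<tau>. R 0 = R0 \<and> \<Omega> 0 = \<Omega>0 \<and>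
              closed_loop J kR k\<Omega> k\<Delta> a \<mu> \<delta> Rd \<Omega>d U0 (\<theta>b0 R0) (\<gamma> R0) \<Delta> R \<Omega> Db \<tau>) \<and>
           (\<forall>R \<Omega> Db \<tau>. R 0 = R0 \<and> \<Omega> 0 = \<Omega>0 \<and>
              closed_loop J kR k\<Omega> k\<Delta> a \<mu> \<delta> Rd \<Omega>d U0 (\<theta>b0 R0) (\<gamma> R0) \<Delta> R \<Omega> Db \<tau> \<longrightarrow>
              ((\<lambda>t. norm (R t - Rd t)) \<longlongrightarrow> 0) at_top \<and>
              ((\<lambda>t. norm (\<Omega> t - \<Omega>d t)) \<longlongrightarrow> 0) at_top \<and>
              ((\<lambda>t. norm (\<Delta> - Db t)) \<longlongrightarrow> 0) at_top)"
      unfolding b_def g_def .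
  qed
qed

end
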